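(* There are uncountably many irrational numbers $\alpha$ for which there exists a smooth function $r:\mathbb{T}^2\to\mathbb{R}^+$ such that the flow $(T^{\alpha,r}_t)$ on $(\mathbb{T}^2,\mu_r)$ is weakly mixing and, for all $x\in\mathbb{T}^2$, the set $\{T^{\alpha,r}_p(x)\mid p\text{ is prime}\}$ is dense in $\mathbb{T}^2$.
   Context: $\mathbb{T}=\mathbb{R}/\mathbb{Z}$, $\mathbb{T}^2=\mathbb{T}\times\mathbb{T}$, and $\mathbb{R}^+$ denotes the positive reals. For an irrational $\alpha$ and a smooth $r:\mathbb{T}^2\to\mathbb{R}^+$, $(T^{\alpha,r}_t)_{t\in\mathbb{R}}$ denotes the flow on $\mathbb{T}^2$ generated by $\frac{dx}{dt}=r(x,y)$, $\frac{dy}{dt}=\alpha\, r(x,y)$ (a reparametrization of the linear flow in direction $\alpha$), and $\mu_r$ denotes its unique invariant Borel probability measure. *)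

theory Defs
  imports "HOL-Probability.Probability" "HOL-Computational_Algebra.Primes"
begin

quotient_type circle = real / "\<lambda>x y. x - y \<in> \<int>"
  morphisms rep_circle circle_of
proof (rule equivpI)
  show "reflp (\<lambda>x y :: real. x - y \<in> \<int>)"
    by (simp add: reflp_def)
  show "symp (\<lambda>x y :: real. x - y \<in> \<int>)"
  proof (rule sympI)
    fix x y :: real
    assume "x - y \<in> \<int>"
    then have "- (x - y) \<in> \<int>" by (rule Ints_minus)
    then show "y - x \<in> \<int>" by simp
  qed
  show "transp (\<lambda>x y :: real. x - y \<in> \<int>)"
  proof (rule transpI)
    fix x y z :: real
    assume "x - y \<in> \<int>" "y - z \<in> \<int>"
    then have "(x - y) + (y - z) \<in> \<int>" by (rule Ints_add)
    then show "x - z \<in> \<int>" by simp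
  qed
qed

instantiation circle :: topological_space
begin

definition open_circle :: "circle set \<Rightarrow> bool" where
  "open_circle U \<longleftrightarrow> open (circle_of -` U)"

instance
proof
  show "open (UNIV :: circle set)"
    by (simp add: open_circle_def)
  show "open (S \<inter> T)" if "open S" "open T" for S T :: "circle set"
    using that by (simp add: open_circle_def vimage_Int open_Int)
  show "open (\<Union> K)" if "\<forall>S\<in>K. open S" for K :: "circle set set"
    using that by (auto simp: open_circle_def vimage_Union)
qed

end

type_synonym torus = "circle \<times> circle"

definition torus_of :: "real \<times> real \<Rightarrow> torus" where
  "torus_of = map_prod circle_of circle_of"

fun C_k :: "nat \<Rightarrow> ('a::euclidean_space \<Rightarrow> real) \<Rightarrow> bool" where
  "C_k 0 f \<longleftrightarrow> continuous_on UNIV f"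
| "C_k (Suc k) f \<longleftrightarrow>
     (\<exists>f'. (\<forall>x. (f has_derivative f' x) (at x)) \<and> (\<forall>v. C_k k (\<lambda>x. f' x v)))"

definition smooth_on_torus :: "(torus \<Rightarrow> real) \<Rightarrow> bool" where
  "smooth_on_torus r \<longleftrightarrow> (\<forall>k. C_k k (r \<circ> torus_of))"

text \<open>The differential equation on the torus is read through a lift \<open>(x, y)\<close> of the orbit to the
  plane. Picard--Lindeloef makes \<open>\<phi>\<close> unique for a given smooth \<open>r\<close>.\<close>

definition is_reparam_flow :: "real \<Rightarrow> (torus \<Rightarrow> real) \<Rightarrow> (real \<Rightarrow> torus \<Rightarrow> torus) \<Rightarrow> bool" where
  "is_reparam_flow \<alpha> r \<phi> \<longleftrightarrow>
     (\<forall>p. \<phi> 0 p = p \<and>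
        (\<exists>x y. \<forall>t. \<phi> t p = torus_of (x t, y t) \<and>
           (x has_real_derivative r (\<phi> t p)) (at t) \<and>
           (y has_real_derivative \<alpha> * r (\<phi> t p)) (at t)))"

definition invariant_prob ::
    "(real \<Rightarrow> 'a \<Rightarrow> 'a) \<Rightarrow> 'a::topological_space measure \<Rightarrow> bool" where
  "invariant_prob \<phi> \<mu> \<longleftrightarrow>
     prob_space \<mu> \<and> sets \<mu> = sets borel \<and>
     (\<forall>t. \<phi> t \<in> measurable \<mu> \<mu> \<and> distr \<mu> \<mu> (\<phi> t) = \<mu>)"

definition unique_invariant_prob ::
    "(real \<Rightarrow> 'a \<Rightarrow> 'a) \<Rightarrow> 'a::topological_space measure \<Rightarrow> bool" where
  "unique_invariant_prob \<phi> \<mu> \<longleftrightarrow>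
     invariant_prob \<phi> \<mu> \<and> (\<forall>\<nu>. invariant_prob \<phi> \<nu> \<longrightarrow> \<nu> = \<mu>)"

text \<open>For a continuous flow the integrand below is bounded and Borel in \<open>t\<close>, so the integral
  does not take its default value.\<close>

definition weakly_mixing :: "'a measure \<Rightarrow> (real \<Rightarrow> 'a \<Rightarrow> 'a) \<Rightarrow> bool" where
  "weakly_mixing \<mu> \<phi> \<longleftrightarrow>
     (\<forall>A\<in>sets \<mu>. \<forall>B\<in>sets \<mu>.
        ((\<lambda>T. (1 / T) * (LINT t:{0..T}|lborel.
            \<bar>measure \<mu> (A \<inter> (\<phi> t -` B \<inter> space \<mu>)) - measure \<mu> A * measure \<mu> B\<bar>))
          \<longlongrightarrow> 0) at_top)"

end

theory Submission
  imports Defs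
begin

text \<open>Put \<open>f = 1 / r\<close> and \<open>v = (1, \<alpha>)\<close>. If \<open>f = c + \<partial>\<^sub>v u\<close> with a periodic \<open>u\<close>, the flow is conjugate to the
  linear flow with constant speed \<open>1 / c\<close>. For a Baire-generic \<open>c\<close> the points \<open>(p / c) v\<close>, \<open>p\<close> prime, are
  dense modulo \<open>\<int>\<^sup>2\<close> (only the infinity of the primes matters), so all prime orbits are dense,
  uniformly in the starting point. Now \<open>\<alpha>\<close> is taken Liouville and \<open>u\<close> is changed by a large wave
  \<open>A sin 2\<pi>(q y - p x)\<close>, where \<open>\<beta> = q \<alpha> - p\<close> is so small that \<open>f\<close> hardly changes in any \<open>C\<^sup>k\<close> norm. At time
  \<open>c / (2 \<bar>\<beta>\<bar>)\<close> short vertical segments have been stretched into long orbit pieces, which are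
  equidistributed, so the flow is almost mixing at that time. Almost density of the prime orbits and almost
  mixing at one time survive small uniform perturbations of \<open>f\<close>; iterating gives a smooth limit \<open>f\<close>
  with both properties at every precision. Mixing along a sequence of times implies weak mixing,
  by Bessel's inequality applied to time shifts.\<close>

section \<open>Averages of periodic functions\<close>

text \<open>A flow that admits a transfer function \<open>u\<close> is conjugate to a linear one and
  hence never weakly mixing, so the limit has to lose the coboundary form that makes each stage
  computable. This dictates the order of choices. The amplitude \<open>A\<close> of a new wave
  depends on the stage reached and on the precision, not on \<open>q\<close>; the transfer functions
  may grow without control, while \<open>f\<close> changes only by \<open>2 \<pi> A \<beta>\<close>,
  which a Liouville slope makes small even after multiplication by any power of \<open>q\<close>.
  Whatever must survive is a condition on a bounded range of times, and its radius of stability is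
  handed to the later stages as a budget. The constant \<open>c\<close> is never touched, so that
  one generic choice serves all stages. The normalisation \<open>f \<ge> 1\<close> makes travel
  times dominate distances and removes constants from the comparison of flows;
  \<open>c \<ge> 2\<close> leaves room for the waves above that bound. All the dynamics takes place
  among periodic functions on the plane; the torus and its measures enter only at the end.\<close>

definition periodic :: "(real \<times> real \<Rightarrow> 'b) \<Rightarrow> bool" where
  "periodic g \<longleftrightarrow> (\<forall>z. \<forall>m\<in>\<int> \<times> \<int>. g (z + m) = g z)"

text \<open>Test functions with explicit constants: equidistribution and mixing are always stated uniformly over
  such a class, which dispenses with a countable dense set of test functions.\<close>

definition lip_per :: "real \<Rightarrow> real \<Rightarrow> (real \<times> real \<Rightarrow> real) \<Rightarrow> bool" where
  "lip_per K B g \<longleftrightarrow> periodic g \<and> (\<forall>z. \<bar>g z\<bar> \<le> B) \<and> (\<forall>z w. \<bar>g z - g w\<bar> \<le> K * norm (z - w))"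

definition mean :: "(real \<times> real \<Rightarrow> real) \<Rightarrow> real" where
  "mean g = integral (cbox (0, 0) (1, 1)) g"

section \<open>Antiderivatives and one-dimensional periodic integrals\<close>

text \<open>Orbit integrals are handled through antiderivatives on the whole line. The oriented
  interval integral supplies one; \<open>integral {0..s}\<close> would vanish for negative
  \<open>s\<close>.\<close>

lemma antiderivative_exists:
  fixes g :: "real \<Rightarrow> real"
  assumes "continuous_on UNIV g"
  shows "\<exists>G. (\<forall>s. (G has_real_derivative g s) (at s)) \<and> G 0 = 0"
proof (intro exI conjI allI)
  let ?G = "\<lambda>u. LBINT y=ereal 0..ereal u. g y"
  fix s :: real
  have "(?G has_vector_derivative (g s)) (at s within {-\<bar>s\<bar> - 1..\<bar>s\<bar> + 1})"
    by (rule interval_integral_FTC2) (auto intro: continuous_on_subset[OF assms])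
  moreover have "at s within {-\<bar>s\<bar> - 1..\<bar>s\<bar> + 1} = at s"
    by (rule at_within_interior) auto
  ultimately show "(?G has_real_derivative g s) (at s)"
    by (simp add: has_real_derivative_iff_has_vector_derivative)
next
  show "(LBINT y=ereal 0..ereal 0. g y) = 0" by simp
qed

lemma integral_antiderivative:
  fixes g :: "real \<Rightarrow> real"
  assumes "\<And>s. (G has_real_derivative g s) (at s)" "a \<le> b"
  shows "(g has_integral (G b - G a)) {a..b}" "integral {a..b} g = G b - G a"
proof -
  show "(g has_integral (G b - G a)) {a..b}"
    using assms by (intro fundamental_theorem_of_calculus)
      (auto simp: has_real_derivative_iff_has_vector_derivative[symmetric]
        intro: has_field_derivative_at_within)
  then show "integral {a..b} g = G b - G a" by (rule integral_unique)
qed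

lemma antiderivative_diff_const:
  fixes G H :: "real \<Rightarrow> real"
  assumes "\<And>s. (G has_real_derivative g s) (at s)" "\<And>s. (H has_real_derivative g s) (at s)"
  shows "G s - G 0 = H s - H 0"
proof -
  have "((\<lambda>s. G s - H s) has_real_derivative 0) (at s)" for s
    using DERIV_diff[OF assms(1)[of s] assms(2)[of s]] by simp
  then have "G s - H s = G 0 - H 0"
    by (metis DERIV_isconst_all)
  then show ?thesis by simp
qed

text \<open>Shifting \<open>G\<close> by a period gives another antiderivative of \<open>g\<close>,
  so each period contributes the same increment.\<close>

lemma antiderivative_periodic_step:
  fixes g :: "real \<Rightarrow> real"
  assumes G: "\<And>s. (G has_real_derivative g s) (at s)" and per: "\<And>x. g (x + 1) = g x"
  shows "G (x + real n) - G x = real n * (G 1 - G 0)"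
proof -
  have d: "((\<lambda>s. G (s + 1)) has_real_derivative g s) (at s)" for s
    using G[of "s + 1"] per[of s] by (simp add: DERIV_shift)
  have step: "G (x + 1) = G x + (G 1 - G 0)" for x
    using antiderivative_diff_const[of "\<lambda>s. G (s + 1)" g G x, OF d G] by simp
  show ?thesis
  proof (induction n)
    case (Suc n)
    have "G (x + real (Suc n)) = G ((x + real n) + 1)" by (simp add: algebra_simps)
    also have "\<dots> = G (x + real n) + (G 1 - G 0)" by (rule step)
    finally show ?case using Suc by (simp add: algebra_simps)
  qed simp
qed

text \<open>The factor \<open>q\<close> is meant for waves of frequency \<open>q\<close> in one
  coordinate; \<open>q = 1\<close> is translation invariance.\<close>

lemma integral_periodic_shift_scale:
  fixes g :: "real \<Rightarrow> real"
  assumes c: "continuous_on UNIV g" and per: "\<And>x. g (x + 1) = g x" and q: "q \<ge> (1::nat)"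
  shows "integral {0..1} (\<lambda>x. g (real q * x + b)) = integral {0..1} g"
proof -
  obtain G where G: "\<And>s. (G has_real_derivative g s) (at s)"
    using antiderivative_exists[OF c] by blast
  have "((\<lambda>x. G (real q * x + b) / real q) has_real_derivative g (real q * s + b)) (at s)" for s
    using q by (auto intro!: derivative_eq_intros DERIV_chain2[OF G])
  then have "integral {0..1} (\<lambda>x. g (real q * x + b)) = (G (b + real q) - G b) / real q"
    by (subst integral_antiderivative) (auto simp: diff_divide_distrib add.commute)
  also have "\<dots> = G 1 - G 0"
    using q by (subst antiderivative_periodic_step[OF G per]) auto
  also have "\<dots> = integral {0..1} g"
    by (subst integral_antiderivative[OF G]) auto
  finally show ?thesis .
qed

lemma integral_periodic_shift:
  fixes g :: "real \<Rightarrow> real"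
  assumes "continuous_on UNIV g" "\<And>x. g (x + 1) = g x"
  shows "integral {0..1} (\<lambda>x. g (x + b)) = integral {0..1} g"
  using integral_periodic_shift_scale[OF assms, of 1 b] by simp

section \<open>Closure properties of the class of test functions\<close>

lemma lip_perI:
  assumes "periodic g" "\<And>z. \<bar>g z\<bar> \<le> B" "\<And>z w. \<bar>g z - g w\<bar> \<le> K * norm (z - w)"
  shows "lip_per K B g"
  using assms unfolding lip_per_def by blast

lemma lip_perD:
  assumes "lip_per K B g"
  shows "periodic g" "\<bar>g z\<bar> \<le> B" "\<bar>g z - g w\<bar> \<le> K * norm (z - w)"
  using assms unfolding lip_per_def by blast+

lemma lip_per_nonneg:
  assumes "lip_per K B g"
  shows "K \<ge> 0" "B \<ge> 0"
proof -
  show "B \<ge> 0" using lip_perD(2)[OF assms, of 0] by linarith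
  have "0 \<le> K * norm ((1, 0) - (0::real \<times> real))"
    using lip_perD(3)[OF assms, of "(1,0)" 0] by linarith
  then show "K \<ge> 0" by simp
qed

lemma lip_per_cont:
  assumes "lip_per K B g" shows "continuous_on S g"
proof (rule continuous_on_subset)
  have "K-lipschitz_on UNIV g"
    by (rule lipschitz_onI) (use lip_perD(3)[OF assms] lip_per_nonneg[OF assms] in \<open>auto simp: dist_norm\<close>)
  then show "continuous_on UNIV g" by (rule lipschitz_on_continuous_on)
qed auto

lemma lip_per_mono:
  assumes "lip_per K B g" "K \<le> K'" "B \<le> B'" shows "lip_per K' B' g"
proof (rule lip_perI)
  fix z w
  show "\<bar>g z\<bar> \<le> B'" using lip_perD(2)[OF assms(1), of z] assms by simp
  show "\<bar>g z - g w\<bar> \<le> K' * norm (z - w)"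
    using lip_perD(3)[OF assms(1), of z w] mult_right_mono[OF assms(2), of "norm (z - w)"] by simp
qed (use lip_perD[OF assms(1)] in auto)

lemma lip_per_const: "\<bar>c\<bar> \<le> B \<Longrightarrow> lip_per 0 B (\<lambda>_. c)"
  by (auto simp: lip_per_def periodic_def)

lemma lip_per_add:
  assumes "lip_per K B g" "lip_per K' B' h"
  shows "lip_per (K + K') (B + B') (\<lambda>z. g z + h z)"
proof (rule lip_perI)
  fix z w
  show "periodic (\<lambda>z. g z + h z)"
    using lip_perD(1)[OF assms(1)] lip_perD(1)[OF assms(2)] by (auto simp: periodic_def)
  show "\<bar>g z + h z\<bar> \<le> B + B'"
    using lip_perD(2)[OF assms(1), of z] lip_perD(2)[OF assms(2), of z] by linarith
  show "\<bar>g z + h z - (g w + h w)\<bar> \<le> (K + K') * norm (z - w)"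
    using lip_perD(3)[OF assms(1), of z w] lip_perD(3)[OF assms(2), of z w]
    unfolding distrib_right by linarith
qed

lemma lip_per_cmult:
  assumes "lip_per K B g"
  shows "lip_per (\<bar>a\<bar> * K) (\<bar>a\<bar> * B) (\<lambda>z. a * g z)"
proof (rule lip_perI)
  fix z w
  show "periodic (\<lambda>z. a * g z)"
    using lip_perD(1)[OF assms(1)] by (auto simp: periodic_def)
  show "\<bar>a * g z\<bar> \<le> \<bar>a\<bar> * B"
    using lip_perD(2)[OF assms(1), of z] by (simp add: abs_mult mult_left_mono)
  have "\<bar>a * g z - a * g w\<bar> = \<bar>a\<bar> * \<bar>g z - g w\<bar>" by (simp add: abs_mult[symmetric] right_diff_distrib)
  also have "\<dots> \<le> \<bar>a\<bar> * (K * norm (z - w))"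
    using lip_perD(3)[OF assms(1), of z w] by (simp add: mult_left_mono)
  finally show "\<bar>a * g z - a * g w\<bar> \<le> \<bar>a\<bar> * K * norm (z - w)" by (simp add: mult.assoc)
qed

lemma lip_per_mult:
  assumes "lip_per K B g" "lip_per K' B' h"
  shows "lip_per (B * K' + K * B') (B * B') (\<lambda>z. g z * h z)"
proof (rule lip_perI)
  fix z w
  show "periodic (\<lambda>z. g z * h z)"
    using lip_perD(1)[OF assms(1)] lip_perD(1)[OF assms(2)] by (auto simp: periodic_def)
  show "\<bar>g z * h z\<bar> \<le> B * B'"
    using lip_perD(2)[OF assms(1), of z] lip_perD(2)[OF assms(2), of z]
    by (simp add: abs_mult mult_mono')
  have "\<bar>g z * h z - g w * h w\<bar> = \<bar>g z * (h z - h w) + (g z - g w) * h w\<bar>"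
    by (simp add: algebra_simps)
  also have "\<dots> \<le> \<bar>g z\<bar> * \<bar>h z - h w\<bar> + \<bar>g z - g w\<bar> * \<bar>h w\<bar>"
    by (metis abs_mult abs_triangle_ineq)
  also have "\<dots> \<le> B * (K' * norm (z - w)) + K * norm (z - w) * B'"
    using lip_perD(2,3)[OF assms(1)] lip_perD(2,3)[OF assms(2)] lip_per_nonneg[OF assms(1)]
    by (intro add_mono mult_mono) auto
  finally show "\<bar>g z * h z - g w * h w\<bar> \<le> (B * K' + K * B') * norm (z - w)"
    by (simp add: algebra_simps)
qed

lemma periodicD: "periodic g \<Longrightarrow> m \<in> \<int> \<times> \<int> \<Longrightarrow> g (z + m) = g z"
  unfolding periodic_def by blast

lemma cont_compose_UNIV:
  assumes "continuous_on UNIV g" "continuous_on S h" shows "continuous_on S (\<lambda>x. g (h x))"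
  using continuous_on_compose2[OF assms] by auto

section \<open>The mean over the unit square\<close>

lemma mean_integrable:
  "continuous_on UNIV g \<Longrightarrow> g integrable_on cbox (0,0) (1,1::real)" for g :: "real \<times> real \<Rightarrow> real"
  by (rule integrable_continuous) (auto intro: continuous_on_subset)

lemma mean_iterated:
  assumes "continuous_on UNIV g"
  shows "mean g = integral {0..1} (\<lambda>x. integral {0..1} (\<lambda>y. g (x, y)))"
  unfolding mean_def by (subst integral_prod_continuous) (auto intro: continuous_on_subset[OF assms])

lemma mean_add:
  assumes "continuous_on UNIV g" "continuous_on UNIV h"
  shows "mean (\<lambda>z. g z + h z) = mean g + mean h"
  unfolding mean_def by (rule integral_add) (use assms mean_integrable in auto)

lemma mean_diff:
  assumes "continuous_on UNIV g" "continuous_on UNIV h"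
  shows "mean (\<lambda>z. g z - h z) = mean g - mean h"
  unfolding mean_def by (rule integral_diff) (use assms mean_integrable in auto)

lemma mean_cmult: "mean (\<lambda>z. a * g z) = a * mean g"
  unfolding mean_def by simp

lemma mean_const: "mean (\<lambda>_. c) = c"
  unfolding mean_def by (simp add: content_Pair)

lemma mean_mono:
  assumes "continuous_on UNIV g" "continuous_on UNIV h" "\<And>z. g z \<le> h z"
  shows "mean g \<le> mean h"
  unfolding mean_def by (rule integral_le) (use assms mean_integrable in auto)

lemma mean_abs_diff_le:
  assumes "continuous_on UNIV g" "continuous_on UNIV h" "continuous_on UNIV e"
    and "\<And>z. \<bar>g z - h z\<bar> \<le> e z"
  shows "\<bar>mean g - mean h\<bar> \<le> mean e"
proof -
  have "mean g \<le> mean (\<lambda>z. h z + e z)" "mean (\<lambda>z. h z - e z) \<le> mean g"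
    by (rule mean_mono; use assms in \<open>auto intro!: continuous_intros simp: abs_le_iff algebra_simps\<close>)+
  then show ?thesis using mean_add[OF assms(2,3)] mean_diff[OF assms(2,3)] by linarith
qed

lemma mean_abs_diff_le_const:
  assumes "continuous_on UNIV g" "continuous_on UNIV h" "\<And>z. \<bar>g z - h z\<bar> \<le> e"
  shows "\<bar>mean g - mean h\<bar> \<le> e"
  using mean_abs_diff_le[OF assms(1,2) _ assms(3)] by (simp add: mean_const)

lemma mean_abs_le:
  assumes "continuous_on UNIV g" "\<And>z. \<bar>g z\<bar> \<le> e"
  shows "\<bar>mean g\<bar> \<le> e"
  using mean_abs_diff_le_const[OF assms(1), of "\<lambda>_. 0" e] assms(2) by (simp add: mean_const)

lemma periodic_unit:
  assumes "periodic g" shows "g (x + 1, y) = g (x, y)" "g (x, y + 1) = g (x, y)"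
proof -
  have "g ((x, y) + (1, 0)) = g (x, y)" "g ((x, y) + (0, 1)) = g (x, y)"
    using periodicD[OF assms, of "(1, 0)" "(x, y)"] periodicD[OF assms, of "(0, 1)" "(x, y)"] by auto
  then show "g (x + 1, y) = g (x, y)" "g (x, y + 1) = g (x, y)" by auto
qed

lemma mean_shift:
  assumes c: "continuous_on UNIV g" and per: "periodic g"
  shows "mean (\<lambda>z. g (z + w)) = mean g"
proof -
  obtain a b where w: "w = (a, b)" by (cases w)
  have cw: "continuous_on UNIV (\<lambda>z. g (z + w))"
    by (intro cont_compose_UNIV[OF c] continuous_intros)
  have "mean (\<lambda>z. g (z + w)) = integral {0..1} (\<lambda>x. integral {0..1} (\<lambda>y. g (x + a, y + b)))"
    by (subst mean_iterated[OF cw]) (simp add: w)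
  also have "\<dots> = integral {0..1} (\<lambda>x. integral {0..1} (\<lambda>y. g (x + a, y)))"
  proof -
    have "integral {0..1} (\<lambda>y. g (x + a, y + b)) = integral {0..1} (\<lambda>y. g (x + a, y))" for x
      by (rule integral_periodic_shift[of "\<lambda>y. g (x + a, y)"])
        (auto intro!: cont_compose_UNIV[OF c] continuous_intros periodic_unit[OF per])
    then show ?thesis by simp
  qed
  \<comment> \<open>The order of integration is exchanged so that the one-dimensional shift also
    removes \<open>a\<close>.\<close>
  also have "\<dots> = integral {0..1} (\<lambda>y. integral {0..1} (\<lambda>x. g (x + a, y)))"
    using integral_swap_continuous[of 0 0 1 1 "\<lambda>x y. g (x + a, y)"]
    by (simp add: cont_compose_UNIV[OF c] case_prod_unfold continuous_intros)
  also have "\<dots> = integral {0..1} (\<lambda>y. integral {0..1} (\<lambda>x. g (x, y)))"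
  proof -
    have "integral {0..1} (\<lambda>x. g (x + a, y)) = integral {0..1} (\<lambda>x. g (x, y))" for y
      by (rule integral_periodic_shift[of "\<lambda>x. g (x, y)"])
        (auto intro!: cont_compose_UNIV[OF c] continuous_intros periodic_unit[OF per])
    then show ?thesis by simp
  qed
  also have "\<dots> = integral {0..1} (\<lambda>x. integral {0..1} (\<lambda>y. g (x, y)))"
    using integral_swap_continuous[of 0 0 1 1 "\<lambda>x y. g (x, y)"]
    by (simp add: cont_compose_UNIV[OF c] case_prod_unfold continuous_intros)
  also have "\<dots> = mean g" by (rule mean_iterated[OF c, symmetric])
  finally show ?thesis .
qed

lemma cont_integral_shift:
  fixes g :: "real \<times> real \<Rightarrow> real"
  assumes c: "continuous_on UNIV g"
  shows "continuous_on UNIV (\<lambda>z. integral {0..L} (\<lambda>s. g (z + s *\<^sub>R w)))"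
proof -
  have "continuous_on (UNIV \<times> cbox 0 L) (\<lambda>(z, s). g (z + s *\<^sub>R w))"
    by (simp add: case_prod_unfold) (intro cont_compose_UNIV[OF c] continuous_intros)
  from integral_continuous_on_param[OF this] show ?thesis by simp
qed

lemma mean_average:
  assumes c: "continuous_on UNIV g" and per: "periodic g" and L: "L \<ge> 0"
  shows "mean (\<lambda>z. integral {0..L} (\<lambda>s. g (z + s *\<^sub>R w))) = L * mean g"
proof -
  have "integral {0..L} (\<lambda>s. mean (\<lambda>z. g (z + s *\<^sub>R w))) =
      mean (\<lambda>z. integral {0..L} (\<lambda>s. g (z + s *\<^sub>R w)))"
    unfolding mean_def box_real[symmetric]
    by (rule integral_swap_continuous)
      (simp add: case_prod_unfold, intro cont_compose_UNIV[OF c] continuous_intros)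
  moreover have "integral {0..L} (\<lambda>s. mean (\<lambda>z. g (z + s *\<^sub>R w))) = L * mean g"
    using L by (simp add: mean_shift[OF c per])
  ultimately show ?thesis by simp
qed

text \<open>Replacing \<open>g\<close> by its averages over segments in direction \<open>w\<close>
  does not change the mean, so knowledge about short segments is enough. The error \<open>e\<close>
  may depend on the point, because the segment estimate of the mixing argument is only trivial near
  critical phases.\<close>

lemma mean_local_average:
  assumes c: "continuous_on UNIV g" and per: "periodic g" and L: "L > 0"
    and x: "continuous_on UNIV x" and e: "continuous_on UNIV e"
    and le: "\<And>z. \<bar>integral {0..L} (\<lambda>s. g (z + s *\<^sub>R w)) - L * x z\<bar> \<le> L * e z"
  shows "\<bar>mean g - mean x\<bar> \<le> mean e"
proof -
  have "\<bar>mean (\<lambda>z. integral {0..L} (\<lambda>s. g (z + s *\<^sub>R w))) - mean (\<lambda>z. L * x z)\<bar> \<le> mean (\<lambda>z. L * e z)"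
    by (rule mean_abs_diff_le) (use le in \<open>auto intro!: cont_integral_shift[OF c] continuous_intros x e\<close>)
  then have "\<bar>L * (mean g - mean x)\<bar> \<le> L * mean e"
    using L by (simp add: mean_average[OF c per] mean_cmult right_diff_distrib)
  then show ?thesis using L by (simp add: abs_mult)
qed

section \<open>The linear flow and its time changes\<close>

lemma antiderivative_lipschitz:
  fixes G :: "real \<Rightarrow> real"
  assumes G: "\<And>s. (G has_real_derivative g s) (at s)" and b: "\<And>s. \<bar>g s\<bar> \<le> B"
  shows "\<bar>G a - G b\<bar> \<le> B * \<bar>a - b\<bar>"
  using field_differentiable_bound[of UNIV G g B a b] G b by simp

lemma antiderivative_shift:
  fixes G :: "real \<Rightarrow> real"
  assumes "\<And>s. (G has_real_derivative g s) (at s)"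
  shows "((\<lambda>s. G (s + a)) has_real_derivative g (s + a)) (at s)"
  using assms[of "s + a"] by (simp only: DERIV_shift)

lemma lip_per_Ints:
  assumes "lip_per K B g" "m \<in> \<int> \<times> \<int>" shows "g (z + m) = g z"
  using periodicD[OF lip_perD(1)[OF assms(1)] assms(2)] .

locale irrational_slope =
  fixes \<alpha> :: real
  assumes irrational: "\<alpha> \<notin> \<rat>"
begin

definition v :: "real \<times> real" where "v = (1, \<alpha>)"

lemma norm_v_pos: "norm v > 0"
  by (simp add: v_def prod_eq_iff)

section \<open>Density and equidistribution of the linear flow\<close>

text \<open>The vertical circle through \<open>w\<close> is a cross-section on which the flow acts
  as the rotation by \<alpha>. Kronecker's theorem is applied to finitely many heights only, and
  this yields a time bound uniform in both points.\<close>

lemma linear_flow_dense: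
  assumes d: "\<delta> > 0"
  shows "\<exists>T\<ge>0. \<forall>z w. \<exists>\<tau>. 0 \<le> \<tau> \<and> \<tau> \<le> T \<and> (\<exists>m\<in>\<int> \<times> \<int>. norm (z + \<tau> *\<^sub>R v - w - m) < \<delta>)"
proof -
  obtain N :: nat where N: "N > 0" "2 / real N < \<delta>"
  proof -
    obtain n :: nat where "n \<noteq> 0" "inverse (real n) < \<delta> / 2"
      using real_arch_inverse[of "\<delta> / 2"] d by auto
    then show ?thesis by (intro that[of n]) (auto simp: field_simps)
  qed
  have "\<exists>k. \<bar>frac (real k * \<alpha>) - real j / real N\<bar> < 1 / real N" if "j < N" for j
    using Kronecker_approx_1_explicit[OF irrational, of "real j / real N" "1 / real N"] that N
    by (auto simp: divide_le_eq)
  then obtain k where k: "\<And>j. j < N \<Longrightarrow> \<bar>frac (real (k j) * \<alpha>) - real j / real N\<bar> < 1 / real N"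
    by metis
  define T where "T = 1 + (\<Sum>j<N. real (k j))"
  have "\<exists>\<tau>. 0 \<le> \<tau> \<and> \<tau> \<le> T \<and> (\<exists>m\<in>\<int> \<times> \<int>. norm (z + \<tau> *\<^sub>R v - w - m) < \<delta>)" for z w
  proof -
    obtain x y where z: "z = (x, y)" by (cases z)
    obtain x' y' where w: "w = (x', y')" by (cases w)
    \<comment> \<open>After time \<open>t\<close> the orbit meets the vertical circle through
      \<open>w\<close> with the gap \<open>g\<close> left; every further unit of time rotates by
      \<alpha>. The rounding of \<open>frac g\<close> to the grid and Kronecker's approximation cost
      one mesh width each.\<close>
    define t where "t = frac (x' - x)"
    define g where "g = y' - y - \<alpha> * t"
    define j where "j = nat \<lfloor>real N * frac g\<rfloor>"
    have fg: "0 \<le> frac g" "frac g < 1" by (auto simp: frac_ge_0 frac_lt_1)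
    have j0: "real j = of_int \<lfloor>real N * frac g\<rfloor>"
      unfolding j_def using fg by simp
    have j1: "real j \<le> real N * frac g" "real N * frac g < real j + 1"
      unfolding j0 by linarith+
    have jN: "j < N"
    proof -
      have "real j \<le> real N * frac g" by (rule j1)
      also have "\<dots> < real N * 1" using fg N by (intro mult_strict_left_mono) auto
      finally show ?thesis by simp
    qed
    have j2: "\<bar>frac g - real j / real N\<bar> \<le> 1 / real N"
    proof -
      have "real j / real N \<le> frac g" "frac g \<le> (real j + 1) / real N"
        using j1 N by (auto simp: field_simps)
      then show ?thesis by (simp add: add_divide_distrib)
    qed
    define \<tau> where "\<tau> = t + real (k j)"
    define m where "m = (of_int (int (k j) - \<lfloor>x' - x\<rfloor>) :: real, of_int (\<lfloor>real (k j) * \<alpha>\<rfloor> - \<lfloor>g\<rfloor>) :: real)"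
    have "real (k j) \<le> (\<Sum>j<N. real (k j))"
      by (rule member_le_sum) (use jN in auto)
    then have "0 \<le> \<tau>" "\<tau> \<le> T"
      using frac_lt_1[of "x' - x"] frac_ge_0[of "x' - x"] by (auto simp: \<tau>_def T_def t_def)
    moreover have "m \<in> \<int> \<times> \<int>" by (auto simp: m_def)
    moreover have "norm (z + \<tau> *\<^sub>R v - w - m) < \<delta>"
    proof -
      have "z + \<tau> *\<^sub>R v - w - m = (0, frac (real (k j) * \<alpha>) - frac g)"
        by (simp add: z w v_def m_def \<tau>_def t_def g_def frac_def algebra_simps)
      then have "norm (z + \<tau> *\<^sub>R v - w - m) = \<bar>frac (real (k j) * \<alpha>) - frac g\<bar>"
        by (simp add: norm_Pair)
      also have "\<dots> < 2 / real N" using k[OF jN] j2 by (simp add: abs_if split: if_splits)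
      finally show ?thesis using N by simp
    qed
    ultimately show ?thesis by blast
  qed
  moreover have "T \<ge> 0" by (simp add: T_def sum_nonneg)
  ultimately show ?thesis by blast
qed

text \<open>The orbit integral \<open>I\<close> varies slowly along orbits (boundary terms) and
  across them (Lipschitz constant). As every orbit comes close to every point in bounded time,
  \<open>I\<close> is nearly constant, hence near its mean, which is \<open>L * mean g\<close>. Only
  \<open>K\<close> and \<open>B\<close> enter, so one threshold serves the whole class.\<close>

lemma equidistribution:
  assumes e: "\<epsilon> > 0"
  shows "\<exists>L0>0. \<forall>L\<ge>L0. \<forall>g. lip_per K B g \<longrightarrow>
    (\<forall>z. \<bar>integral {0..L} (\<lambda>s. g (z + s *\<^sub>R v)) - L * mean g\<bar> \<le> \<epsilon> * L)"
proof -
  \<comment> \<open>Half of the error pays for the transversal distance, at most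
    \<open>K \<delta>\<close> per unit of length; the other half absorbs the boundary terms
    \<open>2 B T\<close> once \<open>L \<ge> L0\<close>.\<close>
  define \<delta> where "\<delta> = \<epsilon> / (2 * (\<bar>K\<bar> + 1))"
  have d: "\<delta> > 0" using e by (simp add: \<delta>_def add_nonneg_pos)
  have dK: "\<bar>K\<bar> * \<delta> \<le> \<epsilon> / 2"
  proof -
    have "\<bar>K\<bar> * \<delta> \<le> (\<bar>K\<bar> + 1) * \<delta>" using d by (intro mult_right_mono) auto
    also have "\<dots> = \<epsilon> / 2" by (simp add: \<delta>_def field_simps add_nonneg_eq_0_iff)
    finally show ?thesis .
  qed
  obtain T where T: "T \<ge> 0" "\<And>z w. \<exists>\<tau>. 0 \<le> \<tau> \<and> \<tau> \<le> T \<and> (\<exists>m\<in>\<int> \<times> \<int>. norm (z + \<tau> *\<^sub>R v - w - m) < \<delta>)"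
    using linear_flow_dense[OF d] by blast
  define L0 where "L0 = 4 * \<bar>B\<bar> * T / \<epsilon> + 1"
  have L0: "L0 > 0" using T e by (simp add: L0_def add_nonneg_pos)
  have "\<bar>integral {0..L} (\<lambda>s. g (z + s *\<^sub>R v)) - L * mean g\<bar> \<le> \<epsilon> * L"
    if L: "L \<ge> L0" and g: "lip_per K B g" for L g z
  proof -
    define I where "I = (\<lambda>z. integral {0..L} (\<lambda>s. g (z + s *\<^sub>R v)))"
    have Lp: "L > 0" using L L0 by simp
    note c = lip_per_cont[OF g, of UNIV] and KB = lip_per_nonneg[OF g]
    have int: "(\<lambda>s. g (z + s *\<^sub>R v)) integrable_on {0..L}" for z
      by (rule integrable_continuous_real) (intro cont_compose_UNIV[OF c] continuous_intros)
    have near: "\<bar>I z - I w\<bar> \<le> L * (K * norm (z - w))" for z w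
    proof -
      have "I z - I w = integral {0..L} (\<lambda>s. g (z + s *\<^sub>R v) - g (w + s *\<^sub>R v))"
        unfolding I_def by (rule integral_diff[symmetric]; rule int)
      moreover have "norm (integral {0..L} (\<lambda>s. g (z + s *\<^sub>R v) - g (w + s *\<^sub>R v))) \<le> integral {0..L} (\<lambda>_. K * norm (z - w))"
      proof (rule integral_norm_bound_integral)
        show "(\<lambda>s. g (z + s *\<^sub>R v) - g (w + s *\<^sub>R v)) integrable_on {0..L}"
          by (intro integrable_diff int)
        show "norm (g (z + s *\<^sub>R v) - g (w + s *\<^sub>R v)) \<le> K * norm (z - w)" for s
          using lip_perD(3)[OF g, of "z + s *\<^sub>R v" "w + s *\<^sub>R v"] by simp
      qed auto
      moreover have "integral {0..L} (\<lambda>_. K * norm (z - w)) = L * (K * norm (z - w))" using Lp by simp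
      ultimately show ?thesis by (simp only: real_norm_def)
    qed
    have along: "\<bar>I (z + \<tau> *\<^sub>R v) - I z\<bar> \<le> 2 * B * \<tau>" if "\<tau> \<ge> 0" for z \<tau>
    proof -
      have "continuous_on UNIV (\<lambda>s. g (z + s *\<^sub>R v))"
        by (intro cont_compose_UNIV[OF c] continuous_intros)
      then obtain G where G: "\<And>s. (G has_real_derivative g (z + s *\<^sub>R v)) (at s)"
        using antiderivative_exists by blast
      have G': "((\<lambda>s. G (s + \<tau>)) has_real_derivative g (z + \<tau> *\<^sub>R v + s *\<^sub>R v)) (at s)" for s
        using antiderivative_shift[of G _ \<tau> s, OF G] by (simp add: algebra_simps)
      have "I z = G L - G 0" unfolding I_def by (rule integral_antiderivative[OF G]) (use Lp in auto)
      moreover have "I (z + \<tau> *\<^sub>R v) = G (L + \<tau>) - G \<tau>"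
        unfolding I_def by (subst integral_antiderivative[OF G']) (use Lp in auto)
      moreover have "\<bar>G (L + \<tau>) - G L\<bar> \<le> B * \<bar>L + \<tau> - L\<bar>" "\<bar>G \<tau> - G 0\<bar> \<le> B * \<bar>\<tau> - 0\<bar>"
        by (rule antiderivative_lipschitz[OF G]; rule lip_perD(2)[OF g])+
      ultimately show ?thesis using that by (simp add: abs_le_iff)
    qed
    have "\<bar>I z - I w\<bar> \<le> \<epsilon> * L" for z w
    proof -
      obtain \<tau> m where tm: "0 \<le> \<tau>" "\<tau> \<le> T" "m \<in> \<int> \<times> \<int>" "norm (z + \<tau> *\<^sub>R v - w - m) < \<delta>"
        using T(2)[of z w] by blast
      have "I (w + m) = I w" unfolding I_def
      proof -
        have "g (w + m + s *\<^sub>R v) = g (w + s *\<^sub>R v)" for s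
          using lip_per_Ints[OF g tm(3), of "w + s *\<^sub>R v"] by (simp add: algebra_simps)
        then show "integral {0..L} (\<lambda>s. g (w + m + s *\<^sub>R v)) = integral {0..L} (\<lambda>s. g (w + s *\<^sub>R v))" by simp
      qed
      then have "\<bar>I (z + \<tau> *\<^sub>R v) - I w\<bar> \<le> L * (K * norm (z + \<tau> *\<^sub>R v - w - m))"
        using near[of "z + \<tau> *\<^sub>R v" "w + m"] by (simp add: algebra_simps)
      also have "\<dots> \<le> L * (K * \<delta>)" using tm(4) KB Lp by (intro mult_left_mono) auto
      also have "\<dots> \<le> L * (\<epsilon> / 2)" using dK KB Lp by (intro mult_left_mono) auto
      finally have 1: "\<bar>I (z + \<tau> *\<^sub>R v) - I w\<bar> \<le> L * (\<epsilon> / 2)" .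
      have "2 * B * \<tau> \<le> 2 * \<bar>B\<bar> * T" using tm KB by (intro mult_mono) auto
      also have "\<dots> \<le> \<epsilon> / 2 * L0" using e by (simp add: L0_def field_simps)
      also have "\<dots> \<le> \<epsilon> / 2 * L" using L e by (intro mult_left_mono) auto
      finally have 2: "2 * B * \<tau> \<le> \<epsilon> / 2 * L" .
      have "L * (\<epsilon> / 2) = \<epsilon> / 2 * L" "\<epsilon> * L = \<epsilon> / 2 * L + \<epsilon> / 2 * L" by auto
      then show ?thesis using 1 2 along[OF tm(1), of z] by linarith
    qed
    then have "\<bar>mean I - mean (\<lambda>_. I z)\<bar> \<le> \<epsilon> * L"
      by (intro mean_abs_diff_le_const) (auto simp: I_def intro!: cont_integral_shift[OF c])
    moreover have "mean I = L * mean g"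
      unfolding I_def by (rule mean_average[OF c]) (use lip_perD(1)[OF g] Lp in auto)
    ultimately show ?thesis by (simp add: mean_const I_def abs_minus_commute)
  qed
  then show ?thesis using L0 by blast
qed

section \<open>Time changes of the linear flow\<close>

text \<open>The lower bound 1, rather than mere positivity, makes every \<open>arrive f z\<close>
  1-Lipschitz. Lipschitz regularity suffices for the dynamics; smoothness is read off the wave
  series separately.\<close>

definition adm :: "(real \<times> real \<Rightarrow> real) \<Rightarrow> bool" where
  "adm f \<longleftrightarrow> (\<exists>K B. lip_per K B f) \<and> (\<forall>z. 1 \<le> f z)"

text \<open>With \<open>f = 1 / r\<close>, the flow needs time \<open>clock f z s\<close> to travel from \<open>z\<close> to \<open>z + s v\<close>; \<open>arrive\<close> inverts this
  in \<open>s\<close>.\<close>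

definition clock :: "(real \<times> real \<Rightarrow> real) \<Rightarrow> real \<times> real \<Rightarrow> real \<Rightarrow> real" where
  "clock f z = (SOME G. (\<forall>s. (G has_real_derivative f (z + s *\<^sub>R v)) (at s)) \<and> G 0 = 0)"

definition arrive :: "(real \<times> real \<Rightarrow> real) \<Rightarrow> real \<times> real \<Rightarrow> real \<Rightarrow> real" where
  "arrive f z = inv (clock f z)"

definition Phi :: "(real \<times> real \<Rightarrow> real) \<Rightarrow> real \<Rightarrow> real \<times> real \<Rightarrow> real \<times> real" where
  "Phi f t z = z + arrive f z t *\<^sub>R v"

lemma admD: "adm f \<Longrightarrow> 1 \<le> f z" "adm f \<Longrightarrow> continuous_on S f" "adm f \<Longrightarrow> m \<in> \<int> \<times> \<int> \<Longrightarrow> f (z + m) = f z"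
  unfolding adm_def using lip_per_cont lip_per_Ints by metis+

lemma line_cont:
  assumes "continuous_on UNIV g" shows "continuous_on UNIV (\<lambda>s. g (z + s *\<^sub>R v))"
  by (intro cont_compose_UNIV[OF assms] continuous_intros)

lemma clock_props:
  assumes "adm f"
  shows "(clock f z has_real_derivative f (z + s *\<^sub>R v)) (at s)" "clock f z 0 = 0"
proof -
  have "(\<forall>s. (clock f z has_real_derivative f (z + s *\<^sub>R v)) (at s)) \<and> clock f z 0 = 0"
    unfolding clock_def
    using someI_ex[OF antiderivative_exists[OF line_cont[OF admD(2)[OF assms]]], of z] .
  then show "(clock f z has_real_derivative f (z + s *\<^sub>R v)) (at s)" "clock f z 0 = 0" by auto
qed

lemma clock_unique:
  assumes "adm f" "\<And>s. (G has_real_derivative f (z + s *\<^sub>R v)) (at s)"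
  shows "clock f z s = G s - G 0"
  using antiderivative_diff_const[of G _ "clock f z", OF assms(2) clock_props(1)[OF assms(1)]]
    clock_props(2)[OF assms(1)] by simp

lemma clock_add:
  assumes "adm f"
  shows "clock f z (s + s') = clock f z s + clock f (z + s *\<^sub>R v) s'"
proof -
  have "((\<lambda>r. clock f z (s + r)) has_real_derivative f (z + s *\<^sub>R v + r *\<^sub>R v)) (at r)" for r
    using antiderivative_shift[of "clock f z" _ s r, OF clock_props(1)[OF assms]] by (simp add: algebra_simps)
  from clock_unique[OF assms this, of s'] show ?thesis by simp
qed

lemma clock_mono:
  assumes "adm f" "s' \<le> s"
  shows "s - s' \<le> clock f z s - clock f z s'"
proof -
  have "clock f z s' - s' \<le> clock f z s - s"
  proof (rule DERIV_nonneg_imp_nondecreasing[OF assms(2)])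
    fix x
    have "((\<lambda>s. clock f z s - s) has_real_derivative f (z + x *\<^sub>R v) - 1) (at x)"
      by (intro derivative_intros clock_props[OF assms(1)])
    then show "\<exists>y. ((\<lambda>s. clock f z s - s) has_real_derivative y) (at x) \<and> 0 \<le> y"
      using admD(1)[OF assms(1), of "z + x *\<^sub>R v"] by (intro exI conjI) auto
  qed
  then show ?thesis by simp
qed

text \<open>An error in travel time bounds the error in distance. Two flows are always compared by
  comparing clocks and passing through this inequality.\<close>

lemma clock_expand: "adm f \<Longrightarrow> \<bar>s - s'\<bar> \<le> \<bar>clock f z s - clock f z s'\<bar>"
  using clock_mono[of f s' s z] clock_mono[of f s s' z] by (cases "s \<le> s'") auto

lemma clock_inj: "adm f \<Longrightarrow> clock f z s = clock f z s' \<Longrightarrow> s = s'"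
  using clock_expand[of f s s' z] by simp

lemma clock_ge: "adm f \<Longrightarrow> s \<ge> 0 \<Longrightarrow> s \<le> clock f z s"
  using clock_mono[of f 0 s z] clock_props(2)[of f z] by simp

lemma clock_le: "adm f \<Longrightarrow> s \<le> 0 \<Longrightarrow> clock f z s \<le> s"
  using clock_mono[of f s 0 z] clock_props(2)[of f z] by simp

lemma clock_cont: "adm f \<Longrightarrow> isCont (clock f z) s"
  using clock_props(1) DERIV_isCont by blast

lemma clock_surj:
  assumes "adm f" shows "\<exists>s. clock f z s = t"
proof -
  have "\<exists>s\<ge>-\<bar>t\<bar>. s \<le> \<bar>t\<bar> \<and> clock f z s = t"
  proof (rule IVT)
    show "clock f z (- \<bar>t\<bar>) \<le> t" using clock_le[OF assms, of "-\<bar>t\<bar>" z] by linarith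
    show "t \<le> clock f z \<bar>t\<bar>" using clock_ge[OF assms, of "\<bar>t\<bar>" z] by linarith
    next
    show "\<forall>x. - \<bar>t\<bar> \<le> x \<and> x \<le> \<bar>t\<bar> \<longrightarrow> isCont (clock f z) x"
      using clock_cont[OF assms] by blast
  qed simp
  then show ?thesis by blast
qed

lemma clock_arrive: "adm f \<Longrightarrow> clock f z (arrive f z t) = t"
  unfolding arrive_def by (rule surj_f_inv_f) (simp add: surj_def, metis clock_surj)

lemma arrive_eqI: "adm f \<Longrightarrow> clock f z s = t \<Longrightarrow> arrive f z t = s"
  using clock_inj clock_arrive by metis

lemma arrive_0: "adm f \<Longrightarrow> arrive f z 0 = 0"
  by (rule arrive_eqI) (auto simp: clock_props)

lemma arrive_lip: "adm f \<Longrightarrow> \<bar>arrive f z t - arrive f z t'\<bar> \<le> \<bar>t - t'\<bar>"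
  using clock_expand[of f "arrive f z t" "arrive f z t'" z] by (simp add: clock_arrive)

lemma arrive_bound: "adm f \<Longrightarrow> \<bar>arrive f z t\<bar> \<le> \<bar>t\<bar>"
  using arrive_lip[of f z t 0] by (simp add: arrive_0)

lemma arrive_nonneg: "adm f \<Longrightarrow> t \<ge> 0 \<Longrightarrow> arrive f z t \<ge> 0"
  using clock_le[of f "arrive f z t" z] by (cases "arrive f z t \<le> 0") (auto simp: clock_arrive)

lemma arrive_add: "adm f \<Longrightarrow> arrive f z (s + t) = arrive f z t + arrive f (Phi f t z) s"
  by (rule arrive_eqI) (auto simp: clock_add clock_arrive Phi_def)

lemma Phi_0: "adm f \<Longrightarrow> Phi f 0 z = z"
  by (simp add: Phi_def arrive_0)

lemma Phi_add: "adm f \<Longrightarrow> Phi f (s + t) z = Phi f s (Phi f t z)"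
  by (simp add: Phi_def arrive_add scaleR_add_left)

lemma arrive_deriv:
  assumes "adm f"
  shows "(arrive f z has_real_derivative 1 / f (Phi f t z)) (at t)"
proof -
  have "(arrive f z has_real_derivative inverse (f (z + arrive f z t *\<^sub>R v))) (at t)"
  proof (rule DERIV_inverse_function[where f = "clock f z" and a = "t - 1" and b = "t + 1"])
    show "(clock f z has_real_derivative f (z + arrive f z t *\<^sub>R v)) (at (arrive f z t))"
      by (rule clock_props[OF assms])
    show "f (z + arrive f z t *\<^sub>R v) \<noteq> 0" using admD(1)[OF assms, of "z + arrive f z t *\<^sub>R v"] by linarith
    show "isCont (arrive f z) t"
    proof -
      have "1-lipschitz_on UNIV (arrive f z)"
        by (rule lipschitz_onI) (use arrive_lip[OF assms] in \<open>auto simp: dist_real_def\<close>)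
      then show ?thesis
        by (metis UNIV_I continuous_on_eq_continuous_at lipschitz_on_continuous_on open_UNIV)
    qed
  qed (auto simp: clock_arrive[OF assms])
  then show ?thesis by (simp add: Phi_def divide_inverse)
qed

text \<open>This equivariance lets the flow descend to the torus. Since \<open>clock\<close> is a
  choice that depends only on the integrand, equal integrands give literally equal clocks.\<close>

lemma Phi_Ints:
  assumes "adm f" "m \<in> \<int> \<times> \<int>"
  shows "Phi f t (z + m) = Phi f t z + m"
proof -
  have "f (z + m + s *\<^sub>R v) = f (z + s *\<^sub>R v)" for s
    using admD(3)[OF assms, of "z + s *\<^sub>R v"] by (simp add: algebra_simps)
  then have "clock f (z + m) = clock f z" by (simp add: clock_def)
  then show ?thesis by (simp add: Phi_def arrive_def algebra_simps)
qed

section \<open>Dependence of the flow on speed, time and starting point\<close>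

lemma arrive_compare:
  assumes f: "adm f" and g: "adm g" and le: "\<And>s. \<bar>f (z + s *\<^sub>R v) - g (w + s *\<^sub>R v)\<bar> \<le> \<eta>"
  shows "\<bar>arrive f z t - arrive g w t\<bar> \<le> \<eta> * \<bar>t\<bar>"
proof -
  let ?s = "arrive f z t" and ?r = "arrive g w t"
  have eta: "\<eta> \<ge> 0" using le[of 0] by linarith
  have "((\<lambda>s. clock f z s - clock g w s) has_real_derivative f (z + s *\<^sub>R v) - g (w + s *\<^sub>R v)) (at s)" for s
    by (intro derivative_intros clock_props f g)
  from antiderivative_lipschitz[OF this le, of ?r 0]
  have "\<bar>clock f z ?r - clock g w ?r\<bar> \<le> \<eta> * \<bar>?r\<bar>"
    by (simp add: clock_props f g)
  also have "\<dots> \<le> \<eta> * \<bar>t\<bar>" using eta arrive_bound[OF g] by (intro mult_left_mono) auto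
  finally have "\<bar>clock f z ?r - clock f z ?s\<bar> \<le> \<eta> * \<bar>t\<bar>" by (simp add: clock_arrive f g)
  then show ?thesis using clock_expand[OF f, of ?s ?r z] by linarith
qed

lemma Phi_perturb:
  assumes f: "adm f" and g: "adm g" and le: "\<And>z. \<bar>f z - g z\<bar> \<le> \<eta>"
  shows "norm (Phi f t z - Phi g t z) \<le> \<eta> * \<bar>t\<bar> * norm v"
proof -
  have "Phi f t z - Phi g t z = (arrive f z t - arrive g z t) *\<^sub>R v"
    by (simp add: Phi_def algebra_simps)
  then show ?thesis using arrive_compare[OF f g, of z z \<eta> t] le by (simp add: mult_right_mono)
qed

lemma Phi_lip_time:
  assumes f: "adm f" shows "norm (Phi f t z - Phi f t' z) \<le> \<bar>t - t'\<bar> * norm v"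
proof -
  have "Phi f t z - Phi f t' z = (arrive f z t - arrive f z t') *\<^sub>R v"
    by (simp add: Phi_def algebra_simps)
  then show ?thesis using arrive_lip[OF f] by (simp add: mult_right_mono)
qed

lemma Phi_lip_space:
  assumes f: "adm f" and K: "lip_per K B f"
  shows "norm (Phi f t z - Phi f t w) \<le> (1 + K * \<bar>t\<bar> * norm v) * norm (z - w)"
proof -
  have "Phi f t z - Phi f t w = (z - w) + (arrive f z t - arrive f w t) *\<^sub>R v"
    by (simp add: Phi_def algebra_simps)
  then have "norm (Phi f t z - Phi f t w) \<le> norm (z - w) + \<bar>arrive f z t - arrive f w t\<bar> * norm v"
    by (metis norm_triangle_ineq norm_scaleR)
  moreover have "\<bar>arrive f z t - arrive f w t\<bar> \<le> K * norm (z - w) * \<bar>t\<bar>"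
  proof (rule arrive_compare[OF f f])
    fix s show "\<bar>f (z + s *\<^sub>R v) - f (w + s *\<^sub>R v)\<bar> \<le> K * norm (z - w)"
      using lip_perD(3)[OF K, of "z + s *\<^sub>R v" "w + s *\<^sub>R v"] by simp
  qed
  then have "\<bar>arrive f z t - arrive f w t\<bar> * norm v \<le> K * norm (z - w) * \<bar>t\<bar> * norm v"
    by (rule mult_right_mono) simp
  ultimately show ?thesis by (simp add: algebra_simps)
qed

text \<open>Composition with the flow stays inside the test class, so the uniform statements apply
  to observables that have been moved by the flow.\<close>

lemma lip_per_Phi:
  assumes f: "adm f" "lip_per K B f" and g: "lip_per K' B' g"
  shows "lip_per (K' * (1 + K * \<bar>t\<bar> * norm v)) B' (\<lambda>z. g (Phi f t z))"
proof (rule lip_perI)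
  fix z w
  show "periodic (\<lambda>z. g (Phi f t z))"
    unfolding periodic_def by (intro allI ballI) (simp only: Phi_Ints[OF f(1)] lip_per_Ints[OF g])
  show "\<bar>g (Phi f t z)\<bar> \<le> B'" by (rule lip_perD(2)[OF g])
  have "\<bar>g (Phi f t z) - g (Phi f t w)\<bar> \<le> K' * norm (Phi f t z - Phi f t w)" by (rule lip_perD(3)[OF g])
  also have "\<dots> \<le> K' * ((1 + K * \<bar>t\<bar> * norm v) * norm (z - w))"
    using Phi_lip_space[OF f] lip_per_nonneg[OF g] by (intro mult_left_mono) auto
  finally show "\<bar>g (Phi f t z) - g (Phi f t w)\<bar> \<le> K' * (1 + K * \<bar>t\<bar> * norm v) * norm (z - w)"
    by (simp add: mult.assoc)
qed

text \<open>Integration against the invariant measure of the flow, which has density \<open>f / mean f\<close>.\<close>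

definition average :: "(real \<times> real \<Rightarrow> real) \<Rightarrow> (real \<times> real \<Rightarrow> real) \<Rightarrow> real" where
  "average f g = mean (\<lambda>z. g z * f z) / mean f"

lemma mean_ge_1: "adm f \<Longrightarrow> mean f \<ge> 1"
  using mean_mono[of "\<lambda>_. 1" f] admD(1,2)[of f] by (simp add: mean_const)

lemma average_abs_le:
  assumes f: "adm f" and g: "continuous_on UNIV g" "\<And>z. \<bar>g z\<bar> \<le> B"
  shows "\<bar>average f g\<bar> \<le> B"
proof -
  have f0: "f z \<ge> 0" for z using admD(1)[OF f, of z] by simp
  have "\<bar>mean (\<lambda>z. g z * f z) - mean (\<lambda>_. 0)\<bar> \<le> mean (\<lambda>z. B * f z)"
    by (rule mean_abs_diff_le)
      (use g f0 admD(2)[OF f] in \<open>auto intro!: continuous_intros mult_right_mono simp: abs_mult\<close>)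
  then have "\<bar>mean (\<lambda>z. g z * f z)\<bar> \<le> B * mean f" by (simp add: mean_const mean_cmult)
  then show ?thesis using mean_ge_1[OF f] by (simp add: average_def field_simps)
qed

text \<open>Substituting distance for time turns the integral of \<open>g\<close> into a line
  integral of \<open>g * f\<close>, and the elapsed time \<open>L\<close> into one of
  \<open>f\<close>. Equidistribution of both, followed by division, gives the weighted
  average.\<close>

lemma time_average:
  assumes f: "adm f" and e: "\<epsilon> > 0"
  shows "\<exists>L0>0. \<forall>L\<ge>L0. \<forall>g. lip_per K B g \<longrightarrow>
    (\<forall>z. \<bar>integral {0..L} (\<lambda>t. g (Phi f t z)) - L * average f g\<bar> \<le> \<epsilon> * L)"
proof -
  obtain Kf Bf where fl: "lip_per Kf Bf f" using f by (auto simp: adm_def)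
  have Bf: "Bf \<ge> 1" using lip_perD(2)[OF fl, of 0] admD(1)[OF f, of 0] by linarith
  define d where "d = \<epsilon> / (1 + \<bar>B\<bar>)"
  have d: "d > 0" using e by (simp add: d_def add_pos_nonneg)
  obtain L1 where L1: "L1 > 0" "\<And>L z. L \<ge> L1 \<Longrightarrow> \<bar>integral {0..L} (\<lambda>s. f (z + s *\<^sub>R v)) - L * mean f\<bar> \<le> d * L"
    using equidistribution[OF d, of Kf Bf] fl by blast
  obtain L2 where L2: "L2 > 0" "\<And>L g z. L \<ge> L2 \<Longrightarrow> lip_per (B * Kf + K * Bf) (B * Bf) g \<Longrightarrow>
      \<bar>integral {0..L} (\<lambda>s. g (z + s *\<^sub>R v)) - L * mean g\<bar> \<le> d * L"
    using equidistribution[OF d, of "B * Kf + K * Bf" "B * Bf"] by blast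
  \<comment> \<open>The clock runs at rate at most \<open>Bf\<close>, so time \<open>L0\<close>
    forces a distance of at least \<open>L1\<close> and \<open>L2\<close>.\<close>
  define L0 where "L0 = Bf * max L1 L2"
  have "L0 > 0" using Bf L1 by (simp add: L0_def)
  moreover have "\<bar>integral {0..L} (\<lambda>t. g (Phi f t z)) - L * average f g\<bar> \<le> \<epsilon> * L"
    if L: "L \<ge> L0" and g: "lip_per K B g" for L g z
  proof -
    define S where "S = arrive f z L"
    have Lp: "L > 0" using L \<open>L0 > 0\<close> by linarith
    note cf = admD(2)[OF f] and cg = lip_per_cont[OF g]
    have S0: "S \<ge> 0" using arrive_nonneg[OF f] Lp by (simp add: S_def)
    have SL: "S \<le> L" using arrive_bound[OF f, of z L] Lp by (simp add: S_def)
    have cS: "clock f z S = L" by (simp add: S_def clock_arrive f)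
    have "\<bar>clock f z S - clock f z 0\<bar> \<le> Bf * \<bar>S - 0\<bar>"
      by (rule antiderivative_lipschitz[OF clock_props(1)[OF f]]) (rule lip_perD(2)[OF fl])
    then have "L \<le> Bf * S" using cS S0 by (simp add: clock_props f)
    then have "Bf * max L1 L2 \<le> Bf * S" using L by (simp add: L0_def)
    then have "max L1 L2 \<le> S" using Bf by simp
    then have S12: "S \<ge> L1" "S \<ge> L2" by auto
    have A1: "\<bar>L - S * mean f\<bar> \<le> d * S"
      using L1(2)[OF S12(1), of z] integral_antiderivative(2)[OF clock_props(1)[OF f] S0, of z] cS
      by (simp add: clock_props f)
    have gf: "lip_per (B * Kf + K * Bf) (B * Bf) (\<lambda>z. g z * f z)" by (rule lip_per_mult[OF g fl])
    have A2: "\<bar>integral {0..S} (\<lambda>s. g (z + s *\<^sub>R v) * f (z + s *\<^sub>R v)) - S * mean (\<lambda>z. g z * f z)\<bar> \<le> d * S"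
      using L2(2)[OF S12(2) gf] .
    obtain H where H: "\<And>s. (H has_real_derivative (g (z + s *\<^sub>R v) * f (z + s *\<^sub>R v))) (at s)"
      using antiderivative_exists[OF line_cont[OF lip_per_cont[OF gf]]] by blast
    \<comment> \<open>The weight \<open>f\<close> cancels the speed \<open>1 / f\<close> of
      \<open>arrive\<close>.\<close>
    have H': "((\<lambda>t. H (arrive f z t)) has_real_derivative g (Phi f t z)) (at t)" for t
    proof -
      have "((\<lambda>t. H (arrive f z t)) has_real_derivative
        (g (z + arrive f z t *\<^sub>R v) * f (z + arrive f z t *\<^sub>R v)) * (1 / f (Phi f t z))) (at t)"
        by (rule DERIV_chain2[OF H arrive_deriv[OF f]])
      moreover have "f (Phi f t z) \<noteq> 0" using admD(1)[OF f, of "Phi f t z"] by linarith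
      ultimately show ?thesis by (simp add: Phi_def[symmetric])
    qed
    have I: "integral {0..L} (\<lambda>t. g (Phi f t z)) = integral {0..S} (\<lambda>s. g (z + s *\<^sub>R v) * f (z + s *\<^sub>R v))"
      using integral_antiderivative(2)[OF H', of 0 L] integral_antiderivative(2)[OF H, of 0 S] Lp S0
      by (simp add: arrive_0[OF f] S_def)
    have m: "mean f \<ge> 1" by (rule mean_ge_1[OF f])
    have a: "\<bar>average f g\<bar> \<le> \<bar>B\<bar>"
      by (rule average_abs_le[OF f cg]) (use lip_perD(2)[OF g] in \<open>meson abs_ge_self order_trans\<close>)
    have "S * mean (\<lambda>z. g z * f z) - L * average f g = (S * mean f - L) * average f g"
      using m by (simp add: average_def field_simps)
    then have "\<bar>S * mean (\<lambda>z. g z * f z) - L * average f g\<bar> = \<bar>L - S * mean f\<bar> * \<bar>average f g\<bar>"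
      by (metis abs_minus_commute abs_mult)
    also have "\<dots> \<le> (d * S) * \<bar>B\<bar>" using A1 a by (intro mult_mono) auto
    finally have "\<bar>integral {0..L} (\<lambda>t. g (Phi f t z)) - L * average f g\<bar> \<le> d * S + (d * S) * \<bar>B\<bar>"
      using A2 I by linarith
    also have "\<dots> = d * (1 + \<bar>B\<bar>) * S" by (simp add: algebra_simps)
    also have "\<dots> = \<epsilon> * S" by (simp add: d_def)
    also have "\<dots> \<le> \<epsilon> * L" using SL e by (intro mult_left_mono) auto
    finally show ?thesis .
  qed
  ultimately show ?thesis by blast
qed

end

section \<open>Coboundary speeds\<close>

lemma sin_taylor_bound:
  fixes a x :: real
  shows "\<bar>sin (a + x) - sin a - x * cos a\<bar> \<le> x\<^sup>2"
proof -
  let ?f = "\<lambda>y. sin (a + y) - y * cos a"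
  have cos_lip: "\<bar>cos (a + y) - cos a\<bar> \<le> \<bar>y\<bar>" for y :: real
    using antiderivative_lipschitz[of cos "\<lambda>x. - sin x" 1 "a + y" a] by (simp add: DERIV_cos)
  have "norm (?f x - ?f 0) \<le> \<bar>x\<bar> * norm (x - 0)"
  proof (rule field_differentiable_bound[of "closed_segment 0 x" ?f "\<lambda>y. cos (a + y) - cos a"])
    fix y assume "y \<in> closed_segment 0 x"
    then have "\<bar>y\<bar> \<le> \<bar>x\<bar>" by (auto simp: closed_segment_eq_real_ivl split: if_splits)
    then show "norm (cos (a + y) - cos a) \<le> \<bar>x\<bar>" using cos_lip[of y] by simp
    show "(?f has_field_derivative cos (a + y) - cos a) (at y within closed_segment 0 x)"
      by (auto intro!: derivative_eq_intros)
  qed auto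
  then show ?thesis by (simp add: power2_eq_square abs_mult_self_eq algebra_simps)
qed

lemma sin_lip: "\<bar>sin x - sin y\<bar> \<le> \<bar>x - y\<bar>" for x y :: real
  using antiderivative_lipschitz[of sin cos 1 x y] by (simp add: DERIV_sin)

lemma cos_lip: "\<bar>cos x - cos y\<bar> \<le> \<bar>x - y\<bar>" for x y :: real
  using antiderivative_lipschitz[of cos "\<lambda>x. - sin x" 1 x y] by (simp add: DERIV_cos)

text \<open>A majorant of the indicator of the phases where the wave is nearly critical and does not
  stretch.\<close>

definition bump :: "real \<Rightarrow> real \<Rightarrow> real" where
  "bump k x = max 0 (2 - k * \<bar>cos (2 * pi * x)\<bar>)"

lemma bump_cont: "continuous_on S (bump k)"
  unfolding bump_def by (intro continuous_intros)

lemma bump_per: "bump k (x + 1) = bump k x"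
proof -
  have "cos (2 * pi * (x + 1)) = cos (2 * pi * x)"
    using cos_periodic[of "2 * pi * x"] by (simp add: algebra_simps)
  then show ?thesis by (simp add: bump_def)
qed

text \<open>As \<open>k\<close> grows, the bumps tend to twice the indicator of the zeros of the
  cosine, a countable set; dominated convergence does the rest.\<close>

lemma bump_small:
  assumes e: "\<epsilon> > 0" shows "\<exists>k>0. integral {0..1} (bump k) \<le> \<epsilon>"
proof -
  let ?g = "\<lambda>x::real. if cos (2 * pi * x) = 0 then 2 else 0 :: real"
  have "(?g has_integral 0) {0..1}"
  proof (rule has_integral_spike[where f = "\<lambda>_. 0"])
    have "{x::real. cos (2 * pi * x) = 0} \<subseteq> range (\<lambda>i::int. of_int i / 4)"
    proof
      fix x :: real assume "x \<in> {x. cos (2 * pi * x) = 0}"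
      then obtain i :: int where "2 * pi * x = of_int i * (pi / 2)"
        by (auto simp: cos_zero_iff_int)
      then have "x = of_int i / 4" by (simp add: field_simps)
      then show "x \<in> range (\<lambda>i::int. of_int i / 4)" by blast
    qed
    then have "countable {x::real. cos (2 * pi * x) = 0}"
      by (rule countable_subset) auto
    then have "negligible (\<Union>((\<lambda>x. {x}) ` {x::real. cos (2 * pi * x) = 0}))"
      by (intro negligible_countable_Union) auto
    then show "negligible {x::real. cos (2 * pi * x) = 0}" by simp
  qed auto
  then have g: "integral {0..1} ?g = 0" by (rule integral_unique)
  have "(\<lambda>n. integral {0..1} (bump (real (Suc n)))) \<longlonglongrightarrow> integral {0..1} ?g"
  proof (rule dominated_convergence(2))
    show "bump (real (Suc n)) integrable_on {0..1}" for n
      by (rule integrable_continuous_real) (rule bump_cont)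
    show "(\<lambda>_. 2) integrable_on {0..1::real}" by auto
    show "norm (bump (real (Suc n)) x) \<le> 2" if "x \<in> {0..1}" for n x
      by (auto simp: bump_def)
    show "(\<lambda>n. bump (real (Suc n)) x) \<longlonglongrightarrow> ?g x" if "x \<in> {0..1}" for x
    proof (cases "cos (2 * pi * x) = 0")
      case False
      obtain n0 :: nat where n0: "real n0 > 2 / \<bar>cos (2 * pi * x)\<bar>" using reals_Archimedean2 by blast
      have "bump (real (Suc n)) x = 0" if "n \<ge> n0" for n
      proof -
        have "2 < real n0 * \<bar>cos (2 * pi * x)\<bar>" using n0 False by (simp add: field_simps)
        also have "\<dots> \<le> real (Suc n) * \<bar>cos (2 * pi * x)\<bar>" using that by (intro mult_right_mono) auto
        finally show ?thesis unfolding bump_def by linarith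
      qed
      then show ?thesis using False
        by (intro tendsto_eventually) (auto simp: eventually_sequentially)
    qed (simp add: bump_def)
  qed
  then have "\<forall>\<^sub>F n in sequentially. integral {0..1} (bump (real (Suc n))) < \<epsilon>"
    unfolding g by (rule order_tendstoD) (rule e)
  then obtain n where "integral {0..1} (bump (real (Suc n))) < \<epsilon>"
    by (auto simp: eventually_sequentially)
  then show ?thesis by (intro exI[of _ "real (Suc n)"]) auto
qed

text \<open>Up to the sign convention this is an integer character of the plane; along
  \<open>v\<close> it advances at the rate \<open>q \<alpha> - p\<close>, the small divisor of the
  approximation \<open>p / q\<close>.\<close>

definition phase :: "int \<Rightarrow> nat \<Rightarrow> real \<times> real \<Rightarrow> real" where
  "phase p q z = real q * snd z - of_int p * fst z"

lemma phase_add: "phase p q (z + w) = phase p q z + phase p q w"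
  by (simp add: phase_def algebra_simps)

lemma phase_diff_bound: "\<bar>phase p q z - phase p q w\<bar> \<le> (real q + \<bar>of_int p\<bar>) * norm (z - w)"
proof -
  have "phase p q z - phase p q w = real q * snd (z - w) - of_int p * fst (z - w)"
    by (simp add: phase_def algebra_simps)
  also have "\<bar>\<dots>\<bar> \<le> real q * \<bar>snd (z - w)\<bar> + \<bar>of_int p\<bar> * \<bar>fst (z - w)\<bar>"
    by (metis abs_mult abs_of_nat abs_triangle_ineq4)
  also have "\<dots> \<le> real q * norm (z - w) + \<bar>of_int p\<bar> * norm (z - w)"
    using norm_fst_le[of "fst (z - w)" "snd (z - w)"] norm_snd_le[of "snd (z - w)" "fst (z - w)"]
    by (intro add_mono mult_left_mono) (simp_all only: prod.collapse real_norm_def of_nat_0_le_iff abs_ge_zero)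
  finally show ?thesis by (simp add: algebra_simps)
qed

lemma phase_Ints: "m \<in> \<int> \<times> \<int> \<Longrightarrow> phase p q m \<in> \<int>"
  by (auto simp: phase_def)

lemma lip_per_trig:
  assumes lip: "\<And>x y::real. \<bar>F x - F y\<bar> \<le> \<bar>x - y\<bar>" and b: "\<And>x. \<bar>F x\<bar> \<le> 1"
    and per: "\<And>x (n::int). F (x + 2 * pi * of_int n) = F x"
  shows "lip_per (2 * pi * (real q + \<bar>of_int p\<bar>)) 1 (\<lambda>z. F (2 * pi * phase p q z))"
proof (rule lip_perI)
  show "periodic (\<lambda>z. F (2 * pi * phase p q z))"
    unfolding periodic_def
  proof (intro allI ballI)
    fix z m :: "real \<times> real" assume "m \<in> \<int> \<times> \<int>"
    then obtain n :: int where "phase p q m = of_int n" using phase_Ints[of m p q] by (auto elim: Ints_cases)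
    then show "F (2 * pi * phase p q (z + m)) = F (2 * pi * phase p q z)"
      using per[of "2 * pi * phase p q z" n] by (simp add: phase_add algebra_simps)
  qed
  fix z w
  have "\<bar>F (2 * pi * phase p q z) - F (2 * pi * phase p q w)\<bar> \<le> \<bar>2 * pi * phase p q z - 2 * pi * phase p q w\<bar>"
    by (rule lip)
  also have "\<dots> = 2 * pi * \<bar>phase p q z - phase p q w\<bar>"
    by (simp add: right_diff_distrib[symmetric] abs_mult)
  also have "\<dots> \<le> 2 * pi * ((real q + \<bar>of_int p\<bar>) * norm (z - w))"
    by (intro mult_left_mono phase_diff_bound) auto
  finally show "\<bar>F (2 * pi * phase p q z) - F (2 * pi * phase p q w)\<bar> \<le> 2 * pi * (real q + \<bar>of_int p\<bar>) * norm (z - w)"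
    by (simp add: mult.assoc)
qed (rule b)

lemma sin_add_int: "sin (x + 2 * pi * of_int n) = sin x"
  and cos_add_int: "cos (x + 2 * pi * of_int n) = cos x"
  using sin.plus_of_int[of x n] cos.plus_of_int[of x n] by (simp_all add: mult.commute)

lemmas lip_per_sin = lip_per_trig[of sin, OF sin_lip abs_sin_le_one sin_add_int]
  and lip_per_cos = lip_per_trig[of cos, OF cos_lip abs_cos_le_one cos_add_int]

text \<open>For fixed \<open>x\<close> the phase is affine in \<open>y\<close> with integer slope
  \<open>q\<close>, so already the inner integral is independent of \<open>x\<close>.\<close>

lemma mean_bump_phase:
  assumes "q \<ge> 1"
  shows "mean (\<lambda>z. bump k (phase p q z)) = integral {0..1} (bump k)"
proof -
  have c: "continuous_on UNIV (\<lambda>z. bump k (phase p q z))"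
    unfolding phase_def by (intro cont_compose_UNIV[OF bump_cont] continuous_intros)
  have "integral {0..1} (\<lambda>y. bump k (phase p q (x, y))) = integral {0..1} (bump k)" for x
    using integral_periodic_shift_scale[of "bump k" q "- (of_int p * x)", OF bump_cont bump_per assms]
    by (simp add: phase_def)
  then show ?thesis by (simp add: mean_iterated[OF c])
qed

section \<open>Coboundaries, prime density and stability\<close>

context irrational_slope
begin

text \<open>The cohomological equation, imposed only along lines in direction \<open>v\<close>, with
  a Lipschitz transfer function. Moving each \<open>z\<close> to \<open>z + (u z / c) v\<close>
  conjugates the flow to the linear flow with velocity \<open>v / c\<close>.\<close>

definition cob :: "real \<Rightarrow> (real \<times> real \<Rightarrow> real) \<Rightarrow> (real \<times> real \<Rightarrow> real) \<Rightarrow> bool" where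
  "cob c f u \<longleftrightarrow> (\<exists>K U. lip_per K U u) \<and>
    (\<forall>z s. ((\<lambda>s. u (z + s *\<^sub>R v)) has_real_derivative f (z + s *\<^sub>R v) - c) (at s))"

lemma clock_cob:
  assumes "adm f" "cob c f u"
  shows "clock f z s = c * s + u (z + s *\<^sub>R v) - u z"
proof -
  have "((\<lambda>s. c * s + u (z + s *\<^sub>R v)) has_real_derivative f (z + s *\<^sub>R v)) (at s)" for s
  proof -
    have "((\<lambda>s. u (z + s *\<^sub>R v)) has_real_derivative f (z + s *\<^sub>R v) - c) (at s)"
      using assms(2) unfolding cob_def by blast
    then show ?thesis by (auto intro!: derivative_eq_intros)
  qed
  from clock_unique[OF assms(1) this, of s] show ?thesis by simp
qed

text \<open>The bound \<open>P\<close>, common to all \<open>z\<close> and \<open>w\<close>,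
  confines the condition to bounded times and thereby makes it stable under small changes of
  \<open>f\<close>.\<close>

definition prime_dense :: "(real \<times> real \<Rightarrow> real) \<Rightarrow> nat \<Rightarrow> real \<Rightarrow> bool" where
  "prime_dense f P \<epsilon> \<longleftrightarrow> (\<forall>z w. \<exists>p. prime p \<and> p \<le> P \<and>
     (\<exists>m\<in>\<int> \<times> \<int>. norm (Phi f (real p) z - w - m) < \<epsilon>))"

text \<open>Prime density for the linear flow with velocity \<open>v / c\<close>; there the starting
  point can be absorbed into the target \<open>w\<close>.\<close>

definition generic_speed :: "real \<Rightarrow> bool" where
  "generic_speed c \<longleftrightarrow> (\<forall>\<delta>>0. \<exists>P. \<forall>w. \<exists>p::nat. prime p \<and> p \<le> P \<and>
     (\<exists>m\<in>\<int> \<times> \<int>. norm ((real p / c) *\<^sub>R v - w - m) < \<delta>))"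

text \<open>Linear prime orbits are dense, and the conjugacy distorts small errors by a bounded
  factor only: an error \<open>e\<close> in position becomes an error \<open>K * norm e\<close> in
  time. The factor \<open>1 + K * norm v\<close> in \<delta> accounts for both.\<close>

lemma prime_dense_stage:
  assumes f: "adm f" and u: "cob c f u" and c: "c > 0" "generic_speed c" and e: "\<epsilon> > 0"
  shows "\<exists>P. prime_dense f P \<epsilon>"
proof -
  obtain K U where ul: "lip_per K U u" using u by (auto simp: cob_def)
  note KU = lip_per_nonneg[OF ul]
  define \<delta> where "\<delta> = \<epsilon> / (1 + K * norm v)"
  have pos: "1 + K * norm v > 0" using KU by (simp add: add_pos_nonneg)
  have d: "\<delta> > 0" using e pos by (simp add: \<delta>_def)
  obtain P where P: "\<And>w. \<exists>p::nat. prime p \<and> p \<le> P \<and> (\<exists>m\<in>\<int> \<times> \<int>. norm ((real p / c) *\<^sub>R v - w - m) < \<delta>)"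
    using c(2) d unfolding generic_speed_def by blast
  have "\<exists>p. prime p \<and> p \<le> P \<and> (\<exists>m\<in>\<int> \<times> \<int>. norm (Phi f (real p) z - w - m) < \<epsilon>)" for z w
  proof -
    \<comment> \<open>The linear flow is aimed at the target corrected by the displacement that the
      conjugacy causes between \<open>z\<close> and \<open>w\<close>.\<close>
    define w' where "w' = w - z - ((u z - u w) / c) *\<^sub>R v"
    obtain p m where pm: "prime p" "p \<le> P" "m \<in> \<int> \<times> \<int>" "norm ((real p / c) *\<^sub>R v - w' - m) < \<delta>"
      using P[of w'] by blast
    define e where "e = (real p / c) *\<^sub>R v - w' - m"
    \<comment> \<open>the time needed to travel \<open>s\<close> from \<open>z\<close> is \<open>p\<close> up to the variation of \<open>u\<close> between \<open>w\<close> and \<open>w + e\<close>\<close>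
    define s where "s = (real p + u z - u w) / c"
    have z: "z + s *\<^sub>R v = w + e + m"
      by (simp add: e_def w'_def s_def add_divide_distrib diff_divide_distrib algebra_simps)
    have "clock f z s = real p + (u (w + e) - u w)"
      using c lip_per_Ints[OF ul pm(3), of "w + e"] by (simp only: clock_cob[OF f u] z) (simp add: s_def)
    moreover have "\<bar>u (w + e) - u w\<bar> \<le> K * norm e"
      using lip_perD(3)[OF ul, of "w + e" w] by simp
    ultimately have "\<bar>clock f z s - clock f z (arrive f z (real p))\<bar> \<le> K * norm e"
      by (simp add: clock_arrive f)
    then have s: "\<bar>s - arrive f z (real p)\<bar> \<le> K * norm e"
      using clock_expand[OF f, of s "arrive f z (real p)" z] by linarith
    have "Phi f (real p) z - w - m = e + (arrive f z (real p) - s) *\<^sub>R v"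
      using z by (simp add: Phi_def algebra_simps)
    then have "norm (Phi f (real p) z - w - m) \<le> norm e + \<bar>arrive f z (real p) - s\<bar> * norm v"
      by (metis norm_triangle_ineq norm_scaleR)
    also have "\<dots> \<le> norm e + K * norm e * norm v"
      using s by (intro add_left_mono mult_right_mono) (auto simp: abs_minus_commute)
    also have "\<dots> = (1 + K * norm v) * norm e" by (simp add: algebra_simps)
    also have "\<dots> < (1 + K * norm v) * \<delta>" using pm(4) pos by (simp add: e_def)
    also have "\<dots> = \<epsilon>" using pos by (simp add: \<delta>_def)
    finally show ?thesis using pm by blast
  qed
  then show ?thesis unfolding prime_dense_def by blast
qed

lemma prime_dense_perturb:
  assumes f: "adm f" and g: "adm g" and pd: "prime_dense f P \<epsilon>"
    and le: "\<And>z. \<bar>f z - g z\<bar> \<le> \<eta>" and eta: "\<eta> * real P * norm v \<le> \<epsilon>"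
  shows "prime_dense g P (2 * \<epsilon>)"
  unfolding prime_dense_def
proof (intro allI)
  fix z w
  obtain p m where pm: "prime p" "p \<le> P" "m \<in> \<int> \<times> \<int>" "norm (Phi f (real p) z - w - m) < \<epsilon>"
    using pd unfolding prime_dense_def by blast
  have e0: "\<eta> \<ge> 0" using le[of 0] by linarith
  have "norm (Phi g (real p) z - Phi f (real p) z) \<le> \<eta> * real p * norm v"
    using Phi_perturb[OF f g le, of "real p" z] by (simp add: norm_minus_commute)
  also have "\<dots> \<le> \<eta> * real P * norm v" using pm e0 by (intro mult_right_mono mult_left_mono) auto
  finally have "norm (Phi g (real p) z - Phi f (real p) z) \<le> \<epsilon>" using eta by linarith
  moreover have "norm (Phi g (real p) z - w - m) \<le> norm (Phi g (real p) z - Phi f (real p) z) + norm (Phi f (real p) z - w - m)"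
    using norm_triangle_ineq[of "Phi g (real p) z - Phi f (real p) z" "Phi f (real p) z - w - m"]
    by (simp add: algebra_simps)
  ultimately have "norm (Phi g (real p) z - w - m) < 2 * \<epsilon>"
    using pm(4) by linarith
  then show "\<exists>p. prime p \<and> p \<le> P \<and> (\<exists>m\<in>\<int> \<times> \<int>. norm (Phi g (real p) z - w - m) < 2 * \<epsilon>)"
    using pm by blast
qed

text \<open>The asymmetry is deliberate: \<open>h\<close> is integrated against Lebesgue measure,
  whose translation invariance in the vertical direction the stretching argument uses. The invariant
  measure is recovered later by putting the density into \<open>h\<close>.\<close>

definition mixes :: "(real \<times> real \<Rightarrow> real) \<Rightarrow> real \<Rightarrow> real \<Rightarrow> bool" where
  "mixes f t \<epsilon> \<longleftrightarrow> (\<forall>g h. lip_per 1 1 g \<longrightarrow> lip_per 1 1 h \<longrightarrow>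
     \<bar>mean (\<lambda>z. g (Phi f t z) * h z) - average f g * mean h\<bar> \<le> \<epsilon>)"

text \<open>The numerator and the normalisation each contribute \<eta>, and dividing by
  \<open>mean f \<ge> 1\<close> costs nothing.\<close>

lemma average_perturb:
  assumes f: "adm f" and f': "adm f'" and le: "\<And>z. \<bar>f z - f' z\<bar> \<le> \<eta>"
    and g: "lip_per K 1 g"
  shows "\<bar>average f g - average f' g\<bar> \<le> 2 * \<eta>"
proof -
  note c = lip_per_cont[OF g, of UNIV] and cf = admD(2)[OF f, of UNIV] and cf' = admD(2)[OF f', of UNIV]
  have m: "mean f \<ge> 1" "mean f' \<ge> 1" using mean_ge_1 f f' by auto
  have 1: "\<bar>mean (\<lambda>z. g z * f z) - mean (\<lambda>z. g z * f' z)\<bar> \<le> \<eta>"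
  proof (rule mean_abs_diff_le_const)
    fix z
    have "\<bar>g z * f z - g z * f' z\<bar> = \<bar>g z\<bar> * \<bar>f z - f' z\<bar>"
      by (simp add: right_diff_distrib[symmetric] abs_mult)
    also have "\<dots> \<le> 1 * \<eta>" using lip_perD(2)[OF g] le by (intro mult_mono) auto
    finally show "\<bar>g z * f z - g z * f' z\<bar> \<le> \<eta>" by simp
  qed (intro continuous_intros c cf cf')+
  have 2: "\<bar>mean f - mean f'\<bar> \<le> \<eta>" by (rule mean_abs_diff_le_const[OF cf cf' le])
  have a: "\<bar>average f' g\<bar> \<le> 1" by (rule average_abs_le[OF f' c]) (rule lip_perD(2)[OF g])
  have "(average f g - average f' g) * mean f = (mean (\<lambda>z. g z * f z) - mean (\<lambda>z. g z * f' z))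
      + average f' g * (mean f' - mean f)"
    using m by (simp add: average_def field_simps)
  moreover have "\<bar>(average f g - average f' g) * mean f\<bar> = \<bar>average f g - average f' g\<bar> * mean f"
    "\<bar>average f' g * (mean f' - mean f)\<bar> = \<bar>average f' g\<bar> * \<bar>mean f' - mean f\<bar>"
    using m by (simp_all add: abs_mult)
  ultimately have "\<bar>average f g - average f' g\<bar> * mean f \<le> \<bar>mean (\<lambda>z. g z * f z) - mean (\<lambda>z. g z * f' z)\<bar>
      + \<bar>average f' g\<bar> * \<bar>mean f' - mean f\<bar>"
    by linarith
  also have "\<dots> \<le> \<eta> + 1 * \<eta>" using 1 2 a by (intro add_mono mult_mono) (auto simp: abs_minus_commute)
  finally have le2: "\<bar>average f g - average f' g\<bar> * mean f \<le> 2 * \<eta>" by simp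
  have "\<bar>average f g - average f' g\<bar> * 1 \<le> \<bar>average f g - average f' g\<bar> * mean f"
    using m by (intro mult_left_mono) auto
  from order_trans[OF this le2] show ?thesis by simp
qed

lemma Phi_cont:
  assumes "adm f" shows "continuous_on S (Phi f t)"
proof -
  obtain K B where K: "lip_per K B f" using assms by (auto simp: adm_def)
  have "(1 + K * \<bar>t\<bar> * norm v)-lipschitz_on UNIV (Phi f t)"
    by (rule lipschitz_onI)
      (use Phi_lip_space[OF assms K, of t] lip_per_nonneg[OF K] in \<open>auto simp: dist_norm\<close>)
  then show ?thesis using lipschitz_on_continuous_on continuous_on_subset by blast
qed

text \<open>One \<epsilon> each for the displaced orbit, for the changed invariant density and for
  the given mixing error.\<close>

lemma mixes_perturb:
  assumes f: "adm f" and f': "adm f'" and mix: "mixes f t \<epsilon>"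
    and le: "\<And>z. \<bar>f z - f' z\<bar> \<le> \<eta>" and eta: "\<eta> * \<bar>t\<bar> * norm v \<le> \<epsilon>" "2 * \<eta> \<le> \<epsilon>"
  shows "mixes f' t (3 * \<epsilon>)"
  unfolding mixes_def
proof (intro allI impI)
  fix g h assume g: "lip_per 1 1 g" and h: "lip_per 1 1 h"
  note cg = lip_per_cont[OF g, of UNIV] and ch = lip_per_cont[OF h, of UNIV]
  have "\<bar>mean (\<lambda>z. g (Phi f' t z) * h z) - mean (\<lambda>z. g (Phi f t z) * h z)\<bar> \<le> \<epsilon>"
  proof (rule mean_abs_diff_le_const)
    fix z
    have "\<bar>g (Phi f' t z) * h z - g (Phi f t z) * h z\<bar> = \<bar>g (Phi f' t z) - g (Phi f t z)\<bar> * \<bar>h z\<bar>"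
      by (simp add: left_diff_distrib[symmetric] abs_mult)
    also have "\<dots> \<le> (1 * norm (Phi f' t z - Phi f t z)) * 1"
      using lip_perD(3)[OF g] lip_perD(2)[OF h] by (intro mult_mono) auto
    also have "\<dots> \<le> \<epsilon>" using Phi_perturb[OF f f' le, of t z] eta by (simp add: norm_minus_commute)
    finally show "\<bar>g (Phi f' t z) * h z - g (Phi f t z) * h z\<bar> \<le> \<epsilon>" .
  qed (intro continuous_intros ch cont_compose_UNIV[OF cg] Phi_cont f f')+
  moreover have "\<bar>average f g * mean h - average f' g * mean h\<bar> \<le> \<epsilon>"
  proof -
    have "\<bar>mean h\<bar> \<le> 1" by (rule mean_abs_le[OF ch]) (rule lip_perD(2)[OF h])
    then have "\<bar>average f g - average f' g\<bar> * \<bar>mean h\<bar> \<le> (2 * \<eta>) * 1"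
      using average_perturb[OF f f' le g] by (intro mult_mono) auto
    then show ?thesis using eta by (simp add: left_diff_distrib[symmetric] abs_mult)
  qed
  moreover have "\<bar>mean (\<lambda>z. g (Phi f t z) * h z) - average f g * mean h\<bar> \<le> \<epsilon>"
    using mix g h unfolding mixes_def by blast
  ultimately show "\<bar>mean (\<lambda>z. g (Phi f' t z) * h z) - average f' g * mean h\<bar> \<le> 3 * \<epsilon>" by linarith
qed

section \<open>The stretching mechanism\<close>

lemma phase_line: "phase p q (z + s *\<^sub>R v) = phase p q z + s * (real q * \<alpha> - of_int p)"
  by (simp add: phase_def v_def algebra_simps)

text \<open>Differentiating along \<open>v\<close> brings down the small factor \<beta>: the
  transfer function changes by the amplitude \<open>A\<close>, the speed only by
  \<open>2 \<pi> A \<beta>\<close>, and \<open>c\<close> not at all.\<close>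

lemma cob_add_wave:
  assumes u: "cob c f u" and b: "\<beta> = real q * \<alpha> - of_int p"
  shows "cob c (\<lambda>z. f z + 2 * pi * A * \<beta> * cos (2 * pi * phase p q z)) (\<lambda>z. u z + A * sin (2 * pi * phase p q z))"
  unfolding cob_def
proof (intro conjI allI)
  obtain K U where ul: "lip_per K U u" using u by (auto simp: cob_def)
  show "\<exists>K U. lip_per K U (\<lambda>z. u z + A * sin (2 * pi * phase p q z))"
    using lip_per_add[OF ul lip_per_cmult[OF lip_per_sin]] by blast
  fix z s
  have "((\<lambda>s. u (z + s *\<^sub>R v)) has_real_derivative f (z + s *\<^sub>R v) - c) (at s)"
    using u unfolding cob_def by blast
  then show "((\<lambda>s. u (z + s *\<^sub>R v) + A * sin (2 * pi * phase p q (z + s *\<^sub>R v))) has_real_derivative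
      f (z + s *\<^sub>R v) + 2 * pi * A * \<beta> * cos (2 * pi * phase p q (z + s *\<^sub>R v)) - c) (at s)"
    unfolding phase_line b[symmetric] by (auto intro!: derivative_eq_intros)
qed

text \<open>At time \<open>t\<close> the phase has advanced by half a period (plus the small \<open>\<rho> \<beta>\<close>), so the two values of the wave
  at the ends of the orbit piece add up instead of cancelling: the point starting at height \<open>r\<close> above \<open>z\<close>
  is where the unperturbed orbit of \<open>z\<close> is at an essentially affine function of \<open>r\<close> with huge slope.\<close>

lemma stretch:
  assumes f: "adm f" and f': "adm f'" and u: "cob c f u" and ul: "lip_per K U u"
    and f'_def: "f' = (\<lambda>z. f z + 2 * pi * A * \<beta> * cos (2 * pi * phase p q z))"
    and b: "\<beta> = real q * \<alpha> - of_int p" "\<beta> \<noteq> 0" and c: "c \<ge> 2" and A: "A \<ge> 0"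
    and r: "0 \<le> r" "real q * r \<le> \<kappa>" and t: "t = c / (2 * \<bar>\<beta>\<bar>)"
  shows "\<bar>arrive f' (z + (0, r)) t -
      arrive f z ((t + 2 * A * sin (2 * pi * phase p q z)) + (4 * pi * A * real q * cos (2 * pi * phase p q z)) * r)\<bar>
    \<le> 2 * K * r + 2 * pi * A * (U + A) * \<bar>\<beta>\<bar> + 8 * pi\<^sup>2 * A * \<kappa>\<^sup>2"
proof -
  define y where "y = z + (0, r)"
  define s where "s = arrive f' y t"
  define \<rho> where "\<rho> = s - 1 / (2 * \<bar>\<beta>\<bar>)"
  define a where "a = 2 * pi * phase p q z"
  define x where "x = 2 * pi * real q * r"
  define W where "W = sin (a + x + 2 * pi * (\<rho> * \<beta>))"
  have ph: "2 * pi * phase p q y = a + x"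
    by (simp add: y_def phase_add a_def x_def phase_def algebra_simps)
  have cob': "cob c f' (\<lambda>z. u z + A * sin (2 * pi * phase p q z))"
    unfolding f'_def by (rule cob_add_wave[OF u b(1)])
  have "sin (2 * pi * phase p q (y + s *\<^sub>R v)) = sin (a + x + 2 * pi * (s * \<beta>))"
    unfolding phase_line b(1)[symmetric] using ph by (simp add: algebra_simps)
  \<comment> \<open>Half a period of the phase, in either direction, reverses the sign of the sine;
    \<rho> measures how far \<open>s\<close> is from the exact half period.\<close>
  also have "s * \<beta> = \<rho> * \<beta> + sgn \<beta> / 2"
    using b(2) by (simp add: \<rho>_def algebra_simps sgn_if)
  also have "sin (a + x + 2 * pi * (\<rho> * \<beta> + sgn \<beta> / 2)) = - W"
  proof -
    have "a + x + 2 * pi * (\<rho> * \<beta> + sgn \<beta> / 2) = (a + x + 2 * pi * (\<rho> * \<beta>)) + sgn \<beta> * pi"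
      by (simp add: algebra_simps)
    then show ?thesis using b(2) by (simp add: W_def sgn_if sin_add)
  qed
  finally have W: "sin (2 * pi * phase p q (y + s *\<^sub>R v)) = - W" .
  have ct: "t = c * s + (u (y + s *\<^sub>R v) - A * W) - (u y + A * sin (a + x))"
  proof -
    have "clock f' y s = t" by (simp add: s_def clock_arrive f')
    with clock_cob[OF f' cob', of y s] show ?thesis unfolding W ph by simp
  qed
  have Wb: "\<bar>W\<bar> \<le> 1" by (simp add: W_def)
  \<comment> \<open>At speed \<open>1 / c\<close> the time \<open>t\<close> would give exactly the
    half period, so \<open>c \<rho>\<close> is made up of transfer function values alone;
    \<open>c \<ge> 2\<close> removes the factor 2.\<close>
  have rho: "\<bar>\<rho>\<bar> \<le> U + A"
  proof -
    have "\<bar>A * W\<bar> \<le> A" "\<bar>A * sin (a + x)\<bar> \<le> A"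
      using A Wb by (simp_all add: abs_mult mult_left_le)
    moreover have "\<bar>u (y + s *\<^sub>R v)\<bar> \<le> U" "\<bar>u y\<bar> \<le> U" using lip_perD(2)[OF ul] by auto
    ultimately have "\<bar>c * s - t\<bar> \<le> 2 * U + 2 * A" using ct by linarith
    moreover have "c * s - t = c * \<rho>" by (simp add: \<rho>_def t field_simps)
    moreover have "2 * \<bar>\<rho>\<bar> \<le> \<bar>c * \<rho>\<bar>" using c by (simp add: abs_mult mult_right_mono)
    ultimately show ?thesis by linarith
  qed
  have "clock f z s - (t + 2 * A * sin a + 2 * A * (x * cos a)) =
      (u (z + s *\<^sub>R v) - u (y + s *\<^sub>R v)) + (u y - u z) + A * (W - sin (a + x))
      + 2 * A * (sin (a + x) - sin a - x * cos a)"
    by (subst clock_cob[OF f u], subst ct) (simp add: algebra_simps)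
  also have "\<bar>\<dots>\<bar> \<le> \<bar>u (z + s *\<^sub>R v) - u (y + s *\<^sub>R v)\<bar> + \<bar>u y - u z\<bar> + A * \<bar>W - sin (a + x)\<bar>
      + 2 * A * \<bar>sin (a + x) - sin a - x * cos a\<bar>"
  proof -
    have "A * \<bar>W - sin (a + x)\<bar> = \<bar>A * (W - sin (a + x))\<bar>"
      "2 * A * \<bar>sin (a + x) - sin a - x * cos a\<bar> = \<bar>2 * A * (sin (a + x) - sin a - x * cos a)\<bar>"
      using A by (simp_all add: abs_mult)
    then show ?thesis by linarith
  qed
  also have "\<dots> \<le> K * r + K * r + A * (2 * pi * ((U + A) * \<bar>\<beta>\<bar>)) + 2 * A * (4 * pi\<^sup>2 * \<kappa>\<^sup>2)"
  proof -
    have "\<bar>u (z + s *\<^sub>R v) - u (y + s *\<^sub>R v)\<bar> \<le> K * r" "\<bar>u y - u z\<bar> \<le> K * r"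
      using lip_perD(3)[OF ul, of "z + s *\<^sub>R v" "y + s *\<^sub>R v"] lip_perD(3)[OF ul, of y z] r
      by (simp_all add: y_def norm_Pair)
    moreover have "\<bar>W - sin (a + x)\<bar> \<le> 2 * pi * ((U + A) * \<bar>\<beta>\<bar>)"
    proof -
      have "\<bar>W - sin (a + x)\<bar> \<le> \<bar>2 * pi * (\<rho> * \<beta>)\<bar>"
        unfolding W_def using sin_lip[of "a + x + 2 * pi * (\<rho> * \<beta>)" "a + x"] by simp
      also have "\<dots> = 2 * pi * (\<bar>\<rho>\<bar> * \<bar>\<beta>\<bar>)" by (simp add: abs_mult)
      also have "\<dots> \<le> 2 * pi * ((U + A) * \<bar>\<beta>\<bar>)"
        using rho by (intro mult_left_mono mult_right_mono) auto
      finally show ?thesis .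
    qed
    moreover have "\<bar>sin (a + x) - sin a - x * cos a\<bar> \<le> 4 * pi\<^sup>2 * \<kappa>\<^sup>2"
    proof -
      have "\<bar>x\<bar> \<le> \<bar>2 * pi * \<kappa>\<bar>" using r by (simp add: x_def abs_mult mult.assoc)
      then have "x\<^sup>2 \<le> (2 * pi * \<kappa>)\<^sup>2" by (simp add: abs_le_square_iff)
      also have "\<dots> = 4 * pi\<^sup>2 * \<kappa>\<^sup>2" by (simp add: power_mult_distrib)
      finally show ?thesis using sin_taylor_bound[of a x] by linarith
    qed
    ultimately show ?thesis using A by (intro add_mono mult_left_mono) auto
  qed
  also have "\<dots> = 2 * K * r + 2 * pi * A * (U + A) * \<bar>\<beta>\<bar> + 8 * pi\<^sup>2 * A * \<kappa>\<^sup>2"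
    by (simp add: algebra_simps)
  finally have fin: "\<bar>clock f z s - (t + 2 * A * sin a + 2 * A * (x * cos a))\<bar>
    \<le> 2 * K * r + 2 * pi * A * (U + A) * \<bar>\<beta>\<bar> + 8 * pi\<^sup>2 * A * \<kappa>\<^sup>2" .
  have eq: "t + 2 * A * sin a + 2 * A * (x * cos a) =
    (t + 2 * A * sin (2 * pi * phase p q z)) + (4 * pi * A * real q * cos (2 * pi * phase p q z)) * r"
    by (simp add: a_def x_def)
  show ?thesis
    using fin clock_expand[OF f, of s "arrive f z (t + 2 * A * sin a + 2 * A * (x * cos a))" z]
    unfolding eq[symmetric] by (simp add: clock_arrive[OF f] s_def y_def)
qed

lemma Phi_cont_time: "adm f \<Longrightarrow> continuous_on S (\<lambda>t. Phi f t z)"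
proof -
  assume f: "adm f"
  have "(norm v)-lipschitz_on UNIV (\<lambda>t. Phi f t z)"
    by (rule lipschitz_onI) (use Phi_lip_time[OF f, of _ z] in \<open>auto simp: dist_norm mult.commute\<close>)
  then show ?thesis using lipschitz_on_continuous_on continuous_on_subset by blast
qed

text \<open>An affine reparametrization by time covers an orbit piece of length
  \<open>\<bar>\<mu>\<bar> * l\<close> in time; a negative slope covers the piece backwards, so it
  is started from its other end.\<close>

lemma affine_time_average:
  assumes f: "adm f" and g: "lip_per 1 1 g" and l: "l > 0" and L: "\<bar>\<mu>\<bar> * l \<ge> L0" "L0 > 0"
    and ta: "\<And>L z. L \<ge> L0 \<Longrightarrow> \<bar>integral {0..L} (\<lambda>t. g (Phi f t z)) - L * average f g\<bar> \<le> \<epsilon> * L"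
  shows "\<bar>integral {0..l} (\<lambda>r. g (Phi f (k + \<mu> * r) z)) - l * average f g\<bar> \<le> \<epsilon> * l"
proof -
  have mu: "\<mu> \<noteq> 0" using L by auto
  define k' where "k' = (if \<mu> > 0 then k else k + \<mu> * l)"
  define y where "y = Phi f k' z"
  have "continuous_on UNIV (\<lambda>t. g (Phi f t y))"
    by (intro cont_compose_UNIV[OF lip_per_cont[OF g]] Phi_cont_time f)
  then obtain G where G: "\<And>s. (G has_real_derivative g (Phi f s y)) (at s)"
    using antiderivative_exists by blast
  define M where "M = \<bar>\<mu>\<bar>"
  have M: "M > 0" using mu by (simp add: M_def)
  have "integral {0..l} (\<lambda>r. g (Phi f (k + \<mu> * r) z)) = (G (M * l) - G 0) / M"
  proof (cases "\<mu> > 0")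
    case True
    have d: "((\<lambda>r. G (\<mu> * r) / \<mu>) has_real_derivative g (Phi f (k + \<mu> * r) z)) (at r)" for r
    proof -
      have "((\<lambda>r. G (\<mu> * r) / \<mu>) has_real_derivative g (Phi f (\<mu> * r) y)) (at r)"
        using mu by (auto intro!: derivative_eq_intros DERIV_chain2[OF G])
      then show ?thesis using True by (simp add: y_def k'_def Phi_add[OF f, symmetric] add.commute)
    qed
    then show ?thesis using integral_antiderivative(2)[OF d, of 0 l] l True
      by (simp add: M_def diff_divide_distrib)
  next
    case False
    have d: "((\<lambda>r. - G (M * (l - r)) / M) has_real_derivative g (Phi f (k + \<mu> * r) z)) (at r)" for r
    proof -
      have "((\<lambda>r. - G (M * (l - r)) / M) has_real_derivative g (Phi f (M * (l - r)) y)) (at r)"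
        using M by (auto intro!: derivative_eq_intros DERIV_chain2[OF G])
      moreover have "M * (l - r) + (k + \<mu> * l) = k + \<mu> * r"
        using False by (simp add: M_def algebra_simps)
      ultimately show ?thesis using False by (simp add: y_def k'_def Phi_add[OF f, symmetric])
    qed
    then show ?thesis using integral_antiderivative(2)[OF d, of 0 l] l False
      by (simp add: diff_divide_distrib)
  qed
  moreover have "integral {0..M * l} (\<lambda>t. g (Phi f t y)) = G (M * l) - G 0"
    using integral_antiderivative(2)[OF G, of 0 "M * l"] M l by simp
  ultimately have eq: "integral {0..M * l} (\<lambda>t. g (Phi f t y)) = M * integral {0..l} (\<lambda>r. g (Phi f (k + \<mu> * r) z))"
    using M by simp
  have "M * l \<ge> L0" using L by (simp add: M_def)
  from ta[OF this, of y] have "\<bar>M * (integral {0..l} (\<lambda>r. g (Phi f (k + \<mu> * r) z)) - l * average f g)\<bar> \<le> M * (\<epsilon> * l)"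
    unfolding eq by (simp add: algebra_simps)
  then show ?thesis using M by (simp add: abs_mult)
qed

end

section \<open>Mixing at one time and the inductive construction\<close>

text \<open>The single index \<open>n\<close> controls both the size of \<open>q\<close> and the
  power to be beaten, which makes the condition a countable intersection of open sets. Rationals
  satisfy it too, through multiples of an exact fraction; this gives density for Baire's theorem,
  and irrationality is always demanded separately.\<close>

definition liouville :: "real \<Rightarrow> bool" where
  "liouville x \<longleftrightarrow> (\<forall>n::nat. \<exists>p q. n \<le> q \<and> 1 \<le> q \<and>
     \<bar>real q * x - of_int p\<bar> * (1 + \<bar>of_int p\<bar> + real q) ^ n < 1)"

definition wave_sum :: "real \<Rightarrow> (nat \<Rightarrow> real) \<Rightarrow> (nat \<Rightarrow> int) \<Rightarrow> (nat \<Rightarrow> nat) \<Rightarrow> real \<times> real \<Rightarrow> real" where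
  "wave_sum c a p q z = c + (\<Sum>n. a n * cos (2 * pi * phase (p n) (q n) z))"

context irrational_slope
begin

text \<open>The order of quantifiers is the point: \<open>A\<close> and \<open>b\<close> are fixed
  before \<open>p\<close> and \<open>q\<close>, so the Liouville property can afterwards make
  \<open>A * \<bar>\<beta>\<bar>\<close> small against any power of \<open>q\<close>. Vertical
  segments of length \<open>\<kappa> / q\<close> are so short that \<open>h\<close> is nearly
  constant on them, while their images follow long orbit pieces of the old flow, where
  \<open>g\<close> averages out.\<close>

lemma mixing_stage:
  assumes f: "adm f" and u: "cob c f u" and c: "c \<ge> 2" and e: "\<epsilon> > 0"
  shows "\<exists>A>0. \<exists>b>0. \<forall>p q \<beta>. q \<ge> 1 \<longrightarrow> \<beta> = real q * \<alpha> - of_int p \<longrightarrow> \<beta> \<noteq> 0 \<longrightarrow> \<bar>\<beta>\<bar> \<le> b \<longrightarrow>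
    adm (\<lambda>z. f z + 2 * pi * A * \<beta> * cos (2 * pi * phase p q z)) \<longrightarrow>
    mixes (\<lambda>z. f z + 2 * pi * A * \<beta> * cos (2 * pi * phase p q z)) (c / (2 * \<bar>\<beta>\<bar>)) \<epsilon>"
proof -
  obtain K U where ul: "lip_per K U u" using u by (auto simp: cob_def)
  note KU = lip_per_nonneg[OF ul]
  \<comment> \<open>The errors below add up to \<open>9 d\<close>: five from the segments, two from
    the bump and two from replacing the invariant density.\<close>
  define d where "d = \<epsilon> / 10"
  have d: "d > 0" using e by (simp add: d_def)
  obtain L0 where L0: "L0 > 0" and ta: "\<And>L g z. L \<ge> L0 \<Longrightarrow> lip_per 1 1 g \<Longrightarrow>
      \<bar>integral {0..L} (\<lambda>t. g (Phi f t z)) - L * average f g\<bar> \<le> d * L"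
    using time_average[OF f d, of 1 1] by blast
  obtain k where k: "k > 0" "integral {0..1} (bump k) \<le> d" using bump_small[OF d] by blast
  \<comment> \<open>In order, the last three terms make the stretched pieces longer than
    \<open>L0\<close> outside the bump, the segments shorter than \<open>d\<close>, and the errors
    from \<open>u\<close> and from the nonlinearity at most \<open>d\<close>.\<close>
  define N where "N = 1 + L0 * k + 1 / d + norm v * (2 * K + 8 * pi\<^sup>2) / d"
  have N: "N \<ge> 1" "N \<ge> L0 * k" "N \<ge> 1 / d" "N \<ge> norm v * (2 * K + 8 * pi\<^sup>2) / d"
    using L0 k d KU norm_v_pos by (auto simp: N_def add_nonneg_nonneg)
  have N2: "1 / N \<le> d" "norm v * (2 * K + 8 * pi\<^sup>2) / N \<le> d"
    using N d by (auto simp: field_simps)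
  \<comment> \<open>\<open>A \<kappa>\<close>, the length of the stretched segments, is large while the nonlinearity \<open>A \<kappa>\<^sup>2\<close> is small\<close>
  define A where "A = N ^ 4"
  define \<kappa> where "\<kappa> = 1 / N ^ 3"
  \<comment> \<open>Small enough for the excess phase in \<open>stretch\<close> and also for the
    uniform change \<open>2 \<pi> A \<beta>\<close> of the speed.\<close>
  define b where "b = d / ((1 + norm v) * (2 * pi * A * (1 + U + A)))"
  have A: "A > 0" using N by (simp add: A_def)
  have pos: "(1 + norm v) * (2 * pi * A * (1 + U + A)) > 0"
    using A KU norm_v_pos by (intro mult_pos_pos add_pos_pos add_pos_nonneg add_nonneg_nonneg) auto
  then have b: "b > 0" unfolding b_def by (rule divide_pos_pos[OF d])
  have kap: "\<kappa> > 0" "\<kappa> \<le> 1 / N" "A * \<kappa>\<^sup>2 \<le> 1 / N" "A * \<kappa> = N"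
  proof -
    have Np: "N > 0" using N by simp
    show "\<kappa> > 0" using Np by (simp add: \<kappa>_def)
    have "N ^ 1 \<le> N ^ 3" "N ^ 1 \<le> N ^ 2" by (rule power_increasing; use N in simp)+
    then show "\<kappa> \<le> 1 / N" using Np by (simp add: \<kappa>_def frac_le)
    have "A * \<kappa>\<^sup>2 = 1 / N ^ 2" using Np by (simp add: A_def \<kappa>_def field_simps flip: power_mult power_add)
    then show "A * \<kappa>\<^sup>2 \<le> 1 / N" using \<open>N ^ 1 \<le> N ^ 2\<close> Np by (simp add: frac_le)
    show "A * \<kappa> = N" using Np by (simp add: A_def \<kappa>_def eval_nat_numeral)
  qed
  have "mixes f' (c / (2 * \<bar>\<beta>\<bar>)) \<epsilon>"
    if q: "q \<ge> 1" and beta: "\<beta> = real q * \<alpha> - of_int p" "\<beta> \<noteq> 0" and bb: "\<bar>\<beta>\<bar> \<le> b"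
      and f'_def: "f' = (\<lambda>z. f z + 2 * pi * A * \<beta> * cos (2 * pi * phase p q z))" and f': "adm f'"
    for p q \<beta> f'
    unfolding mixes_def
  proof (intro allI impI)
    fix g h assume g: "lip_per 1 1 g" and h: "lip_per 1 1 h"
    note cg = lip_per_cont[OF g] and ch = lip_per_cont[OF h]
    define t where "t = c / (2 * \<bar>\<beta>\<bar>)"
    have small: "(1 + norm v) * (2 * pi * A * (1 + U + A) * \<bar>\<beta>\<bar>) \<le> d"
    proof -
      have "(1 + norm v) * (2 * pi * A * (1 + U + A)) * \<bar>\<beta>\<bar> \<le> (1 + norm v) * (2 * pi * A * (1 + U + A)) * b"
        using bb pos by (intro mult_left_mono) auto
      also have "\<dots> = d" using pos unfolding b_def by (metis less_irrefl nonzero_mult_div_cancel_left times_divide_eq_right)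
      finally show ?thesis by (simp add: mult.assoc)
    qed
    have small1: "norm v * (2 * pi * A * (U + A) * \<bar>\<beta>\<bar>) \<le> d"
    proof (rule order_trans[OF _ small])
      show "norm v * (2 * pi * A * (U + A) * \<bar>\<beta>\<bar>) \<le> (1 + norm v) * (2 * pi * A * (1 + U + A) * \<bar>\<beta>\<bar>)"
        using A KU by (intro mult_mono) auto
    qed
    have small2: "2 * pi * A * \<bar>\<beta>\<bar> \<le> d"
    proof -
      have "1 * (2 * pi * A * 1 * \<bar>\<beta>\<bar>) \<le> (1 + norm v) * (2 * pi * A * (1 + U + A) * \<bar>\<beta>\<bar>)"
        using A KU by (intro mult_mono) auto
      from order_trans[OF this small] show ?thesis by simp
    qed
    have close: "\<bar>f z - f' z\<bar> \<le> d" for z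
    proof -
      have "\<bar>f z - f' z\<bar> = 2 * pi * A * \<bar>\<beta>\<bar> * \<bar>cos (2 * pi * phase p q z)\<bar>"
        using A by (simp add: f'_def abs_mult)
      also have "\<dots> \<le> 2 * pi * A * \<bar>\<beta>\<bar> * 1" using A by (intro mult_left_mono) auto
      finally show ?thesis using small2 by simp
    qed
    define l where "l = \<kappa> / real q"
    have l: "l > 0" using kap q by (simp add: l_def)
    have lk: "l \<le> \<kappa>" using q kap by (simp add: l_def field_simps)
    have ld: "l \<le> d" using lk kap N2 by linarith
    define H where "H = (\<lambda>z. g (Phi f' t z) * h z)"
    obtain K1 B1 where "lip_per K1 B1 f'" using f' by (auto simp: adm_def)
    from lip_per_mult[OF lip_per_Phi[OF f' this g, of t] h]
    obtain K2 B2 where H: "lip_per K2 B2 H" unfolding H_def by blast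
    have Hc: "continuous_on S H" for S by (rule lip_per_cont[OF H])
    have avg: "\<bar>average f g\<bar> \<le> 1" by (rule average_abs_le[OF f cg]) (rule lip_perD(2)[OF g])
    have g1: "\<bar>g z\<bar> \<le> 1" and h1: "\<bar>h z\<bar> \<le> 1" for z using lip_perD(2) g h by blast+
    have H1: "\<bar>H z\<bar> \<le> 1" for z
      using mult_mono[OF g1[of "Phi f' t z"] h1[of z]] by (simp add: H_def abs_mult)
    have main: "\<bar>integral {0..l} (\<lambda>r. H (z + r *\<^sub>R (0, 1))) - l * (average f g * h z)\<bar>
        \<le> l * (5 * d + 2 * bump k (phase p q z))" for z
    \<comment> \<open>Near critical phases nothing is stretched and the trivial bound
      \<open>2 l\<close> is charged to the bump. Elsewhere the cosine is at least
      \<open>1 / k\<close> in absolute value, so the stretched piece has length at least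
      \<open>L0\<close>.\<close>
    proof (cases "bump k (phase p q z) \<ge> 1")
      case True
      have "norm (integral {0..l} (\<lambda>r. H (z + r *\<^sub>R (0, 1)))) \<le> integral {0..l} (\<lambda>_. 1)"
        by (rule integral_norm_bound_integral)
          (use H1 in \<open>auto intro!: integrable_continuous_real cont_compose_UNIV[OF Hc] continuous_intros\<close>)
      then have "\<bar>integral {0..l} (\<lambda>r. H (z + r *\<^sub>R (0, 1)))\<bar> \<le> l" using l by simp
      moreover have "\<bar>l * (average f g * h z)\<bar> \<le> l * (1 * 1)"
        unfolding abs_mult using avg h1[of z] l by (intro mult_mono) auto
      moreover have "l * 2 \<le> l * (5 * d + 2 * bump k (phase p q z))"
        using True d l by (intro mult_left_mono) auto
      ultimately show ?thesis by linarith
    next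
      case False
      define \<theta> where "\<theta> = phase p q z"
      have cosb: "k * \<bar>cos (2 * pi * \<theta>)\<bar> \<ge> 1" using False by (simp add: bump_def \<theta>_def)
      define K0 where "K0 = t + 2 * A * sin (2 * pi * \<theta>)"
      define \<mu> where "\<mu> = 4 * pi * A * real q * cos (2 * pi * \<theta>)"
      have "\<bar>\<mu>\<bar> * l = 4 * pi * N * \<bar>cos (2 * pi * \<theta>)\<bar>"
        using q A kap(4) by (simp add: \<mu>_def l_def abs_mult)
      moreover have "4 * pi * N * \<bar>cos (2 * pi * \<theta>)\<bar> \<ge> 1 * (L0 * k) * \<bar>cos (2 * pi * \<theta>)\<bar>"
        using N L0 k pi_gt3 by (intro mult_mono) auto
      moreover have "L0 * (k * \<bar>cos (2 * pi * \<theta>)\<bar>) \<ge> L0 * 1"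
        using cosb L0 by (intro mult_left_mono) auto
      ultimately have mul: "\<bar>\<mu>\<bar> * l \<ge> L0" by (simp add: mult.assoc)
      have B: "\<bar>integral {0..l} (\<lambda>r. g (Phi f (K0 + \<mu> * r) z)) - l * average f g\<bar> \<le> d * l"
        by (rule affine_time_average[OF f g l mul L0]) (rule ta[OF _ g])
      \<comment> \<open>One \<open>d\<close> for moving \<open>h\<close> to the foot of the segment;
        three for \<open>g\<close>, namely one for the height of the segment and two for the arrival
        error of \<open>stretch\<close>.\<close>
      have pt: "\<bar>H (z + r *\<^sub>R (0, 1)) - g (Phi f (K0 + \<mu> * r) z) * h z\<bar> \<le> 4 * d"
        if r: "r \<in> {0..l}" for r
      proof -
        define y where "y = z + (0, r)"
        have r0: "0 \<le> r" "r \<le> l" using r by auto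
        have qr: "real q * r \<le> \<kappa>" using r0 q by (simp add: l_def field_simps)
        have ny: "norm (y - z) \<le> d" using r0 ld by (simp add: y_def norm_Pair)
        have st: "\<bar>arrive f' y t - arrive f z (K0 + \<mu> * r)\<bar>
          \<le> 2 * K * r + 2 * pi * A * (U + A) * \<bar>\<beta>\<bar> + 8 * pi\<^sup>2 * A * \<kappa>\<^sup>2"
          unfolding y_def K0_def \<mu>_def \<theta>_def
          by (rule stretch[OF f f' u ul f'_def beta c _ r0(1) qr t_def]) (use A in simp)
        have r1: "r \<le> 1 / N" using r0 lk kap by linarith
        have "2 * K * r + 8 * pi\<^sup>2 * (A * \<kappa>\<^sup>2) \<le> 2 * K * (1 / N) + 8 * pi\<^sup>2 * (1 / N)"
          using r1 kap KU by (intro add_mono mult_left_mono) auto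
        also have "\<dots> = (2 * K + 8 * pi\<^sup>2) / N" by (simp add: add_divide_distrib)
        finally have "norm v * (2 * K * r + 8 * pi\<^sup>2 * (A * \<kappa>\<^sup>2)) \<le> norm v * ((2 * K + 8 * pi\<^sup>2) / N)"
          by (rule mult_left_mono) simp
        then have "norm v * (2 * K * r + 8 * pi\<^sup>2 * (A * \<kappa>\<^sup>2)) \<le> d" using N2 by simp
        moreover have "norm v * \<bar>arrive f' y t - arrive f z (K0 + \<mu> * r)\<bar>
            \<le> norm v * (2 * K * r + 8 * pi\<^sup>2 * (A * \<kappa>\<^sup>2) + 2 * pi * A * (U + A) * \<bar>\<beta>\<bar>)"
          using st by (intro mult_left_mono) (auto simp: algebra_simps)
        ultimately have nv: "norm v * \<bar>arrive f' y t - arrive f z (K0 + \<mu> * r)\<bar> \<le> 2 * d"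
          using small1 by (simp add: distrib_left)
        have "Phi f' t y - Phi f (K0 + \<mu> * r) z = (y - z) + (arrive f' y t - arrive f z (K0 + \<mu> * r)) *\<^sub>R v"
          by (simp add: Phi_def algebra_simps)
        then have "norm (Phi f' t y - Phi f (K0 + \<mu> * r) z) \<le> norm (y - z) + \<bar>arrive f' y t - arrive f z (K0 + \<mu> * r)\<bar> * norm v"
          by (metis norm_triangle_ineq norm_scaleR)
        then have "norm (Phi f' t y - Phi f (K0 + \<mu> * r) z) \<le> 3 * d" using ny nv by (simp add: mult.commute)
        then have G: "\<bar>g (Phi f' t y) - g (Phi f (K0 + \<mu> * r) z)\<bar> \<le> 3 * d"
          using lip_perD(3)[OF g, of "Phi f' t y" "Phi f (K0 + \<mu> * r) z"] by linarith
        have Hh: "\<bar>h y - h z\<bar> \<le> d" using lip_perD(3)[OF h, of y z] ny by linarith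
        have "g (Phi f' t y) * h y - g (Phi f (K0 + \<mu> * r) z) * h z =
          g (Phi f' t y) * (h y - h z) + (g (Phi f' t y) - g (Phi f (K0 + \<mu> * r) z)) * h z"
          by (simp add: algebra_simps)
        also have "\<bar>\<dots>\<bar> \<le> \<bar>g (Phi f' t y)\<bar> * \<bar>h y - h z\<bar> + \<bar>g (Phi f' t y) - g (Phi f (K0 + \<mu> * r) z)\<bar> * \<bar>h z\<bar>"
          by (metis abs_mult abs_triangle_ineq)
        also have "\<dots> \<le> 1 * d + (3 * d) * 1" using G Hh g1 h1 by (intro add_mono mult_mono) auto
        finally show ?thesis by (simp add: H_def y_def)
      qed
      have i1: "(\<lambda>r. H (z + r *\<^sub>R (0, 1))) integrable_on {0..l}"
        by (intro integrable_continuous_real cont_compose_UNIV[OF Hc] continuous_intros)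
      have i2: "(\<lambda>r. g (Phi f (K0 + \<mu> * r) z) * h z) integrable_on {0..l}"
        by (intro integrable_continuous_real continuous_intros cont_compose_UNIV[OF cg]
          cont_compose_UNIV[OF Phi_cont_time[OF f]])
      have "\<bar>integral {0..l} (\<lambda>r. H (z + r *\<^sub>R (0, 1))) - integral {0..l} (\<lambda>r. g (Phi f (K0 + \<mu> * r) z) * h z)\<bar> \<le> 4 * d * l"
      proof -
        have "norm (integral {0..l} (\<lambda>r. H (z + r *\<^sub>R (0, 1)) - g (Phi f (K0 + \<mu> * r) z) * h z)) \<le> integral {0..l} (\<lambda>_. 4 * d)"
          by (rule integral_norm_bound_integral[OF integrable_diff[OF i1 i2]]) (use pt in auto)
        moreover have "integral {0..l} (\<lambda>_. 4 * d) = 4 * d * l" using l by simp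
        ultimately show ?thesis unfolding integral_diff[OF i1 i2] real_norm_def by linarith
      qed
      moreover have "\<bar>integral {0..l} (\<lambda>r. g (Phi f (K0 + \<mu> * r) z) * h z) - l * (average f g * h z)\<bar> \<le> d * l"
      proof -
        have "integral {0..l} (\<lambda>r. g (Phi f (K0 + \<mu> * r) z) * h z) - l * (average f g * h z)
          = (integral {0..l} (\<lambda>r. g (Phi f (K0 + \<mu> * r) z)) - l * average f g) * h z"
          by (simp add: algebra_simps)
        also have "\<bar>\<dots>\<bar> \<le> (d * l) * 1" unfolding abs_mult using B h1[of z] d l by (intro mult_mono) auto
        finally show ?thesis by simp
      qed
      moreover have "4 * d * l + d * l \<le> l * (5 * d + 2 * bump k (phase p q z))"
      proof -
        have "l * (5 * d) \<le> l * (5 * d + 2 * bump k (phase p q z))"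
          using l by (intro mult_left_mono) (auto simp: bump_def)
        moreover have "4 * d * l + d * l = l * (5 * d)" by simp
        ultimately show ?thesis by linarith
      qed
      ultimately show ?thesis by linarith
    qed
    have cb: "continuous_on UNIV (\<lambda>z. bump k (phase p q z))"
      unfolding phase_def by (intro cont_compose_UNIV[OF bump_cont] continuous_intros)
    have "\<bar>mean H - mean (\<lambda>z. average f g * h z)\<bar> \<le> mean (\<lambda>z. 5 * d + 2 * bump k (phase p q z))"
      by (rule mean_local_average[OF Hc lip_perD(1)[OF H] l _ _ main])
        (intro continuous_intros ch cb)+
    moreover have "mean (\<lambda>z. 5 * d + 2 * bump k (phase p q z)) = 5 * d + 2 * integral {0..1} (bump k)"
      by (subst mean_add) (auto intro!: continuous_intros cb simp: mean_const mean_cmult mean_bump_phase[OF q])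
    ultimately have 1: "\<bar>mean H - average f g * mean h\<bar> \<le> 7 * d"
      using k(2) by (simp add: mean_cmult)
    have "\<bar>average f g - average f' g\<bar> * \<bar>mean h\<bar> \<le> (2 * d) * 1"
      using average_perturb[OF f f' close g] mean_abs_le[OF ch h1] by (intro mult_mono) auto
    then have 2: "\<bar>average f g * mean h - average f' g * mean h\<bar> \<le> 2 * d"
      by (simp add: left_diff_distrib[symmetric] abs_mult)
    show "\<bar>mean (\<lambda>z. g (Phi f' (c / (2 * \<bar>\<beta>\<bar>)) z) * h z) - average f' g * mean h\<bar> \<le> \<epsilon>"
    proof -
      have "10 * d = \<epsilon>" by (simp add: d_def)
      then have "\<bar>mean H - average f' g * mean h\<bar> \<le> \<epsilon>" using 1 2 d by linarith
      then show ?thesis by (simp add: H_def t_def)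
    qed
  qed
  then show ?thesis using A b by blast
qed

lemma adm_add_wave:
  assumes f: "adm f" and lb: "\<And>z. f z \<ge> 1 + \<delta>" and a: "\<bar>a\<bar> \<le> \<delta>"
  shows "adm (\<lambda>z. f z + a * cos (2 * pi * phase p q z))"
    and "f z + a * cos (2 * pi * phase p q z) \<ge> 1 + (\<delta> - \<bar>a\<bar>)"
proof -
  have b: "\<bar>a * cos (2 * pi * phase p q z)\<bar> \<le> \<bar>a\<bar>" for z
    by (simp add: abs_mult mult_left_le)
  show *: "f z + a * cos (2 * pi * phase p q z) \<ge> 1 + (\<delta> - \<bar>a\<bar>)" for z
    using b[of z] lb[of z] by linarith
  obtain K B where "lip_per K B f" using f by (auto simp: adm_def)
  from lip_per_add[OF this lip_per_cmult[OF lip_per_cos]]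
  have "\<exists>K B. lip_per K B (\<lambda>z. f z + a * cos (2 * pi * phase p q z))" by blast
  then show "adm (\<lambda>z. f z + a * cos (2 * pi * phase p q z))"
    unfolding adm_def using a by (intro conjI allI order_trans[OF _ *]) auto
qed

section \<open>The inductive construction\<close>

text \<open>One spare power of \<open>1 + \<bar>p\<bar> + q\<close>, which is large because
  \<open>q\<close> is, turns the bound 1 into \<epsilon>.\<close>

lemma liouville_approx:
  assumes li: "liouville \<alpha>" and e: "\<epsilon> > 0"
  shows "\<exists>p q. 1 \<le> q \<and> \<bar>real q * \<alpha> - of_int p\<bar> * (1 + \<bar>of_int p\<bar> + real q) ^ n \<le> \<epsilon>"
proof -
  obtain N0 :: nat where N0: "real N0 > 1 / \<epsilon>" using reals_Archimedean2 by blast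
  define N where "N = Suc (max n N0)"
  obtain p q where pq: "N \<le> q" "1 \<le> q" "\<bar>real q * \<alpha> - of_int p\<bar> * (1 + \<bar>of_int p\<bar> + real q) ^ N < 1"
    using li unfolding liouville_def by blast
  define X where "X = 1 + \<bar>of_int p\<bar> + real q"
  have X: "X \<ge> real N" "X \<ge> 1" using pq(1) by (auto simp: X_def)
  have "X ^ Suc n \<le> X ^ N" using X by (intro power_increasing) (auto simp: N_def)
  then have "\<bar>real q * \<alpha> - of_int p\<bar> * X ^ Suc n \<le> 1"
    using mult_left_mono[of "X ^ Suc n" "X ^ N" "\<bar>real q * \<alpha> - of_int p\<bar>"] pq(3) by (simp add: X_def)
  then have "(\<bar>real q * \<alpha> - of_int p\<bar> * X ^ n) * X \<le> 1" by (simp add: mult_ac)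
  then have "\<bar>real q * \<alpha> - of_int p\<bar> * X ^ n \<le> 1 / X" using X by (simp add: field_simps)
  also have "\<dots> \<le> \<epsilon>"
  proof -
    have "X \<ge> 1 / \<epsilon>" using N0 X by (simp add: N_def)
    then have "X * \<epsilon> \<ge> 1" using e by (simp add: field_simps)
    then show ?thesis using X by (simp add: field_simps)
  qed
  finally show ?thesis using pq(2) unfolding X_def by blast
qed

text \<open>The wave leaves \<open>c\<close> alone, so prime density after the step is automatic by
  genericity; only mixing and the required smallness of \<open>a\<close> constrain the choice of
  \<open>p\<close> and \<open>q\<close>.\<close>

lemma stage_step:
  assumes li: "liouville \<alpha>" and f: "adm f" and lb: "\<And>z. f z \<ge> 1 + \<delta>" and u: "cob c f u"
    and c: "c \<ge> 2" "generic_speed c" and eta: "\<eta> > 0" "\<eta> \<le> \<delta>" and e: "\<epsilon> > 0"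
  shows "\<exists>p q a u' t P. q \<ge> 1 \<and> \<bar>a\<bar> * (1 + \<bar>of_int p\<bar> + real q) ^ n \<le> \<eta> \<and> \<bar>a\<bar> \<le> \<eta> \<and>
    adm (\<lambda>z. f z + a * cos (2 * pi * phase p q z)) \<and>
    cob c (\<lambda>z. f z + a * cos (2 * pi * phase p q z)) u' \<and>
    mixes (\<lambda>z. f z + a * cos (2 * pi * phase p q z)) t \<epsilon> \<and>
    prime_dense (\<lambda>z. f z + a * cos (2 * pi * phase p q z)) P \<epsilon>"
proof -
  obtain A b where A: "A > 0" and b: "b > 0" and mx: "\<And>p q \<beta>. q \<ge> 1 \<Longrightarrow> \<beta> = real q * \<alpha> - of_int p \<Longrightarrow> \<beta> \<noteq> 0 \<Longrightarrow> \<bar>\<beta>\<bar> \<le> b \<Longrightarrow>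
    adm (\<lambda>z. f z + 2 * pi * A * \<beta> * cos (2 * pi * phase p q z)) \<Longrightarrow>
    mixes (\<lambda>z. f z + 2 * pi * A * \<beta> * cos (2 * pi * phase p q z)) (c / (2 * \<bar>\<beta>\<bar>)) \<epsilon>"
    using mixing_stage[OF f u c(1) e] by blast
  define d where "d = min b (\<eta> / (2 * pi * A))"
  have d: "d > 0" using A b eta by (simp add: d_def)
  obtain p q where pq: "1 \<le> q" "\<bar>real q * \<alpha> - of_int p\<bar> * (1 + \<bar>of_int p\<bar> + real q) ^ n \<le> d"
    using liouville_approx[OF li d] by blast
  define \<beta> where "\<beta> = real q * \<alpha> - of_int p"
  define X where "X = (1 + \<bar>of_int p\<bar> + real q) ^ n"
  define a where "a = 2 * pi * A * \<beta>"
  have X: "X \<ge> 1" unfolding X_def by (rule one_le_power) auto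
  have bX: "\<bar>\<beta>\<bar> * X \<le> d" using pq(2) by (simp add: \<beta>_def X_def)
  have "\<bar>\<beta>\<bar> * 1 \<le> \<bar>\<beta>\<bar> * X" using X by (intro mult_left_mono) auto
  then have b1: "\<bar>\<beta>\<bar> \<le> b" using bX by (simp add: d_def)
  have aX: "\<bar>a\<bar> * X \<le> \<eta>"
  proof -
    have "\<bar>a\<bar> * X = 2 * pi * A * (\<bar>\<beta>\<bar> * X)" using A by (simp add: a_def abs_mult)
    also have "\<dots> \<le> 2 * pi * A * (\<eta> / (2 * pi * A))"
      using bX A by (intro mult_left_mono) (auto simp: d_def)
    finally show ?thesis using A by simp
  qed
  have "\<bar>a\<bar> * 1 \<le> \<bar>a\<bar> * X" using X by (intro mult_left_mono) auto
  then have a: "\<bar>a\<bar> \<le> \<eta>" using aX by simp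
  \<comment> \<open>Irrationality enters here: the mixing time
    \<open>c / (2 \<bar>\<beta>\<bar>)\<close> has to be a genuine one.\<close>
  have bnz: "\<beta> \<noteq> 0"
  proof
    assume "\<beta> = 0"
    then have "\<alpha> = of_int p / of_nat q" using pq(1) by (simp add: \<beta>_def field_simps)
    then show False using irrational by (metis Rats_divide Rats_of_int Rats_of_nat)
  qed
  have f': "adm (\<lambda>z. f z + a * cos (2 * pi * phase p q z))"
    using adm_add_wave(1)[OF f lb, of a] a eta by simp
  have u': "cob c (\<lambda>z. f z + a * cos (2 * pi * phase p q z)) (\<lambda>z. u z + A * sin (2 * pi * phase p q z))"
    unfolding a_def by (rule cob_add_wave[OF u \<beta>_def])
  have m: "mixes (\<lambda>z. f z + a * cos (2 * pi * phase p q z)) (c / (2 * \<bar>\<beta>\<bar>)) \<epsilon>"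
    using mx[OF pq(1) \<beta>_def bnz b1] f' unfolding a_def by blast
  obtain P where "prime_dense (\<lambda>z. f z + a * cos (2 * pi * phase p q z)) P \<epsilon>"
    using prime_dense_stage[OF f' u' _ c(2) e] c(1) by auto
  then show ?thesis using pq(1) aX a f' u' m unfolding X_def by blast
qed

text \<open>\<open>good\<close> speaks about a whole ball around the new stage and thus about the
  limit, for which no coboundary form is claimed. The lower bound starts from
  \<open>c \<ge> 2\<close> and stage \<open>n\<close> spends at most \<open>2^-(n+1)\<close> of it,
  so the limit stays above 1.\<close>

lemma mixing_speed_exists:
  assumes li: "liouville \<alpha>" and c: "c \<ge> 2" "generic_speed c"
  shows "\<exists>a p q. (\<forall>k. summable (\<lambda>n. \<bar>a n\<bar> * (1 + \<bar>of_int (p n)\<bar> + real (q n)) ^ k)) \<and>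
    adm (wave_sum c a p q) \<and>
    (\<forall>n. \<exists>t P. mixes (wave_sum c a p q) t (1 / Suc n) \<and> prime_dense (wave_sum c a p q) P (1 / Suc n))"
proof -
  \<comment> \<open>The clause for \<open>n = 0\<close> pins the start to the constant
    \<open>c\<close>, which later identifies the stages with partial sums of
    \<open>wave_sum\<close>.\<close>
  define Pr where "Pr = (\<lambda>(n::nat) x. case x of (f, u::real \<times> real \<Rightarrow> real, \<eta>::real, p::int, q::nat, a::real) \<Rightarrow>
    (n = 0 \<longrightarrow> f = (\<lambda>_. c)) \<and> adm f \<and> (\<forall>z. f z \<ge> 1 + (1/2)^n) \<and> cob c f u \<and> 0 < \<eta>)"
  \<comment> \<open>\<open>\<eta>\<close> is the total perturbation that all later stages together are allowed to make\<close>
  define good where "good = (\<lambda>(n::nat) f (\<eta>::real). \<exists>t P. \<forall>g. adm g \<longrightarrow> (\<forall>z. \<bar>f z - g z\<bar> \<le> \<eta>) \<longrightarrow>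
    mixes g t (1 / Suc n) \<and> prime_dense g P (1 / Suc n))"
  define Qr where "Qr = (\<lambda>(n::nat) x y. case x of (f, u::real \<times> real \<Rightarrow> real, \<eta>::real, p::int, q::nat, a::real) \<Rightarrow>
    case y of (f', u'::real \<times> real \<Rightarrow> real, \<eta>', p', q', a') \<Rightarrow>
      f' = (\<lambda>z. f z + a' * cos (2 * pi * phase p' q' z)) \<and>
      \<bar>a'\<bar> * (1 + \<bar>of_int p'\<bar> + real q') ^ n \<le> (1/2)^Suc n \<and> \<bar>a'\<bar> \<le> \<eta> / 2 \<and> \<eta>' \<le> \<eta> / 2 \<and> good n f' \<eta>')"
  have "\<exists>x. \<forall>n. Pr n (x n) \<and> Qr n (x n) (x (Suc n))"
  proof (rule dependent_nat_choice)
    have "adm (\<lambda>_. c)" using lip_per_const[of c "\<bar>c\<bar>"] c by (auto simp: adm_def)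
    moreover have "cob c (\<lambda>_. c) (\<lambda>_. 0)"
      using lip_per_const[of 0 0] by (auto simp: cob_def)
    ultimately have "Pr 0 (\<lambda>_. c, \<lambda>_. 0, 1, 0, 0, 0)" using c by (simp add: Pr_def)
    then show "\<exists>x. Pr 0 x" by blast
  next
    fix x n assume "Pr n x"
    obtain f u \<eta> p0 q0 a0 where x: "x = (f, u, \<eta>, p0, q0, a0)" by (cases x) auto
    have f: "adm f" and lb: "\<And>z. f z \<ge> 1 + (1/2)^n" and u: "cob c f u" and eta: "\<eta> > 0"
      using \<open>Pr n x\<close> by (auto simp: Pr_def x)
    define \<eta>1 where "\<eta>1 = min (\<eta> / 2) ((1/2)^Suc n)"
    \<comment> \<open>Perturbation triples the mixing error and doubles the prime density
      error.\<close>
    define e where "e = 1 / (3 * real (Suc n))"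
    have e1: "\<eta>1 > 0" "\<eta>1 \<le> (1/2)^n" "\<eta>1 \<le> \<eta> / 2" "\<eta>1 \<le> (1/2)^Suc n" and e: "e > 0"
      using eta by (auto simp: \<eta>1_def e_def min_le_iff_disj)
    obtain p q a u' t P where st: "\<bar>a\<bar> * (1 + \<bar>of_int p\<bar> + real q) ^ n \<le> \<eta>1" "\<bar>a\<bar> \<le> \<eta>1"
      "adm (\<lambda>z. f z + a * cos (2 * pi * phase p q z))"
      "cob c (\<lambda>z. f z + a * cos (2 * pi * phase p q z)) u'"
      "mixes (\<lambda>z. f z + a * cos (2 * pi * phase p q z)) t e"
      "prime_dense (\<lambda>z. f z + a * cos (2 * pi * phase p q z)) P e"
      using stage_step[OF li f lb u c e1(1,2) e, of n] by blast
    define f' where "f' = (\<lambda>z. f z + a * cos (2 * pi * phase p q z))"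
    \<comment> \<open>Dominates the factors of \<eta> in the two perturbation lemmas, so that the
      radius \<open>e / M\<close> is admissible for both.\<close>
    define M where "M = 1 + \<bar>t\<bar> * norm v + real P * norm v + 2"
    have M: "M > 0" "\<bar>t\<bar> * norm v \<le> M" "real P * norm v \<le> M" "2 \<le> M"
      by (auto simp: M_def add_pos_nonneg add_nonneg_nonneg)
    define \<eta>' where "\<eta>' = min (\<eta> / 2) (e / M)"
    have eta': "\<eta>' > 0" "\<eta>' \<le> \<eta> / 2" using eta e M(1) unfolding \<eta>'_def by (simp, linarith)
    have bd: "\<eta>' * y \<le> e" if "0 \<le> y" "y \<le> M" for y
    proof -
      have "\<eta>' * y \<le> (e / M) * M" using that e M eta' by (intro mult_mono) (auto simp: \<eta>'_def)
      then show ?thesis using M by simp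
    qed
    have "good n f' \<eta>'"
      unfolding good_def
    proof (intro exI allI impI conjI)
      fix g assume g: "adm g" and close: "\<forall>z. \<bar>f' z - g z\<bar> \<le> \<eta>'"
      have close': "\<bar>f' z - g z\<bar> \<le> \<eta>'" for z using close by blast
      have "mixes g t (3 * e)"
        by (rule mixes_perturb[OF st(3)[folded f'_def] g st(5)[folded f'_def] close'])
          (use bd[OF _ M(2)] bd[OF _ M(4)] in \<open>simp_all add: mult.assoc\<close>)
      moreover have "3 * e = 1 / Suc n" by (simp add: e_def field_simps)
      ultimately show "mixes g t (1 / Suc n)" by metis
      have "prime_dense g P (2 * e)"
        by (rule prime_dense_perturb[OF st(3)[folded f'_def] g st(6)[folded f'_def] close'])
          (use bd[OF _ M(3)] in \<open>auto simp: mult.assoc\<close>)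
      moreover have "2 * e \<le> 1 / Suc n" by (simp add: e_def field_simps)
      ultimately show "prime_dense g P (1 / Suc n)"
        unfolding prime_dense_def by (meson order_less_le_trans)
    qed
    moreover have "f' z \<ge> 1 + (1/2)^Suc n" for z
    proof -
      have "f' z \<ge> 1 + ((1/2)^n - \<bar>a\<bar>)"
        unfolding f'_def by (rule adm_add_wave(2)[OF f lb]) (use st(2) e1 in linarith)
      then show ?thesis using st(2) e1(4) by simp
    qed
    ultimately have "Pr (Suc n) (f', u', \<eta>', p, q, a) \<and> Qr n x (f', u', \<eta>', p, q, a)"
      using st e1 eta' by (auto simp: Pr_def Qr_def x f'_def simp del: power_Suc)
    then show "\<exists>y. Pr (Suc n) y \<and> Qr n x y" by blast
  qed
  then obtain x where x: "\<And>n. Pr n (x n)" "\<And>n. Qr n (x n) (x (Suc n))" by blast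
  define F where "F n = fst (x n)" for n
  define \<eta> where "\<eta> n = fst (snd (snd (x n)))" for n
  \<comment> \<open>The wave added in passing from stage \<open>n\<close> to \<open>n + 1\<close> is
    stored in stage \<open>n + 1\<close> and indexed by \<open>n\<close>; the entries of the initial
    tuple are dummies.\<close>
  define p where "p n = fst (snd (snd (snd (x (Suc n)))))" for n
  define q where "q n = fst (snd (snd (snd (snd (x (Suc n))))))" for n
  define a where "a n = snd (snd (snd (snd (snd (x (Suc n))))))" for n
  define w where "w n z = a n * cos (2 * pi * phase (p n) (q n) z)" for n z
  define X where "X n = 1 + \<bar>of_int (p n)\<bar> + real (q n)" for n
  have P: "adm (F n)" "F n z \<ge> 1 + (1/2)^n" "0 < \<eta> n" for n z
    using x(1)[of n] by (auto simp: Pr_def F_def \<eta>_def simp del: split_paired_All split: prod.splits)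
  have Q: "F (Suc n) z = F n z + w n z" "\<bar>a n\<bar> * X n ^ n \<le> (1/2)^Suc n" "\<bar>a n\<bar> \<le> \<eta> n / 2"
    "\<eta> (Suc n) \<le> \<eta> n / 2" "good n (F (Suc n)) (\<eta> (Suc n))" for n z
    using x(2)[of n] by (auto simp: Qr_def F_def \<eta>_def p_def q_def a_def w_def X_def simp del: power_Suc split: prod.splits)
  have X1: "X n \<ge> 1" for n by (simp add: X_def)
  have half: "summable (\<lambda>n. (1/2::real)^Suc n)" by (simp add: summable_geometric)
  \<comment> \<open>Step \<open>n\<close> beats the power \<open>n\<close>, hence from
    \<open>n = k\<close> on also the fixed power \<open>k\<close>; this diagonal choice gives
    smoothness of all orders.\<close>
  have sumk: "summable (\<lambda>n. \<bar>a n\<bar> * X n ^ k)" for k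
  proof (rule summable_comparison_test'[OF half, of k])
    fix n assume "k \<le> n"
    then have "\<bar>a n\<bar> * X n ^ k \<le> \<bar>a n\<bar> * X n ^ n"
      using X1[of n] by (intro mult_left_mono power_increasing) auto
    also have "\<dots> \<le> (1/2)^Suc n" by (rule Q(2))
    finally show "norm (\<bar>a n\<bar> * X n ^ k) \<le> (1/2)^Suc n" using X1[of n] by simp
  qed
  have suma: "summable (\<lambda>n. \<bar>a n\<bar>)" using sumk[of 0] by simp
  have wb: "\<bar>w n z\<bar> \<le> \<bar>a n\<bar>" for n z
    by (simp add: w_def abs_mult mult_left_le)
  have sumw: "summable (\<lambda>n. w n z)" for z
    by (rule summable_comparison_test'[OF suma, of 0]) (use wb in simp)
  define f where "f = wave_sum c a p q"
  have f_def': "f z = c + (\<Sum>n. w n z)" for z by (simp add: f_def wave_sum_def w_def)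
  have F0: "F 0 z = c" for z using x(1)[of 0] by (auto simp: Pr_def F_def split: prod.splits)
  have F: "F n z = c + (\<Sum>k<n. w k z)" for n z
    by (induction n) (simp_all add: F0 Q(1))
  have decay: "\<eta> (k + m) \<le> \<eta> m * (1/2)^k" for k m
  proof (induction k)
    case (Suc k)
    then show ?case using Q(4)[of "k + m"] by simp
  qed simp
  have a_decay: "\<bar>a (k + m)\<bar> \<le> \<eta> m * (1/2)^Suc k" for k m
    using decay[of k m] Q(3)[of "k + m"] by simp
  \<comment> \<open>Every wave takes at most half of the remaining budget, which is halved each
    time; the geometric series sums exactly to the budget.\<close>
  have tail: "\<bar>F n z - f z\<bar> \<le> \<eta> n" for n z
  proof -
    have "f z - F n z = (\<Sum>k. w (k + n) z)"
      using suminf_split_initial_segment[OF sumw[of z], of n] by (simp add: f_def' F)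
    also have "\<bar>\<dots>\<bar> \<le> (\<Sum>k. \<eta> n * (1/2)^Suc k)"
    proof -
      have s: "summable (\<lambda>k. \<eta> n * (1/2)^Suc k)" by (rule summable_mult[OF half])
      have le: "norm (w (k + n) z) \<le> \<eta> n * (1/2)^Suc k" for k
        using wb[of "k + n" z] a_decay[of k n] by simp
      have "norm (\<Sum>k. w (k + n) z) \<le> (\<Sum>k. \<eta> n * (1/2)^Suc k)"
        by (rule norm_suminf_le[OF le s])
      then show ?thesis by simp
    qed
    also have "(\<Sum>k. \<eta> n * (1/2)^Suc k) = \<eta> n"
      using sums_unique[OF sums_mult[OF power_half_series, of "\<eta> n"]] by simp
    finally show ?thesis by (simp add: abs_minus_commute)
  qed
  have f1: "f z \<ge> 1" for z
  proof (rule LIMSEQ_le_const)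
    show "(\<lambda>n. F n z) \<longlonglongrightarrow> f z"
      unfolding F f_def' by (intro tendsto_intros summable_LIMSEQ sumw)
    have "F n z \<ge> 1" for n using P(2)[of n z] by (rule order_trans[rotated]) simp
    then show "\<exists>N. \<forall>n\<ge>N. 1 \<le> F n z" by blast
  qed
  have "lip_per (\<Sum>n. \<bar>a n\<bar> * (2 * pi * X n)) (\<bar>c\<bar> + (\<Sum>n. \<bar>a n\<bar>)) f"
  proof (rule lip_perI)
    have w_lip: "lip_per (\<bar>a n\<bar> * (2 * pi * (real (q n) + \<bar>of_int (p n)\<bar>))) (\<bar>a n\<bar> * 1) (w n)" for n
      unfolding w_def by (rule lip_per_cmult[OF lip_per_cos])
    show "periodic f"
      unfolding periodic_def f_def' by (intro allI ballI) (simp add: lip_per_Ints[OF w_lip])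
    fix z y
    have "norm (\<Sum>n. w n z) \<le> (\<Sum>n. \<bar>a n\<bar>)" using wb by (intro norm_suminf_le suma) simp
    then show "\<bar>f z\<bar> \<le> \<bar>c\<bar> + (\<Sum>n. \<bar>a n\<bar>)" unfolding f_def' real_norm_def by linarith
    have s: "summable (\<lambda>n. \<bar>a n\<bar> * (2 * pi * X n))"
      using summable_mult[OF sumk[of 1], of "2 * pi"] by (simp add: mult_ac)
    have "f z - f y = (\<Sum>n. w n z - w n y)"
      unfolding f_def' by (simp add: suminf_diff[OF sumw sumw])
    also have "\<bar>\<dots>\<bar> \<le> (\<Sum>n. \<bar>a n\<bar> * (2 * pi * X n) * norm (z - y))"
    proof -
      have "norm (w n z - w n y) \<le> \<bar>a n\<bar> * (2 * pi * X n) * norm (z - y)" for n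
      proof -
        have "\<bar>w n z - w n y\<bar> \<le> \<bar>a n\<bar> * (2 * pi * (real (q n) + \<bar>of_int (p n)\<bar>)) * norm (z - y)"
          by (rule lip_perD(3)[OF w_lip])
        also have "\<dots> \<le> \<bar>a n\<bar> * (2 * pi * X n) * norm (z - y)"
          by (intro mult_right_mono mult_left_mono) (auto simp: X_def)
        finally show ?thesis by simp
      qed
      from norm_suminf_le[OF this summable_mult2[OF s]] show ?thesis by simp
    qed
    also have "\<dots> = (\<Sum>n. \<bar>a n\<bar> * (2 * pi * X n)) * norm (z - y)"
      by (rule suminf_mult2[OF s, symmetric])
    finally show "\<bar>f z - f y\<bar> \<le> (\<Sum>n. \<bar>a n\<bar> * (2 * pi * X n)) * norm (z - y)" .
  qed
  then have adm: "adm f" using f1 unfolding adm_def by blast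
  have "\<exists>t P. mixes f t (1 / Suc n) \<and> prime_dense f P (1 / Suc n)" for n
    using Q(5)[of n] adm tail[of "Suc n"] unfolding good_def by blast
  then show ?thesis using sumk adm unfolding f_def X_def by blast
qed

end

section \<open>Smoothness and genericity\<close>

lemma C_k_continuous: "C_k k f \<Longrightarrow> continuous_on UNIV f"
  by (cases k) (auto intro!: continuous_at_imp_continuous_on simp: has_derivative_continuous dest: has_derivative_continuous)

lemma C_k_SucI:
  "(\<And>x. (f has_derivative f' x) (at x)) \<Longrightarrow> (\<And>v. C_k k (\<lambda>x. f' x v)) \<Longrightarrow> C_k (Suc k) f"
  by auto

lemma C_k_SucE:
  assumes "C_k (Suc k) f"
  obtains f' where "\<And>x. (f has_derivative f' x) (at x)" "\<And>v. C_k k (\<lambda>x. f' x v)"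
  using assms by auto

lemma C_k_Suc_imp: "C_k (Suc k) f \<Longrightarrow> C_k k f"
proof (induction k arbitrary: f)
  case 0
  then show ?case using C_k_continuous[of "Suc 0" f] by (simp only: C_k.simps(1))
next
  case (Suc k)
  from Suc.prems obtain f' where "\<And>x. (f has_derivative f' x) (at x)" "\<And>v. C_k (Suc k) (\<lambda>x. f' x v)"
    by (rule C_k_SucE) blast
  then show ?case using Suc.IH by (intro C_k_SucI[of f f']) auto
qed

lemma C_k_add: "C_k k f \<Longrightarrow> C_k k g \<Longrightarrow> C_k k (\<lambda>x. f x + g x)"
proof (induction k arbitrary: f g)
  case (Suc k)
  obtain f' where f: "\<And>x. (f has_derivative f' x) (at x)" "\<And>v. C_k k (\<lambda>x. f' x v)"
    using Suc.prems(1) by (rule C_k_SucE) blast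
  obtain g' where g: "\<And>x. (g has_derivative g' x) (at x)" "\<And>v. C_k k (\<lambda>x. g' x v)"
    using Suc.prems(2) by (rule C_k_SucE) blast
  show ?case
    by (rule C_k_SucI[of _ "\<lambda>x v. f' x v + g' x v"]) (intro has_derivative_add f g Suc.IH)+
qed (auto intro: continuous_intros)

lemma C_k_const: "C_k k (\<lambda>_. c)"
proof (induction k arbitrary: c)
  case (Suc k)
  then show ?case by (intro C_k_SucI[of _ "\<lambda>_ _. 0"]) auto
qed auto

lemma C_k_mult: "C_k k f \<Longrightarrow> C_k k g \<Longrightarrow> C_k k (\<lambda>x. f x * g x)"
proof (induction k arbitrary: f g)
  case (Suc k)
  obtain f' where f: "\<And>x. (f has_derivative f' x) (at x)" "\<And>v. C_k k (\<lambda>x. f' x v)"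
    using Suc.prems(1) by (rule C_k_SucE) blast
  obtain g' where g: "\<And>x. (g has_derivative g' x) (at x)" "\<And>v. C_k k (\<lambda>x. g' x v)"
    using Suc.prems(2) by (rule C_k_SucE) blast
  show ?case
  proof (rule C_k_SucI[of _ "\<lambda>x v. f x * g' x v + f' x v * g x"])
    show "((\<lambda>x. f x * g x) has_derivative (\<lambda>v. f x * g' x v + f' x v * g x)) (at x)" for x
      by (rule has_derivative_mult[OF f(1) g(1)])
    show "C_k k (\<lambda>x. f x * g' x v + f' x v * g x)" for v
      by (rule C_k_add[OF Suc.IH[OF C_k_Suc_imp[OF Suc.prems(1)] g(2)] Suc.IH[OF f(2) C_k_Suc_imp[OF Suc.prems(2)]]])
  qed
qed (auto intro: continuous_intros)

text \<open>The derivative is a product of \<open>f'\<close> with two copies of the inverse itself,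
  so the induction hypothesis covers it.\<close>

lemma C_k_inverse:
  assumes nz: "\<And>x. f x \<noteq> 0"
  shows "C_k k f \<Longrightarrow> C_k k (\<lambda>x. inverse (f x))"
proof (induction k)
  case (Suc k)
  obtain f' where f: "\<And>x. (f has_derivative f' x) (at x)" "\<And>v. C_k k (\<lambda>x. f' x v)"
    using Suc.prems by (rule C_k_SucE) blast
  have inv: "C_k k (\<lambda>x. inverse (f x))" by (rule Suc.IH[OF C_k_Suc_imp[OF Suc.prems]])
  show ?case
  proof (rule C_k_SucI[of _ "\<lambda>x v. (-1) * (inverse (f x) * f' x v * inverse (f x))"])
    show "((\<lambda>x. inverse (f x)) has_derivative (\<lambda>v. (-1) * (inverse (f x) * f' x v * inverse (f x)))) (at x)" for x
      using Deriv.has_derivative_inverse[OF nz f(1)] by simp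
  qed (intro C_k_mult C_k_const inv f)
qed (use nz in \<open>auto intro!: continuous_intros\<close>)

section \<open>Termwise differentiation of wave series\<close>

text \<open>Writing the sine as a cosine shifted by \<open>pi / 2\<close> keeps derivatives within
  one family of waves.\<close>

lemma wave_term_derivative:
  "((\<lambda>z. b * cos (2 * pi * phase p q z + \<phi>)) has_derivative
    (\<lambda>h. (2 * pi * b * phase p q h) * cos (2 * pi * phase p q z + (\<phi> + pi / 2)))) (at z)"
proof -
  have "(phase p q has_derivative phase p q) (at z)"
    unfolding phase_def by (auto intro!: derivative_eq_intros)
  then have "((\<lambda>z. b * cos (2 * pi * phase p q z + \<phi>)) has_derivative
    (\<lambda>h. b * (- sin (2 * pi * phase p q z + \<phi>) * (2 * pi * phase p q h)))) (at z)"
    by (auto intro!: derivative_eq_intros)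
  moreover have "cos (2 * pi * phase p q z + (\<phi> + pi / 2)) = - sin (2 * pi * phase p q z + \<phi>)"
    using cos_add[of "2 * pi * phase p q z + \<phi>" "pi / 2"] by (simp add: add.assoc)
  ultimately show ?thesis by (simp add: mult_ac)
qed

lemma phase_bound: "\<bar>phase p q h\<bar> \<le> (1 + \<bar>of_int p\<bar> + real q) * norm h"
proof -
  have "\<bar>phase p q h\<bar> \<le> (real q + \<bar>of_int p\<bar>) * norm h"
    using phase_diff_bound[of p q h 0] by (simp add: phase_def)
  also have "\<dots> \<le> (1 + \<bar>of_int p\<bar> + real q) * norm h" by (intro mult_right_mono) auto
  finally show ?thesis .
qed

text \<open>A directional derivative is a series of the same shape with new coefficients and a new
  shift, so both vary in the induction. Each differentiation costs one factor
  \<open>1 + \<bar>p\<bar> + q\<close>, for which summability against all powers provides.\<close>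

lemma C_k_wave_series:
  assumes "\<And>k. summable (\<lambda>n. \<bar>b n\<bar> * (1 + \<bar>of_int (p n)\<bar> + real (q n)) ^ k)"
  shows "C_k k (\<lambda>z. \<Sum>n. b n * cos (2 * pi * phase (p n) (q n) z + \<phi>))"
  using assms
proof (induction k arbitrary: b \<phi>)
  define X where "X n = 1 + \<bar>of_int (p n)\<bar> + real (q n)" for n
  have X1: "X n \<ge> 1" for n by (simp add: X_def)
  define D where "D b h n = 2 * pi * b n * phase (p n) (q n) h" for b :: "nat \<Rightarrow> real" and h n
  have Db: "\<bar>D b h n\<bar> \<le> 2 * pi * norm h * (\<bar>b n\<bar> * X n)" for b h n
  proof -
    have "\<bar>D b h n\<bar> = 2 * pi * \<bar>b n\<bar> * \<bar>phase (p n) (q n) h\<bar>" by (simp add: D_def abs_mult)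
    also have "\<dots> \<le> 2 * pi * \<bar>b n\<bar> * (X n * norm h)"
      unfolding X_def by (intro mult_left_mono phase_bound) auto
    finally show ?thesis by (simp add: mult_ac)
  qed
  have summable_D: "summable (\<lambda>n. \<bar>D b h n\<bar> * X n ^ k)"
    if s: "\<And>k. summable (\<lambda>n. \<bar>b n\<bar> * X n ^ k)" for b h k
  proof (rule summable_comparison_test'[of "\<lambda>n. 2 * pi * norm h * (\<bar>b n\<bar> * X n ^ Suc k)" 0])
    show "summable (\<lambda>n. 2 * pi * norm h * (\<bar>b n\<bar> * X n ^ Suc k))" by (rule summable_mult[OF s])
    fix n
    have "\<bar>D b h n\<bar> * X n ^ k \<le> 2 * pi * norm h * (\<bar>b n\<bar> * X n) * X n ^ k"
      using X1[of n] by (intro mult_right_mono Db) auto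
    then show "norm (\<bar>D b h n\<bar> * X n ^ k) \<le> 2 * pi * norm h * (\<bar>b n\<bar> * X n ^ Suc k)"
      using X1[of n] by (simp add: abs_mult mult_ac)
  qed
  have summable_wave: "summable (\<lambda>n. b n * cos (y n))"
    if s: "\<And>k. summable (\<lambda>n. \<bar>b n\<bar> * X n ^ k)" for b y
    by (rule summable_comparison_test'[of "\<lambda>n. \<bar>b n\<bar>" 0])
      (use s[of 0] in \<open>auto simp: abs_mult mult_left_le\<close>)
  have deriv: "((\<lambda>z. \<Sum>n. b n * cos (2 * pi * phase (p n) (q n) z + \<phi>)) has_derivative
    (\<lambda>h. \<Sum>n. D b h n * cos (2 * pi * phase (p n) (q n) z + (\<phi> + pi / 2)))) (at z)"
    if s: "\<And>k. summable (\<lambda>n. \<bar>b n\<bar> * X n ^ k)" for b \<phi> z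
  proof -
    let ?f = "\<lambda>n z. b n * cos (2 * pi * phase (p n) (q n) z + \<phi>)"
    let ?f' = "\<lambda>n z h. D b h n * cos (2 * pi * phase (p n) (q n) z + (\<phi> + pi / 2))"
    have s1: "summable (\<lambda>n. \<bar>b n\<bar> * X n)" using s[of 1] by simp
    have "\<exists>g. \<forall>x\<in>UNIV. (\<lambda>n. ?f n x) sums g x \<and> (g has_derivative (\<lambda>h. \<Sum>n. ?f' n x h)) (at x within UNIV)"
    proof (rule has_derivative_series[where x = 0])
      show "(?f n has_derivative ?f' n x) (at x within UNIV)" for n x
        unfolding D_def by (rule wave_term_derivative)
      show "(\<lambda>n. ?f n 0) sums (\<Sum>n. ?f n 0)" by (rule summable_sums[OF summable_wave[OF s]])
      \<comment> \<open>Tails of the derivative series are bounded by those of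
        \<open>\<Sum> \<bar>b n\<bar> * X n\<close>, uniformly in \<open>x\<close> and linearly in
        \<open>h\<close>.\<close>
      show "\<forall>\<^sub>F n in sequentially. \<forall>x\<in>UNIV. \<forall>h. norm ((\<Sum>i<n. ?f' i x h) - (\<Sum>i. ?f' i x h)) \<le> e * norm h"
        if e: "e > 0" for e
      proof -
        have "0 < e / (2 * pi)" using e by simp
        from suminf_exist_split[OF this s1]
        obtain N where N: "\<And>n. n \<ge> N \<Longrightarrow> norm (\<Sum>i. \<bar>b (i + n)\<bar> * X (i + n)) < e / (2 * pi)" by blast
        have "norm ((\<Sum>i<n. ?f' i x h) - (\<Sum>i. ?f' i x h)) \<le> e * norm h" if n: "n \<ge> N" for n x h
        proof -
          have sw: "summable (\<lambda>i. ?f' i x h)" by (rule summable_wave[OF summable_D[OF s]])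
          have st: "summable (\<lambda>i. \<bar>b (i + n)\<bar> * X (i + n))"
            using s1 by (rule summable_ignore_initial_segment)
          have "(\<Sum>i. ?f' i x h) - (\<Sum>i<n. ?f' i x h) = (\<Sum>i. ?f' (i + n) x h)"
            using suminf_split_initial_segment[OF sw, of n] by simp
          from arg_cong[OF this, of norm]
          have "norm ((\<Sum>i<n. ?f' i x h) - (\<Sum>i. ?f' i x h)) = norm (\<Sum>i. ?f' (i + n) x h)"
            by (subst norm_minus_commute)
          also have "\<dots> \<le> (\<Sum>i. 2 * pi * norm h * (\<bar>b (i + n)\<bar> * X (i + n)))"
          proof (rule norm_suminf_le)
            show "norm (?f' (i + n) x h) \<le> 2 * pi * norm h * (\<bar>b (i + n)\<bar> * X (i + n))" for i
            proof -
              have "norm (?f' (i + n) x h) \<le> \<bar>D b h (i + n)\<bar> * 1"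
                unfolding real_norm_def abs_mult by (intro mult_left_mono) auto
              then show ?thesis using Db[of b h "i + n"] by simp
            qed
          qed (rule summable_mult[OF st])
          also have "\<dots> = 2 * pi * norm h * (\<Sum>i. \<bar>b (i + n)\<bar> * X (i + n))"
            by (rule suminf_mult[OF st])
          also have "\<dots> \<le> 2 * pi * norm h * (e / (2 * pi))"
            using N[OF n] by (intro mult_left_mono) auto
          finally show ?thesis by (simp add: mult.commute)
        qed
        then show ?thesis unfolding eventually_sequentially by blast
      qed
    qed auto
    then obtain g where g: "\<And>x. (\<lambda>n. ?f n x) sums g x" "\<And>x. (g has_derivative (\<lambda>h. \<Sum>n. ?f' n x h)) (at x)"
      by blast
    have "g = (\<lambda>x. \<Sum>n. ?f n x)" using sums_unique[OF g(1)] by (intro ext)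
    then show ?thesis using g(2)[of z] by simp
  qed
  {
    case 0
    have "isCont (\<lambda>z. \<Sum>n. b n * cos (2 * pi * phase (p n) (q n) z + \<phi>)) z" for z
      by (rule has_derivative_continuous[OF deriv]) (use 0 in \<open>simp add: X_def\<close>)
    then show ?case by (simp add: continuous_at_imp_continuous_on)
  next
    case (Suc k)
    note s = Suc.prems[folded X_def]
    show ?case
    proof (rule C_k_SucI)
      show "((\<lambda>z. \<Sum>n. b n * cos (2 * pi * phase (p n) (q n) z + \<phi>)) has_derivative
        (\<lambda>h. \<Sum>n. D b h n * cos (2 * pi * phase (p n) (q n) z + (\<phi> + pi / 2)))) (at z)" for z
        by (rule deriv[OF s])
      show "C_k k (\<lambda>z. \<Sum>n. D b h n * cos (2 * pi * phase (p n) (q n) z + (\<phi> + pi / 2)))" for h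
        by (rule Suc.IH) (use summable_D[OF s] in \<open>simp add: X_def\<close>)
    qed
  }
qed

lemma C_k_wave_sum:
  assumes "\<And>k. summable (\<lambda>n. \<bar>a n\<bar> * (1 + \<bar>of_int (p n)\<bar> + real (q n)) ^ k)"
  shows "C_k k (wave_sum c a p q)"
proof -
  have "wave_sum c a p q = (\<lambda>z. c + (\<Sum>n. a n * cos (2 * pi * phase (p n) (q n) z + 0)))"
    by (intro ext) (simp add: wave_sum_def)
  then show ?thesis using C_k_add[OF C_k_const[of k c] C_k_wave_series[OF assms, of k 0]] by simp
qed

section \<open>Baire category arguments\<close>

text \<open>The sets \<open>U n\<close> are open and dense. If only countably many irrational points
  lay in all of them, removing these and the rationals would still leave a countable family of open
  dense sets, now with empty intersection.\<close>

lemma uncountable_liouville: "uncountable {x::real. x \<notin> \<rat> \<and> liouville x}"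
proof
  assume cnt: "countable {x::real. x \<notin> \<rat> \<and> liouville x}"
  define A where "A n q p = {x::real. \<bar>real q * x - of_int p\<bar> * (1 + \<bar>of_int p\<bar> + real q) ^ n < 1}" for n q :: nat and p :: int
  define U where "U n = (\<Union>q\<in>{max n 1..}. \<Union>p. A n q p)" for n :: nat
  have openA: "open (A n q p)" for n q p
    unfolding A_def by (intro open_Collect_less continuous_intros)
  have openU: "open (U n)" for n unfolding U_def by (intro open_UN ballI openA)
  have rat: "\<rat> \<subseteq> U n" for n
  proof
    fix x :: real assume "x \<in> \<rat>"
    then obtain i j where ij: "x = of_int i / of_nat j" "j > 0"
      by (metis Rats_cases' of_nat_0_less_iff of_int_of_nat_eq zero_less_imp_eq_int)
    \<comment> \<open>The fraction is expanded until its denominator reaches \<open>max n 1\<close>;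
      the approximation stays exact.\<close>
    have "x \<in> A n (j * max n 1) (i * int (max n 1))"
      using ij by (simp add: A_def)
    moreover have "1 * max n 1 \<le> j * max n 1" using ij by (intro mult_right_mono) auto
    then have "j * max n 1 \<in> {max n 1..}" by simp
    ultimately show "x \<in> U n" unfolding U_def by blast
  qed
  define C where "C = \<rat> \<union> {x::real. x \<notin> \<rat> \<and> liouville x}"
  define \<G> where "\<G> = range U \<union> (\<lambda>x. - {x}) ` C"
  have "UNIV \<subseteq> closure (\<Inter>\<G>)"
  proof (rule Baire)
    show "countable \<G>" unfolding \<G>_def C_def using cnt countable_rat by auto
    fix T assume "T \<in> \<G>"
    then consider n where "T = U n" | x where "T = - {x}" unfolding \<G>_def by blast
    then show "openin (top_of_set UNIV) T \<and> UNIV \<subseteq> closure T"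
    proof cases
      case 1
      have "closure \<rat> \<subseteq> closure (U n)" by (rule closure_mono[OF rat])
      then show ?thesis using 1 openU by (simp add: Rats_closure_real)
    next
      case 2
      then show ?thesis by (simp add: closure_complement open_closed)
    qed
  qed auto
  moreover have "\<Inter>\<G> = {}"
  proof (rule equals0I)
    fix x assume x: "x \<in> \<Inter>\<G>"
    then have nC: "x \<notin> C" by (auto simp: \<G>_def)
    have "liouville x" unfolding liouville_def
    proof
      fix n
      have "x \<in> U n" using x unfolding \<G>_def by blast
      then obtain q p where qp: "q \<in> {max n 1..}" "\<bar>real q * x - of_int p\<bar> * (1 + \<bar>of_int p\<bar> + real q) ^ n < 1"
        unfolding U_def A_def by blast
      then have "n \<le> q" "1 \<le> q" by auto
      with qp(2) show "\<exists>p q. n \<le> q \<and> 1 \<le> q \<and> \<bar>real q * x - of_int p\<bar> * (1 + \<bar>of_int p\<bar> + real q) ^ n < 1"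
        by blast
    qed
    then show False using nC by (auto simp: C_def)
  qed
  ultimately show False by simp
qed

context irrational_slope
begin

text \<open>For an open dense set of \<open>x\<close> some \<open>p x v\<close> hits a given ball: moving \<open>x\<close> in a short interval
  moves \<open>p x\<close> in a long one once \<open>p\<close> is large.\<close>

lemma generic_speed_exists: "\<exists>c\<ge>2. generic_speed c"
proof -
  define B where "B w \<delta> p m = {x. norm ((real p * x) *\<^sub>R v - w - m) < \<delta>}" for w m :: "real \<times> real" and \<delta> and p :: nat
  define D where "D w \<delta> = (\<Union>p\<in>{p. prime p}. \<Union>m\<in>\<int> \<times> \<int>. B w \<delta> p m)" for w \<delta>
  have openD: "open (D w \<delta>)" for w \<delta>
    unfolding D_def B_def by (intro open_UN ballI open_Collect_less continuous_intros)
  have denseD: "UNIV \<subseteq> closure (D w \<delta>)" if d: "\<delta> > 0" for w \<delta>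
  proof
    fix y :: real
    show "y \<in> closure (D w \<delta>)"
      unfolding closure_approachable
    proof (intro allI impI)
      fix e :: real assume e: "e > 0"
      obtain T where T: "\<And>z w. \<exists>\<tau>. 0 \<le> \<tau> \<and> \<tau> \<le> T \<and> (\<exists>m\<in>\<int> \<times> \<int>. norm (z + \<tau> *\<^sub>R v - w - m) < \<delta>)"
        using linear_flow_dense[OF d] by blast
      \<comment> \<open>The waiting time \<tau> is at most \<open>T\<close>, so it is made up by
        moving \<open>y\<close> by less than \<open>e\<close>.\<close>
      obtain p :: nat where p: "prime p" "real p > (\<bar>T\<bar> + 1) / e"
      proof -
        obtain p where "prime p" "nat \<lceil>(\<bar>T\<bar> + 1) / e\<rceil> < p" using bigger_prime by blast
        then show ?thesis by (intro that[of p]) linarith+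
      qed
      have p0: "real p > 0" using p(1) prime_gt_0_nat by simp
      obtain \<tau> m where tm: "0 \<le> \<tau>" "\<tau> \<le> T" "m \<in> \<int> \<times> \<int>" "norm ((real p * y) *\<^sub>R v + \<tau> *\<^sub>R v - w - m) < \<delta>"
        using T[of "(real p * y) *\<^sub>R v" w] by blast
      define x where "x = y + \<tau> / real p"
      have "real p * x = real p * y + \<tau>" using p0 by (simp add: x_def distrib_left)
      then have "x \<in> B w \<delta> p m" using tm by (simp add: B_def scaleR_add_left)
      then have "x \<in> D w \<delta>" using p(1) tm(3) unfolding D_def by blast
      moreover have "dist x y < e"
      proof -
        have "\<tau> < \<bar>T\<bar> + 1" using tm by linarith
        also have "\<dots> < e * real p" using p(2) e by (simp add: field_simps)
        finally show ?thesis using tm p0 by (simp add: x_def dist_real_def field_simps)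
      qed
      ultimately show "\<exists>x\<in>D w \<delta>. dist x y < e" by blast
    qed
  qed
  define W where "W n = (\<lambda>(i, j). (real i / real (Suc n), real j / real (Suc n))) ` ({..n} \<times> {..n})" for n :: nat
  define \<G> where "\<G> = (\<Union>n. (\<lambda>w. D w (1 / real (Suc n))) ` W n)"
  have finW: "finite (W n)" for n by (simp add: W_def)
  have "UNIV \<subseteq> closure (\<Inter>\<G>)"
  proof (rule Baire)
    have "countable (W n)" for n by (rule countable_finite[OF finW])
    then show "countable \<G>" unfolding \<G>_def by simp
    fix T assume "T \<in> \<G>"
    then obtain n w where T: "T = D w (1 / real (Suc n))" unfolding \<G>_def by blast
    have "1 / real (Suc n) > 0" by simp
    from denseD[OF this, of w] openD[of w "1 / real (Suc n)"]
    show "openin (top_of_set UNIV) T \<and> UNIV \<subseteq> closure T"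
      unfolding T by simp
  qed simp
  \<comment> \<open>A point within \<open>1/20\<close> of \<open>2/5\<close> is positive and at most
    \<open>1/2\<close>, so that its reciprocal \<open>c\<close> is at least 2.\<close>
  then have "2/5 \<in> closure (\<Inter>\<G>)" by blast
  then obtain x where x: "x \<in> \<Inter>\<G>" "dist x (2/5) < 1/20"
    unfolding closure_approachable by (metis zero_less_divide_1_iff zero_less_numeral)
  then have x2: "x > 0" "x \<le> 1/2" by (auto simp: dist_real_def abs_if split: if_splits)
  define c where "c = 1 / x"
  have "c \<ge> 2" using x2 by (simp add: c_def field_simps)
  moreover have "generic_speed c"
    unfolding generic_speed_def
  proof (intro allI impI)
    fix \<delta> :: real assume d: "\<delta> > 0"
    \<comment> \<open>One mesh width is lost at a grid target and two in rounding \<open>w\<close>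
      to the grid. The grid is finite, which gives the uniform bound \<open>P\<close>.\<close>
    obtain n :: nat where n: "real n > 3 / \<delta>" using reals_Archimedean2 by blast
    define N where "N = real (Suc n)"
    have N: "N > 0" "3 / N < \<delta>" using n d by (auto simp: N_def field_simps)
    have "\<exists>p m. prime p \<and> m \<in> \<int> \<times> \<int> \<and> norm ((real p * x) *\<^sub>R v - w - m) < 1 / N" if "w \<in> W n" for w
    proof -
      have "x \<in> D w (1 / N)" using x(1) that unfolding \<G>_def N_def by blast
      then show ?thesis unfolding D_def B_def by blast
    qed
    then obtain p m where pm: "\<And>w. w \<in> W n \<Longrightarrow> prime (p w)" "\<And>w. w \<in> W n \<Longrightarrow> m w \<in> \<int> \<times> \<int>"
      "\<And>w. w \<in> W n \<Longrightarrow> norm ((real (p w) * x) *\<^sub>R v - w - m w) < 1 / N" by metis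
    define P where "P = (\<Sum>w\<in>W n. p w)"
    have "\<exists>p::nat. prime p \<and> p \<le> P \<and> (\<exists>m\<in>\<int> \<times> \<int>. norm ((real p / c) *\<^sub>R v - w - m) < \<delta>)" for w
    proof -
      obtain a b where w: "w = (a, b)" by (cases w)
      have grid: "\<exists>i\<le>n. \<bar>y - of_int \<lfloor>y\<rfloor> - real i / N\<bar> \<le> 1 / N" for y
      proof -
        define i where "i = nat \<lfloor>N * frac y\<rfloor>"
        have fg: "0 \<le> frac y" "frac y < 1" by (auto simp: frac_lt_1)
        have i0: "real i = of_int \<lfloor>N * frac y\<rfloor>" unfolding i_def using fg N by simp
        have i1: "real i \<le> N * frac y" "N * frac y < real i + 1" unfolding i0 by linarith+
        have "N * frac y < N * 1" using fg N by (intro mult_strict_left_mono) auto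
        then have "real i < N" using i1 by linarith
        then have "i \<le> n" by (simp add: N_def)
        moreover have "real i / N \<le> frac y" "frac y \<le> (real i + 1) / N"
          using i1 N by (auto simp: field_simps)
        then have "\<bar>frac y - real i / N\<bar> \<le> 1 / N" by (simp add: add_divide_distrib)
        ultimately show ?thesis unfolding frac_def by blast
      qed
      obtain i j where ij: "i \<le> n" "\<bar>a - of_int \<lfloor>a\<rfloor> - real i / N\<bar> \<le> 1 / N"
        "j \<le> n" "\<bar>b - of_int \<lfloor>b\<rfloor> - real j / N\<bar> \<le> 1 / N" using grid[of a] grid[of b] by blast
      define w' where "w' = (real i / N, real j / N)"
      define m' where "m' = (of_int \<lfloor>a\<rfloor> :: real, of_int \<lfloor>b\<rfloor> :: real)"
      have w': "w' \<in> W n" using ij unfolding W_def w'_def N_def by force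
      have "norm (w' + m' - w) \<le> norm (fst (w' + m' - w)) + norm (snd (w' + m' - w))"
        by (metis norm_Pair_le prod.collapse)
      also have "\<dots> \<le> 1 / N + 1 / N"
        using ij by (intro add_mono) (simp_all add: w'_def m'_def w abs_minus_commute algebra_simps)
      finally have n1: "norm (w' + m' - w) \<le> 2 / N" by simp
      have "(real (p w') / c) *\<^sub>R v - w - (m w' - m') = ((real (p w') * x) *\<^sub>R v - w' - m w') + (w' + m' - w)"
        by (simp add: c_def)
      then have "norm ((real (p w') / c) *\<^sub>R v - w - (m w' - m')) \<le> norm ((real (p w') * x) *\<^sub>R v - w' - m w') + norm (w' + m' - w)"
        by (metis norm_triangle_ineq)
      also have "\<dots> < 1 / N + 2 / N" by (rule add_less_le_mono[OF pm(3)[OF w'] n1])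
      also have "\<dots> = 3 / N" by (simp add: field_simps)
      finally have "norm ((real (p w') / c) *\<^sub>R v - w - (m w' - m')) < \<delta>" using N by simp
      moreover have "m w' - m' \<in> \<int> \<times> \<int>" using pm(2)[OF w'] by (auto simp: m'_def mem_Times_iff)
      moreover have "p w' \<le> P" unfolding P_def by (rule member_le_sum) (use w' finW in auto)
      ultimately show ?thesis
        using pm(1)[OF w'] by (intro exI[of _ "p w'"] conjI bexI[of _ "m w' - m'"])
    qed
    then show "\<exists>P. \<forall>w. \<exists>p::nat. prime p \<and> p \<le> P \<and> (\<exists>m\<in>\<int> \<times> \<int>. norm ((real p / c) *\<^sub>R v - w - m) < \<delta>)"
      by (rule exI[of _ P, OF allI])
  qed
  ultimately show ?thesis by blast
qed

end

section \<open>Measures on the torus\<close>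

lemma circle_of_eq_iff: "circle_of x = circle_of y \<longleftrightarrow> x - y \<in> \<int>"
  by (rule circle.abs_eq_iff)

lemma circle_of_rep: "circle_of (rep_circle p) = p"
  by (rule Quotient3_abs_rep[OF Quotient3_circle])

text \<open>An arbitrary section of \<open>torus_of\<close>, necessarily discontinuous; under a
  periodic function the choice disappears.\<close>

definition rep :: "torus \<Rightarrow> real \<times> real" where
  "rep = map_prod rep_circle rep_circle"

lemma torus_of_Pair: "torus_of z = (circle_of (fst z), circle_of (snd z))"
  by (simp add: torus_of_def map_prod_def case_prod_unfold)

lemma torus_of_rep [simp]: "torus_of (rep p) = p"
  by (simp add: torus_of_Pair rep_def circle_of_rep)

lemma torus_of_eq_iff: "torus_of z = torus_of w \<longleftrightarrow> z - w \<in> \<int> \<times> \<int>"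
  by (simp add: torus_of_Pair circle_of_eq_iff mem_Times_iff)

lemma torus_of_add_Ints: "m \<in> \<int> \<times> \<int> \<Longrightarrow> torus_of (z + m) = torus_of z"
  by (simp add: torus_of_eq_iff)

lemma rep_torus_of: "periodic g \<Longrightarrow> g (rep (torus_of z)) = g z"
proof -
  assume "periodic g"
  moreover have "rep (torus_of z) - z \<in> \<int> \<times> \<int>" using torus_of_eq_iff[of "rep (torus_of z)" z] by simp
  ultimately have "g (z + (rep (torus_of z) - z)) = g z" by (rule periodicD)
  then show ?thesis by simp
qed

lemma circle_of_continuous: "continuous_on S circle_of"
proof -
  have "continuous_on UNIV circle_of"
    by (simp add: continuous_on_open_vimage open_circle_def)
  then show ?thesis by (rule continuous_on_subset) simp
qed

lemma torus_of_continuous: "continuous_on S torus_of"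
proof -
  have "continuous_on S (\<lambda>z. (circle_of (fst z), circle_of (snd z)))"
    by (intro continuous_on_Pair continuous_on_compose2[OF circle_of_continuous[of UNIV]] continuous_intros) auto
  then show ?thesis by (simp add: torus_of_Pair[abs_def])
qed

lemma circle_of_open_map: "open V \<Longrightarrow> open (circle_of ` V)"
proof -
  assume V: "open V"
  have "circle_of -` (circle_of ` V) = (\<Union>n::int. (\<lambda>x. x + of_int n) ` V)"
  proof (intro set_eqI iffI)
    fix x assume "x \<in> circle_of -` (circle_of ` V)"
    then obtain y where "y \<in> V" "x - y \<in> \<int>" by (auto simp: circle_of_eq_iff)
    then obtain n where "x - y = of_int n" by (auto elim: Ints_cases)
    then have "x = y + of_int n" by simp
    then show "x \<in> (\<Union>n::int. (\<lambda>x. x + of_int n) ` V)" using \<open>y \<in> V\<close> by blast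
  next
    fix x assume "x \<in> (\<Union>n::int. (\<lambda>x. x + of_int n) ` V)"
    then obtain y n where "y \<in> V" "x = y + of_int n" by blast
    then have "circle_of x = circle_of y" by (simp add: circle_of_eq_iff)
    then show "x \<in> circle_of -` (circle_of ` V)" using \<open>y \<in> V\<close> by simp
  qed
  moreover have "open ((\<lambda>x. x + of_int n) ` V)" for n :: int
    using open_translation[OF V, of "of_int n"] by (simp add: add.commute)
  ultimately show ?thesis by (simp add: open_circle_def open_UN)
qed

text \<open>The pair type carries the product topology and \<open>torus_of\<close> suggests the
  quotient topology; they agree because \<open>circle_of\<close> is an open map.\<close>

lemma open_torus_iff: "open A \<longleftrightarrow> open (torus_of -` A)"
proof
  show "open (torus_of -` A)" if "open A"
    using continuous_on_open_vimage[of UNIV torus_of] torus_of_continuous[of UNIV] that by simp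
  assume o: "open (torus_of -` A)"
  show "open A"
    unfolding open_prod_def
  proof
    fix p assume "p \<in> A"
    then have "rep p \<in> torus_of -` A" by simp
    then obtain V W where VW: "open V" "open W" "rep p \<in> V \<times> W" "V \<times> W \<subseteq> torus_of -` A"
      by (rule open_prod_elim[OF o])
    have "torus_of (rep p) \<in> circle_of ` V \<times> circle_of ` W"
      using VW(3) unfolding torus_of_Pair by (simp add: mem_Times_iff)
    then have "p \<in> circle_of ` V \<times> circle_of ` W" by simp
    moreover have "circle_of ` V \<times> circle_of ` W \<subseteq> A"
    proof
      fix r assume "r \<in> circle_of ` V \<times> circle_of ` W"
      then obtain x y where "x \<in> V" "y \<in> W" "r = torus_of (x, y)" by (auto simp: torus_of_Pair)
      then show "r \<in> A" using VW(4) by blast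
    qed
    ultimately show "\<exists>A' B. open A' \<and> open B \<and> p \<in> A' \<times> B \<and> A' \<times> B \<subseteq> A"
      using circle_of_open_map[OF VW(1)] circle_of_open_map[OF VW(2)]
      by (intro exI[of _ "circle_of ` V"] exI[of _ "circle_of ` W"] conjI)
  qed
qed

section \<open>Periodic functions as test functions for torus measures\<close>

lemma continuous_lift:
  fixes g :: "real \<times> real \<Rightarrow> 'b::topological_space"
  assumes c: "continuous_on UNIV g" and per: "periodic g"
  shows "continuous_on UNIV (\<lambda>p. g (rep p))"
proof (subst continuous_on_open_vimage, simp, intro allI impI)
  fix B :: "'b set" assume "open B"
  then have "open (g -` B)" using c by (simp add: continuous_on_open_vimage)
  moreover have "torus_of -` ((\<lambda>p. g (rep p)) -` B) = g -` B"
    by (rule set_eqI) (simp only: vimage_eq rep_torus_of[OF per])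
  ultimately show "open ((\<lambda>p. g (rep p)) -` B \<inter> UNIV)" by (simp add: open_torus_iff)
qed

lemma measurable_lift:
  assumes "lip_per K B g" shows "(\<lambda>p. g (rep p)) \<in> borel_measurable borel"
  by (rule borel_measurable_continuous_onI, rule continuous_lift)
    (rule lip_per_cont[OF assms], rule lip_perD(1)[OF assms])

lemma torus_of_measurable [measurable]: "torus_of \<in> borel \<rightarrow>\<^sub>M borel"
  by (rule borel_measurable_continuous_onI[OF torus_of_continuous])

text \<open>Truncated multiples of the distance to the lifted complement increase to the indicator;
  they are periodic because that complement is invariant under integer translations.\<close>

lemma open_torus_lip_approx:
  assumes U: "open (U :: torus set)"
  shows "\<exists>g K. (\<forall>n. lip_per (K n) 1 (g n)) \<and> (\<forall>n z. 0 \<le> g n z) \<and>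
    (\<forall>p. (\<lambda>n. g n (rep p)) \<longlonglongrightarrow> (indicator U p :: real))"
proof (cases "U = UNIV")
  \<comment> \<open>The complement is empty here and \<open>infdist\<close> to the empty set is 0,
    so the formula used below would tend to 0.\<close>
  case True
  then show ?thesis
    using lip_per_const[of 1 1] by (intro exI[of _ "\<lambda>_ _. 1"] exI[of _ "\<lambda>_. 0"]) auto
next
  case False
  define S where "S = - (torus_of -` U)"
  obtain p0 where "p0 \<notin> U" using False by blast
  then have "rep p0 \<in> S" by (simp add: S_def)
  then have S: "S \<noteq> {}" by blast
  have clS: "closed S" using U by (simp add: S_def open_torus_iff closed_open)
  have Sm: "s + m \<in> S" if "s \<in> S" "m \<in> \<int> \<times> \<int>" for s m
    using that torus_of_add_Ints[of m s] by (simp add: S_def)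
  have le: "infdist (z + m) S \<le> infdist z S" if m: "m \<in> \<int> \<times> \<int>" for z m
  proof -
    have "infdist (z + m) S \<le> dist z s" if "s \<in> S" for s
      using infdist_le[OF Sm[OF that m], of "z + m"] by (simp add: dist_norm)
    then have "infdist (z + m) S \<le> (INF s\<in>S. dist z s)"
      using S by (intro cINF_greatest) auto
    then show ?thesis using S by (simp add: infdist_notempty)
  qed
  have per: "infdist (z + m) S = infdist z S" if m: "m \<in> \<int> \<times> \<int>" for z m
  proof (rule antisym[OF le[OF m]])
    have "- m \<in> \<int> \<times> \<int>" using m by (auto simp: mem_Times_iff)
    from le[OF this, of "z + m"] show "infdist z S \<le> infdist (z + m) S" by simp
  qed
  define g where "g n z = min 1 (real n * infdist z S)" for n z
  have "lip_per (real n) 1 (g n)" for n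
  proof (rule lip_perI)
    show "periodic (g n)" unfolding periodic_def g_def by (intro allI ballI) (simp only: per)
    show "\<bar>g n z\<bar> \<le> 1" for z by (simp add: g_def infdist_nonneg)
    fix z w
    have "\<bar>infdist z S - infdist w S\<bar> \<le> norm (z - w)"
      using infdist_triangle[of z S w] infdist_triangle[of w S z]
      by (simp add: dist_norm norm_minus_commute abs_le_iff)
    then have "real n * \<bar>infdist z S - infdist w S\<bar> \<le> real n * norm (z - w)" by (rule mult_left_mono) simp
    moreover have "real n * \<bar>infdist z S - infdist w S\<bar> = \<bar>real n * infdist z S - real n * infdist w S\<bar>"
      by (simp add: right_diff_distrib[symmetric] abs_mult)
    ultimately show "\<bar>g n z - g n w\<bar> \<le> real n * norm (z - w)" unfolding g_def by linarith
  qed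
  moreover have "0 \<le> g n z" for n z by (simp add: g_def infdist_nonneg)
  moreover have "(\<lambda>n. g n (rep p)) \<longlonglongrightarrow> indicator U p" for p
  proof (cases "p \<in> U")
    case False
    then have "rep p \<in> S" by (simp add: S_def)
    then have "g n (rep p) = 0" for n by (simp add: g_def)
    then show ?thesis using False by simp
  next
    case True
    then have "rep p \<notin> S" by (simp add: S_def)
    then have pos: "infdist (rep p) S > 0"
      using in_closed_iff_infdist_zero[OF clS S] infdist_nonneg[of "rep p" S] by (auto simp: less_le)
    obtain n0 :: nat where n0: "real n0 > 1 / infdist (rep p) S" using reals_Archimedean2 by blast
    have "g n (rep p) = 1" if "n \<ge> n0" for n
    proof -
      have "1 < real n0 * infdist (rep p) S" using n0 pos by (simp add: field_simps)
      also have "\<dots> \<le> real n * infdist (rep p) S" using that by (intro mult_right_mono infdist_nonneg) auto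
      finally show ?thesis by (simp add: g_def)
    qed
    then show ?thesis using True by (intro tendsto_eventually) (auto simp: eventually_sequentially)
  qed
  ultimately show ?thesis by blast
qed

lemma integrable_lift:
  assumes M: "finite_measure M" "sets M = sets borel" and g: "lip_per K B g"
  shows "integrable M (\<lambda>p. g (rep p))"
proof (rule finite_measure.integrable_const_bound[OF M(1), of _ B])
  show "AE p in M. norm (g (rep p)) \<le> B" using lip_perD(2)[OF g] by simp
  show "(\<lambda>p. g (rep p)) \<in> borel_measurable M"
    using measurable_lift[OF g] M(2) measurable_cong_sets by blast
qed

text \<open>Open sets form an intersection-stable generator, and their measures are limits of
  integrals of test functions.\<close>

lemma torus_measure_eqI:
  assumes M: "finite_measure M" "sets M = sets (borel :: torus measure)"
    and N: "finite_measure N" "sets N = sets (borel :: torus measure)"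
    and eq: "\<And>K B g. lip_per K B g \<Longrightarrow> (LINT p|M. g (rep p)) = (LINT p|N. g (rep p))"
  shows "M = N"
proof (rule measure_eqI_generator_eq[where E = "{U :: torus set. open U}" and \<Omega> = UNIV and A = "\<lambda>_. UNIV"])
  have lim: "(\<lambda>n. LINT p|M. g n (rep p)) \<longlonglongrightarrow> measure M U"
    if M: "finite_measure M" "sets M = sets (borel :: torus measure)" and U: "open U"
      and g: "\<And>n. lip_per (K n) 1 (g n)" "\<And>p. (\<lambda>n. g n (rep p)) \<longlonglongrightarrow> (indicator U p :: real)"
    for M U g and K :: "nat \<Rightarrow> real"
  proof -
    have UM: "U \<in> sets M" using U M by simp
    have "(\<lambda>n. LINT p|M. g n (rep p)) \<longlonglongrightarrow> (LINT p|M. indicator U p)"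
    proof (rule integral_dominated_convergence[where w = "\<lambda>_. 1"])
      show "integrable M (\<lambda>_. 1 :: real)" using M(1) by (simp add: finite_measure.integrable_const)
      show "(\<lambda>p. g n (rep p)) \<in> borel_measurable M" for n
        using integrable_lift[OF M g(1)] by (rule borel_measurable_integrable)
      show "(\<lambda>p. indicator U p :: real) \<in> borel_measurable M" using UM by simp
      show "AE p in M. norm (g n (rep p)) \<le> 1" for n using lip_perD(2)[OF g(1)] by simp
    qed (use g in simp)
    then show ?thesis using UM by simp
  qed
  show "emeasure M U = emeasure N U" if "U \<in> {U. open U}" for U
  proof -
    have U: "open U" using that by simp
    obtain g K where g: "\<And>n. lip_per (K n) 1 (g n)" "\<And>p. (\<lambda>n. g n (rep p)) \<longlonglongrightarrow> (indicator U p :: real)"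
      using open_torus_lip_approx[OF U] by blast
    have "measure M U = measure N U"
      using lim[OF M U g] lim[OF N U g] eq[OF g(1)] LIMSEQ_unique by simp
    then show ?thesis using M N by (simp add: finite_measure.emeasure_eq_measure)
  qed
  show "sets M = sigma_sets UNIV {U. open U}" "sets N = sigma_sets UNIV {U. open U}"
    using M N by (auto simp: borel_def)
  show "emeasure M UNIV \<noteq> \<infinity>" using finite_measure.emeasure_finite[OF M(1)] by simp
qed (auto simp: Int_stable_def)

text \<open>Approximation of the indicator in mean by test functions with values in
  \<open>[0, 1]\<close>; this range is preserved by \<open>1 - g\<close> and by maxima, as
  complements and finite unions require.\<close>

definition lip_approx :: "torus measure \<Rightarrow> torus set \<Rightarrow> bool" where
  "lip_approx M A \<longleftrightarrow> A \<in> sets M \<and> (\<forall>\<epsilon>>0. \<exists>K g. lip_per K 1 g \<and> (\<forall>z. 0 \<le> g z) \<and>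
     (LINT p|M. \<bar>indicator A p - g (rep p)\<bar>) < \<epsilon>)"

lemma integrable_indicator_finite:
  "finite_measure M \<Longrightarrow> A \<in> sets M \<Longrightarrow> integrable M (indicator A :: _ \<Rightarrow> real)"
  by (rule integrable_real_indicator) (auto simp: finite_measure.emeasure_finite less_top[symmetric])

lemma integrable_approx_diff:
  assumes M: "finite_measure M" "sets M = sets (borel :: torus measure)" and A: "A \<in> sets M" and g: "lip_per K B g"
  shows "integrable M (\<lambda>p. \<bar>indicator A p - g (rep p)\<bar>)"
  by (intro integrable_abs Bochner_Integration.integrable_diff integrable_lift[OF M g]
    integrable_indicator_finite M A)

lemma lip_approx_Un:
  assumes M: "finite_measure M" "sets M = sets borel" and A: "lip_approx M A" and B: "lip_approx M B"
  shows "lip_approx M (A \<union> B)"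
  unfolding lip_approx_def
proof (intro conjI allI impI)
  have AB: "A \<in> sets M" "B \<in> sets M" using A B by (auto simp: lip_approx_def)
  then show ABM: "A \<union> B \<in> sets M" by simp
  fix \<epsilon> :: real assume "\<epsilon> > 0"
  then have e: "\<epsilon> / 2 > 0" by simp
  obtain K g where g: "lip_per K 1 g" "\<And>z. 0 \<le> g z" "(LINT p|M. \<bar>indicator A p - g (rep p)\<bar>) < \<epsilon> / 2"
    using A e unfolding lip_approx_def by blast
  obtain L h where h: "lip_per L 1 h" "\<And>z. 0 \<le> h z" "(LINT p|M. \<bar>indicator B p - h (rep p)\<bar>) < \<epsilon> / 2"
    using B e unfolding lip_approx_def by blast
  have m: "lip_per (K + L) 1 (\<lambda>z. max (g z) (h z))"
  proof (rule lip_perI)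
    show "periodic (\<lambda>z. max (g z) (h z))"
      unfolding periodic_def by (intro allI ballI) (simp only: lip_per_Ints[OF g(1)] lip_per_Ints[OF h(1)])
    fix z w
    show "\<bar>max (g z) (h z)\<bar> \<le> 1" using lip_perD(2)[OF g(1), of z] lip_perD(2)[OF h(1), of z] by linarith
    show "\<bar>max (g z) (h z) - max (g w) (h w)\<bar> \<le> (K + L) * norm (z - w)"
      using lip_perD(3)[OF g(1), of z w] lip_perD(3)[OF h(1), of z w] unfolding distrib_right by linarith
  qed
  have "(LINT p|M. \<bar>indicator (A \<union> B) p - max (g (rep p)) (h (rep p))\<bar>)
    \<le> (LINT p|M. \<bar>indicator A p - g (rep p)\<bar> + \<bar>indicator B p - h (rep p)\<bar>)"
  proof (rule integral_mono)
    show "integrable M (\<lambda>p. \<bar>indicator (A \<union> B) p - max (g (rep p)) (h (rep p))\<bar>)"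
      by (rule integrable_approx_diff[OF M ABM m])
    show "integrable M (\<lambda>p. \<bar>indicator A p - g (rep p)\<bar> + \<bar>indicator B p - h (rep p)\<bar>)"
      by (intro Bochner_Integration.integrable_add integrable_approx_diff[OF M AB(1) g(1)] integrable_approx_diff[OF M AB(2) h(1)])
    fix p
    have "indicator (A \<union> B) p = max (indicator A p) (indicator B p :: real)" by (auto simp: indicator_def)
    then show "\<bar>indicator (A \<union> B) p - max (g (rep p)) (h (rep p))\<bar> \<le> \<bar>indicator A p - g (rep p)\<bar> + \<bar>indicator B p - h (rep p)\<bar>"
      by linarith
  qed
  also have "\<dots> = (LINT p|M. \<bar>indicator A p - g (rep p)\<bar>) + (LINT p|M. \<bar>indicator B p - h (rep p)\<bar>)"
    by (intro Bochner_Integration.integral_add integrable_approx_diff[OF M AB(1) g(1)] integrable_approx_diff[OF M AB(2) h(1)])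
  finally have "(LINT p|M. \<bar>indicator (A \<union> B) p - max (g (rep p)) (h (rep p))\<bar>) < \<epsilon>" using g(3) h(3) by linarith
  moreover have "\<forall>z. 0 \<le> max (g z) (h z)" using g(2) by (simp add: le_max_iff_disj)
  ultimately show "\<exists>K g. lip_per K 1 g \<and> (\<forall>z. 0 \<le> g z) \<and> (LINT p|M. \<bar>indicator (A \<union> B) p - g (rep p)\<bar>) < \<epsilon>"
    using m by (intro exI[of _ "K + L"] exI[of _ "\<lambda>z. max (g z) (h z)"]) simp
qed

text \<open>Induction over the generated sigma algebra; countable unions are first cut to finite
  ones by continuity of the measure from below.\<close>

lemma lip_approx_borel:
  assumes M: "finite_measure M" "sets M = sets (borel :: torus measure)" and A: "A \<in> sets M"
  shows "lip_approx M A"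
proof -
  interpret finite_measure M by fact
  have sp: "space M = UNIV" using sets_eq_imp_space_eq[OF M(2)] by simp
  have "A \<in> sigma_sets UNIV {U. open U}" using A M by (simp add: borel_def)
  then show ?thesis
  proof induction
    case (Basic U)
    then have U: "open U" by simp
    then have UM: "U \<in> sets M" using M by simp
    obtain g K where g: "\<And>n. lip_per (K n) 1 (g n)" "\<And>n z. 0 \<le> g n z" "\<And>p. (\<lambda>n. g n (rep p)) \<longlonglongrightarrow> (indicator U p :: real)"
      using open_torus_lip_approx[OF U] by blast
    have "(\<lambda>n. LINT p|M. \<bar>indicator U p - g n (rep p)\<bar>) \<longlonglongrightarrow> (LINT p|M. 0)"
    proof (rule integral_dominated_convergence[where w = "\<lambda>_. 2"])
      show "(\<lambda>p. \<bar>indicator U p - g n (rep p)\<bar>) \<in> borel_measurable M" for n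
        using integrable_approx_diff[OF M UM g(1)] by (rule borel_measurable_integrable)
      show "AE p in M. norm \<bar>indicator U p - g n (rep p)\<bar> \<le> 2" for n
      proof (rule AE_I2)
        fix p
        show "norm \<bar>indicator U p - g n (rep p)\<bar> \<le> 2"
          using lip_perD(2)[OF g(1), of n "rep p"] by (auto simp: indicator_def abs_le_iff)
      qed
      show "AE p in M. (\<lambda>n. \<bar>indicator U p - g n (rep p)\<bar>) \<longlonglongrightarrow> 0"
      proof (rule AE_I2)
        fix p
        have "(\<lambda>n. \<bar>indicator U p - g n (rep p)\<bar>) \<longlonglongrightarrow> \<bar>indicator U p - indicator U p\<bar>"
          by (intro tendsto_intros g(3))
        then show "(\<lambda>n. \<bar>indicator U p - g n (rep p)\<bar>) \<longlonglongrightarrow> 0" by simp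
      qed
    qed auto
    then have lim: "(\<lambda>n. LINT p|M. \<bar>indicator U p - g n (rep p)\<bar>) \<longlonglongrightarrow> 0" by simp
    show ?case
      unfolding lip_approx_def
    proof (intro conjI allI impI UM)
      fix \<epsilon> :: real assume "\<epsilon> > 0"
      from order_tendstoD(2)[OF lim this] obtain n where "(LINT p|M. \<bar>indicator U p - g n (rep p)\<bar>) < \<epsilon>"
        by (auto simp: eventually_sequentially)
      then show "\<exists>K g. lip_per K 1 g \<and> (\<forall>z. 0 \<le> g z) \<and> (LINT p|M. \<bar>indicator U p - g (rep p)\<bar>) < \<epsilon>"
        using g(1)[of n] g(2)[of n] by blast
    qed
  next
    case Empty
    have "lip_per 0 1 (\<lambda>_. 0)" by (rule lip_per_const) simp
    then show ?case unfolding lip_approx_def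
      by (intro conjI allI impI exI[of _ 0] exI[of _ "\<lambda>_. 0"]) auto
  next
    case (Compl A)
    have AM: "A \<in> sets M" using Compl.IH by (simp add: lip_approx_def)
    have "UNIV - A \<in> sets M" using sets.compl_sets[OF AM] by (simp add: sp)
    moreover have "\<exists>K h. lip_per K 1 h \<and> (\<forall>z. 0 \<le> h z) \<and> (LINT p|M. \<bar>indicator (UNIV - A) p - h (rep p)\<bar>) < \<epsilon>"
      if e: "\<epsilon> > 0" for \<epsilon>
    proof -
      obtain K g where g: "lip_per K 1 g" "\<And>z. 0 \<le> g z" "(LINT p|M. \<bar>indicator A p - g (rep p)\<bar>) < \<epsilon>"
        using Compl.IH e unfolding lip_approx_def by blast
      have h: "lip_per K 1 (\<lambda>z. 1 - g z)"
      proof (rule lip_perI)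
        show "periodic (\<lambda>z. 1 - g z)"
          unfolding periodic_def by (intro allI ballI) (simp only: lip_per_Ints[OF g(1)])
        show "\<bar>1 - g z\<bar> \<le> 1" for z using lip_perD(2)[OF g(1), of z] g(2)[of z] by linarith
        show "\<bar>1 - g z - (1 - g w)\<bar> \<le> K * norm (z - w)" for z w using lip_perD(3)[OF g(1), of z w] by linarith
      qed
      have "\<bar>indicator (UNIV - A) p - (1 - g (rep p))\<bar> = \<bar>indicator A p - g (rep p)\<bar>" for p
        by (auto simp: indicator_def)
      then have "(LINT p|M. \<bar>indicator (UNIV - A) p - (1 - g (rep p))\<bar>) < \<epsilon>" using g(3) by simp
      moreover have "\<forall>z. 0 \<le> 1 - g z" using lip_perD(2)[OF g(1)] by (simp add: abs_le_iff)
      ultimately show ?thesis using h by (intro exI[of _ K] exI[of _ "\<lambda>z. 1 - g z"]) simp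
    qed
    ultimately show ?case unfolding lip_approx_def by blast
  next
    case (Union A)
    have AM: "A i \<in> sets M" for i using Union.IH by (simp add: lip_approx_def)
    define F where "F n = (\<Union>i<n. A i)" for n
    have FM: "F n \<in> sets M" for n unfolding F_def using AM by auto
    have Fa: "lip_approx M (F n)" for n
    proof (induction n)
      case 0
      have "lip_per 0 1 (\<lambda>_. 0)" by (rule lip_per_const) simp
      then show ?case unfolding lip_approx_def F_def
        by (intro conjI allI impI exI[of _ 0] exI[of _ "\<lambda>_. 0"]) auto
    next
      case (Suc n)
      have "F (Suc n) = F n \<union> A n" by (auto simp: F_def less_Suc_eq)
      then show ?case using lip_approx_Un[OF M Suc Union.IH] by simp
    qed
    have UM: "(\<Union>i. A i) \<in> sets M" using AM by auto
    have "(\<lambda>n. measure M (F n)) \<longlonglongrightarrow> measure M (\<Union>n. F n)"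
    proof (rule finite_Lim_measure_incseq)
      show "range F \<subseteq> sets M" using FM by blast
      show "incseq F" unfolding incseq_def F_def by (intro allI impI UN_mono) auto
    qed
    moreover have "(\<Union>n. F n) = (\<Union>i. A i)" by (auto simp: F_def)
    ultimately have lim: "(\<lambda>n. measure M (F n)) \<longlonglongrightarrow> measure M (\<Union>i. A i)" by simp
    show ?case
      unfolding lip_approx_def
    proof (intro conjI allI impI UM)
      fix \<epsilon> :: real assume e: "\<epsilon> > 0"
      have "measure M (\<Union>i. A i) - \<epsilon> / 2 < measure M (\<Union>i. A i)" using e by simp
      from order_tendstoD(1)[OF lim this] obtain n where n: "measure M (\<Union>i. A i) - \<epsilon> / 2 < measure M (F n)"
        by (auto simp: eventually_sequentially)
      obtain K g where g: "lip_per K 1 g" "\<And>z. 0 \<le> g z" "(LINT p|M. \<bar>indicator (F n) p - g (rep p)\<bar>) < \<epsilon> / 2"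
        using Fa[of n] e unfolding lip_approx_def by (metis half_gt_zero)
      let ?U = "\<Union>i. A i"
      have sub: "F n \<subseteq> ?U" by (auto simp: F_def)
      have i: "integrable M (\<lambda>p. indicator ?U p - indicator (F n) p :: real)"
        by (intro Bochner_Integration.integrable_diff integrable_indicator_finite M UM FM)
      have "(LINT p|M. \<bar>indicator ?U p - g (rep p)\<bar>) \<le> (LINT p|M. (indicator ?U p - indicator (F n) p) + \<bar>indicator (F n) p - g (rep p)\<bar>)"
      proof (rule integral_mono)
        show "integrable M (\<lambda>p. \<bar>indicator ?U p - g (rep p)\<bar>)" by (rule integrable_approx_diff[OF M UM g(1)])
        show "integrable M (\<lambda>p. (indicator ?U p - indicator (F n) p) + \<bar>indicator (F n) p - g (rep p)\<bar>)"
          by (intro Bochner_Integration.integrable_add i integrable_approx_diff[OF M FM g(1)])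
        fix p
        have "indicator (F n) p \<le> (indicator ?U p :: real)" using sub by (auto simp: indicator_def)
        then show "\<bar>indicator ?U p - g (rep p)\<bar> \<le> (indicator ?U p - indicator (F n) p) + \<bar>indicator (F n) p - g (rep p)\<bar>"
          by linarith
      qed
      also have "\<dots> = (LINT p|M. indicator ?U p - indicator (F n) p) + (LINT p|M. \<bar>indicator (F n) p - g (rep p)\<bar>)"
        by (intro Bochner_Integration.integral_add i integrable_approx_diff[OF M FM g(1)])
      also have "(LINT p|M. indicator ?U p - indicator (F n) p) = measure M ?U - measure M (F n)"
        using UM FM integrable_indicator_finite[OF M(1)] by (subst Bochner_Integration.integral_diff) auto
      finally have "(LINT p|M. \<bar>indicator ?U p - g (rep p)\<bar>) < \<epsilon>" using g(3) n by linarith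
      then show "\<exists>K g. lip_per K 1 g \<and> (\<forall>z. 0 \<le> g z) \<and> (LINT p|M. \<bar>indicator ?U p - g (rep p)\<bar>) < \<epsilon>"
        using g by blast
    qed
  qed
qed

section \<open>Weak mixing from a sequence of mixing times\<close>

lemma sequence_choice:
  assumes "\<And>F. finite F \<Longrightarrow> \<exists>x. \<forall>y\<in>F. R y x"
  shows "\<exists>s :: nat \<Rightarrow> 'a. \<forall>k. \<forall>j<k. R (s j) (s k)"
proof (rule dependent_wellorder_choice[where P = "\<lambda>f k r. \<forall>j<k. R (f j) r"])
  fix k :: nat and f :: "nat \<Rightarrow> 'a"
  show "\<exists>r. \<forall>j<k. R (f j) r" using assms[of "f ` {..<k}"] by auto
qed simp

text \<open>For fixed \<open>K\<close>, shifts by \<open>K\<close> times that make the translates of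
  \<open>B\<close> nearly independent bound the time average of \<open>\<bar>c\<bar>\<close> by
  \<open>2 / sqrt K\<close>, up to a boundary term independent of \<open>T\<close>. Letting
  \<open>T\<close> grow first and \<open>K\<close> afterwards gives 0.\<close>

lemma weakly_mixing_if_mixing_sequence:
  fixes M :: "'a measure" and \<phi> :: "real \<Rightarrow> 'a \<Rightarrow> 'a"
  assumes "prob_space M"
    and meas: "\<And>t. \<phi> t \<in> measurable M M" and pres: "\<And>t. distr M M (\<phi> t) = M"
    and grp: "\<And>s t x. \<phi> (s + t) x = \<phi> s (\<phi> t x)"
    and cont: "\<And>A B. A \<in> sets M \<Longrightarrow> B \<in> sets M \<Longrightarrow>
      continuous_on UNIV (\<lambda>t. measure M (A \<inter> (\<phi> t -` B \<inter> space M)))"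
    and mix: "\<And>A B. A \<in> sets M \<Longrightarrow> B \<in> sets M \<Longrightarrow>
      (\<lambda>n::nat. measure M (A \<inter> (\<phi> (\<tau> n) -` B \<inter> space M))) \<longlonglongrightarrow> measure M A * measure M B"
  shows "weakly_mixing M \<phi>"
  unfolding weakly_mixing_def
proof (intro ballI)
  interpret prob_space M by fact
  fix A B assume A: "A \<in> sets M" and B: "B \<in> sets M"
  define b where "b = measure M B"
  define P where "P t = \<phi> t -` B \<inter> space M" for t
  define c where "c t = measure M (A \<inter> P t) - measure M A * b" for t
  have P: "P t \<in> sets M" for t unfolding P_def using measurable_sets[OF meas B] .
  have pres': "measure M (\<phi> t -` C \<inter> space M) = measure M C" if "C \<in> sets M" for t C
    using measure_distr[OF meas that, of t] by (simp add: pres)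
  have mP: "measure M (P t) = b" for t unfolding P_def b_def by (rule pres'[OF B])
  have Padd: "P (t + s) = \<phi> t -` P s \<inter> space M" for s t
    using measurable_space[OF meas] grp[of s t] by (auto simp: P_def add.commute)
  have corr: "measure M (P (t + s) \<inter> P (t + r)) = measure M (P s \<inter> P r)" for t s r
  proof -
    have "P (t + s) \<inter> P (t + r) = \<phi> t -` (P s \<inter> P r) \<inter> space M" unfolding Padd by auto
    then show ?thesis using pres'[of "P s \<inter> P r" t] P by auto
  qed
  have bb: "0 \<le> b" "b \<le> 1" by (auto simp: b_def)
  have c1: "\<bar>c t\<bar> \<le> 1" for t
  proof -
    have "measure M A * b \<le> 1 * 1" using bb by (intro mult_mono) auto
    moreover have "0 \<le> measure M A * b" using bb by simp
    moreover have "measure M (A \<inter> P t) \<le> 1" "0 \<le> measure M (A \<inter> P t)" by auto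
    ultimately show ?thesis unfolding c_def by linarith
  qed
  have ccont: "continuous_on UNIV (\<lambda>t. \<bar>c t\<bar>)"
    unfolding c_def P_def by (intro continuous_intros cont A B)
  obtain G where G: "\<And>t. (G has_real_derivative \<bar>c t\<bar>) (at t)"
    using antiderivative_exists[OF ccont] by blast
  \<comment> \<open>the shifted indicators of \<open>B\<close> at the times \<open>s k\<close> are nearly orthogonal after centering\<close>
  have bessel: "\<exists>S. \<forall>T\<ge>0. integral {0..T} (\<lambda>t. \<bar>c t\<bar>) \<le> 2 / sqrt (real K) * T + S" if K: "K > 0" for K :: nat
  proof -
    have "\<exists>s :: nat \<Rightarrow> real. \<forall>k. \<forall>j<k. \<bar>measure M (P (s j) \<inter> P (s k)) - b * b\<bar> \<le> 1 / real K"
    proof (rule sequence_choice)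
      fix F :: "real set" assume F: "finite F"
      have "\<forall>\<^sub>F n in sequentially. \<bar>measure M (P y \<inter> P (\<tau> n)) - b * b\<bar> < 1 / real K" for y
      proof -
        have "(\<lambda>n. \<bar>measure M (P y \<inter> P (\<tau> n)) - b * b\<bar>) \<longlonglongrightarrow> \<bar>measure M (P y) * measure M B - b * b\<bar>"
          using mix[OF P B, of y] unfolding P_def[of "\<tau> _", symmetric] by (intro tendsto_intros)
        then have "(\<lambda>n. \<bar>measure M (P y \<inter> P (\<tau> n)) - b * b\<bar>) \<longlonglongrightarrow> 0" by (simp add: mP b_def)
        then show ?thesis by (rule order_tendstoD(2)) (use K in simp)
      qed
      then have "\<forall>\<^sub>F n in sequentially. \<forall>y\<in>F. \<bar>measure M (P y \<inter> P (\<tau> n)) - b * b\<bar> < 1 / real K"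
        using F by (simp add: eventually_ball_finite)
      then obtain n where "\<forall>y\<in>F. \<bar>measure M (P y \<inter> P (\<tau> n)) - b * b\<bar> < 1 / real K"
        by (auto simp: eventually_sequentially)
      then show "\<exists>x. \<forall>y\<in>F. \<bar>measure M (P y \<inter> P x) - b * b\<bar> \<le> 1 / real K" by (intro exI[of _ "\<tau> n"]) auto
    qed
    then obtain s :: "nat \<Rightarrow> real" where s: "\<And>k j. j < k \<Longrightarrow> \<bar>measure M (P (s j) \<inter> P (s k)) - b * b\<bar> \<le> 1 / real K"
      by blast
    have s': "measure M (P (s j) \<inter> P (s k)) - b * b \<le> (if j = k then 1 else 1 / real K)"
      "- (measure M (P (s j) \<inter> P (s k)) - b * b) \<le> (if j = k then 1 else 1 / real K)" for j k
    proof -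
      have "0 \<le> b * b" "b * b \<le> 1 * 1" using bb mult_mono[of b 1 b 1] by auto
      moreover have "measure M (P (s j) \<inter> P (s k)) \<le> 1" "0 \<le> measure M (P (s j) \<inter> P (s k))" by auto
      ultimately have "\<bar>measure M (P (s j) \<inter> P (s k)) - b * b\<bar> \<le> 1" by linarith
      then have "\<bar>measure M (P (s j) \<inter> P (s k)) - b * b\<bar> \<le> (if j = k then 1 else 1 / real K)"
        using s[of j k] s[of k j] by (cases j k rule: linorder_cases) (auto simp: Int_commute)
      then show "measure M (P (s j) \<inter> P (s k)) - b * b \<le> (if j = k then 1 else 1 / real K)"
        "- (measure M (P (s j) \<inter> P (s k)) - b * b) \<le> (if j = k then 1 else 1 / real K)" by linarith+
    qed
    \<comment> \<open>By invariance the near-orthogonality holds for the times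
      \<open>t + s k\<close> at every \<open>t\<close>, so the \<open>K\<close> correlations with
      \<open>A\<close> sum to order \<open>sqrt K\<close> only.\<close>
    have pt: "(\<Sum>k<K. \<bar>c (t + s k)\<bar>) \<le> 2 * sqrt (real K)" for t
    proof -
      \<comment> \<open>The signs turn the sum of absolute values into a single integral of
        \<open>X\<close> over \<open>A\<close>.\<close>
      define \<sigma> where "\<sigma> k = sgn (c (t + s k))" for k
      define g where "g k x = indicator (P (t + s k)) x - b" for k x
      define X where "X x = (\<Sum>k<K. \<sigma> k * g k x)" for x
      have iP: "integrable M (indicator C :: _ \<Rightarrow> real)" if "C \<in> sets M" for C
        using that by (rule integrable_indicator_finite[OF finite_measure_axioms])
      have gm: "g k \<in> borel_measurable M" for k unfolding g_def using P by simp
      have Xm: "X \<in> borel_measurable M" unfolding X_def using gm by simp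
      have gb: "\<bar>g k x\<bar> \<le> 1" for k x using bb by (auto simp: g_def indicator_def)
      have sb: "\<bar>\<sigma> k\<bar> \<le> 1" for k by (simp add: \<sigma>_def sgn_if)
      have Xb: "\<bar>X x\<bar> \<le> real K" for x
      proof -
        have "\<bar>X x\<bar> \<le> (\<Sum>k<K. \<bar>\<sigma> k * g k x\<bar>)" unfolding X_def by (rule sum_abs)
        also have "\<dots> \<le> (\<Sum>k<K. 1)"
          by (intro sum_mono) (use mult_mono[OF sb gb] in \<open>simp add: abs_mult\<close>)
        finally show ?thesis by simp
      qed
      have Ag: "(LINT x|M. indicator A x * g k x) = c (t + s k)" for k
      proof -
        have "(\<lambda>x. indicator A x * g k x) = (\<lambda>x. indicator (A \<inter> P (t + s k)) x - b * indicator A x)"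
          by (auto simp: g_def indicator_def)
        then show ?thesis
          using A P by (simp add: iP c_def mult.commute)
      qed
      have ig: "integrable M (\<lambda>x. indicator A x * g k x)" for k
        by (rule integrable_const_bound[of _ 1]) (use gm A gb in \<open>auto simp: indicator_def\<close>)
      have "(\<Sum>k<K. \<bar>c (t + s k)\<bar>) = (\<Sum>k<K. \<sigma> k * (LINT x|M. indicator A x * g k x))"
        by (intro sum.cong) (auto simp: Ag \<sigma>_def abs_sgn mult.commute)
      also have "\<dots> = (LINT x|M. indicator A x * X x)"
        using ig by (simp add: X_def sum_distrib_left mult.left_commute)
      \<comment> \<open>The inequality of arithmetic and geometric means, balanced at the expected
        size \<open>sqrt K\<close> of \<open>X\<close>, replaces Cauchy-Schwarz.\<close>
      also have "\<dots> \<le> (LINT x|M. ((X x)\<^sup>2 / sqrt (real K) + sqrt (real K)) / 2)"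
      proof (rule integral_mono)
        show "integrable M (\<lambda>x. indicator A x * X x)"
          by (rule integrable_const_bound[of _ "real K"]) (use Xm A Xb in \<open>auto simp: indicator_def\<close>)
        show "integrable M (\<lambda>x. ((X x)\<^sup>2 / sqrt (real K) + sqrt (real K)) / 2)"
        proof (rule integrable_const_bound[of _ "((real K)\<^sup>2 / sqrt (real K) + sqrt (real K)) / 2"])
          have "(X x)\<^sup>2 \<le> (real K)\<^sup>2" for x using Xb[of x] abs_le_square_iff[of "X x" "real K"] by simp
          then show "AE x in M. norm (((X x)\<^sup>2 / sqrt (real K) + sqrt (real K)) / 2) \<le> ((real K)\<^sup>2 / sqrt (real K) + sqrt (real K)) / 2"
            by (intro AE_I2) (auto intro!: divide_right_mono)
        qed (use Xm in simp)
        fix x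
        have sK: "sqrt (real K) > 0" using K by simp
        have "0 \<le> (\<bar>X x\<bar> - sqrt (real K))\<^sup>2" by simp
        then have "2 * \<bar>X x\<bar> * sqrt (real K) \<le> (X x)\<^sup>2 + (sqrt (real K))\<^sup>2" by (simp add: power2_diff)
        then have "\<bar>X x\<bar> \<le> ((X x)\<^sup>2 / sqrt (real K) + sqrt (real K)) / 2"
          using sK by (simp add: field_simps power2_eq_square)
        moreover have "indicator A x * X x \<le> \<bar>X x\<bar>" by (auto simp: indicator_def)
        ultimately show "indicator A x * X x \<le> ((X x)\<^sup>2 / sqrt (real K) + sqrt (real K)) / 2" by linarith
      qed
      also have "\<dots> = ((LINT x|M. (X x)\<^sup>2) / sqrt (real K) + sqrt (real K)) / 2"
      proof -
        have "integrable M (\<lambda>x. (X x)\<^sup>2)"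
        proof (rule integrable_const_bound[of _ "(real K)\<^sup>2"])
          show "AE x in M. norm ((X x)\<^sup>2) \<le> (real K)\<^sup>2"
            using Xb abs_le_square_iff[of _ "real K"] by (intro AE_I2) (metis abs_of_nat norm_power power_mono real_norm_def abs_ge_zero)
        qed (use Xm in simp)
        then show ?thesis by (simp add: prob_space)
      qed
      \<comment> \<open>The diagonal contributes at most \<open>K\<close>, the fewer than
        \<open>K^2\<close> remaining pairs at most \<open>1 / K\<close> each.\<close>
      also have "(LINT x|M. (X x)\<^sup>2) \<le> 2 * real K"
      proof -
        have gg: "(LINT x|M. g j x * g k x) = measure M (P (s j) \<inter> P (s k)) - b * b" for j k
        proof -
          have "(\<lambda>x. g j x * g k x) = (\<lambda>x. indicator (P (t + s j) \<inter> P (t + s k)) x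
              - b * indicator (P (t + s j)) x - b * indicator (P (t + s k)) x + b * b)"
            by (auto simp: g_def indicator_def algebra_simps)
          then have "(LINT x|M. g j x * g k x) = measure M (P (t + s j) \<inter> P (t + s k)) - b * b - b * b + b * b"
            using P by (simp add: iP mP prob_space)
          then show ?thesis by (simp add: corr)
        qed
        have ig: "integrable M (\<lambda>x. g j x * g k x)" for j k
          by (rule integrable_const_bound[of _ 1]) (use gm gb mult_mono[OF gb gb] in \<open>auto simp: abs_mult\<close>)
        have "(\<lambda>x. (X x)\<^sup>2) = (\<lambda>x. \<Sum>j<K. \<Sum>k<K. (\<sigma> j * \<sigma> k) * (g j x * g k x))"
          by (simp add: X_def power2_eq_square sum_product mult_ac)
        then have "(LINT x|M. (X x)\<^sup>2) = (\<Sum>j<K. \<Sum>k<K. (\<sigma> j * \<sigma> k) * (measure M (P (s j) \<inter> P (s k)) - b * b))"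
          using ig by (simp add: gg)
        also have "\<dots> \<le> (\<Sum>j<K. \<Sum>k<K. if j = k then 1 else 1 / real K)"
        proof (intro sum_mono)
          fix j k
          have "(\<sigma> j * \<sigma> k) * (measure M (P (s j) \<inter> P (s k)) - b * b) \<le>
            \<bar>\<sigma> j * \<sigma> k\<bar> * \<bar>measure M (P (s j) \<inter> P (s k)) - b * b\<bar>" by (metis abs_ge_self abs_mult)
          also have "\<dots> \<le> 1 * (if j = k then 1 else 1 / real K)"
            using s'[of j k] mult_mono[OF sb[of j] sb[of k]] by (intro mult_mono) (auto simp: abs_mult abs_le_iff)
          finally show "(\<sigma> j * \<sigma> k) * (measure M (P (s j) \<inter> P (s k)) - b * b) \<le> (if j = k then 1 else 1 / real K)" by simp
        qed
        also have "\<dots> \<le> (\<Sum>j<K. \<Sum>k<K. (if j = k then 1 else 0) + 1 / real K)"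
          by (intro sum_mono) auto
        also have "\<dots> = 2 * real K" using K by (simp add: sum.distrib)
        finally show ?thesis .
      qed
      finally have "(\<Sum>k<K. \<bar>c (t + s k)\<bar>) \<le> (2 * real K / sqrt (real K) + sqrt (real K)) / 2"
        by (simp add: divide_right_mono)
      also have "2 * real K / sqrt (real K) = 2 * sqrt (real K)"
        by (metis real_div_sqrt of_nat_0_le_iff times_divide_eq_right)
      also have "(2 * sqrt (real K) + sqrt (real K)) / 2 \<le> 2 * sqrt (real K)" by simp
      finally show ?thesis .
    qed
    define S where "S = (\<Sum>k<K. 2 * \<bar>s k\<bar>)"
    have "integral {0..T} (\<lambda>t. \<bar>c t\<bar>) \<le> 2 / sqrt (real K) * T + S" if T: "T \<ge> 0" for T
    proof -
      have sh: "integral {0..T} (\<lambda>t. \<bar>c t\<bar>) \<le> integral {0..T} (\<lambda>t. \<bar>c (t + r)\<bar>) + 2 * \<bar>r\<bar>" for r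
      proof -
        have "integral {0..T} (\<lambda>t. \<bar>c t\<bar>) = G T - G 0" by (rule integral_antiderivative[OF G T])
        moreover have "integral {0..T} (\<lambda>t. \<bar>c (t + r)\<bar>) = G (T + r) - G (0 + r)"
          by (rule integral_antiderivative[OF antiderivative_shift[OF G] T])
        moreover have "\<bar>G T - G (T + r)\<bar> \<le> 1 * \<bar>T - (T + r)\<bar>" "\<bar>G 0 - G (0 + r)\<bar> \<le> 1 * \<bar>0 - (0 + r)\<bar>"
          by (rule antiderivative_lipschitz[OF G]; use c1 in simp)+
        ultimately show ?thesis by (simp add: abs_le_iff)
      qed
      have ci: "(\<lambda>t. \<bar>c (t + r)\<bar>) integrable_on {0..T}" for r
        by (intro integrable_continuous_real cont_compose_UNIV[OF ccont] continuous_intros)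
      have "real K * integral {0..T} (\<lambda>t. \<bar>c t\<bar>) = (\<Sum>k<K. integral {0..T} (\<lambda>t. \<bar>c t\<bar>))" by simp
      also have "\<dots> \<le> (\<Sum>k<K. integral {0..T} (\<lambda>t. \<bar>c (t + s k)\<bar>) + 2 * \<bar>s k\<bar>)" by (intro sum_mono sh)
      also have "\<dots> = integral {0..T} (\<lambda>t. \<Sum>k<K. \<bar>c (t + s k)\<bar>) + S"
        by (simp add: sum.distrib S_def integral_sum ci)
      also have "integral {0..T} (\<lambda>t. \<Sum>k<K. \<bar>c (t + s k)\<bar>) \<le> integral {0..T} (\<lambda>t. 2 * sqrt (real K))"
        by (rule integral_le) (auto intro!: integrable_sum ci pt)
      also have "\<dots> = 2 * sqrt (real K) * T" using T by (simp add: mult_ac)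
      finally have 1: "real K * integral {0..T} (\<lambda>t. \<bar>c t\<bar>) \<le> 2 * sqrt (real K) * T + S" by simp
      have S0: "S \<ge> 0" by (simp add: S_def sum_nonneg)
      have "S \<le> real K * S" using K S0 by (simp add: mult_left_le_one_le mult_le_cancel_right1)
      moreover have "2 * sqrt (real K) * T = real K * (2 / sqrt (real K) * T)"
        using K by (simp add: field_simps)
      ultimately have "real K * integral {0..T} (\<lambda>t. \<bar>c t\<bar>) \<le> real K * (2 / sqrt (real K) * T + S)"
        using 1 by (simp add: distrib_left)
      then show ?thesis using K by simp
    qed
    then show ?thesis by blast
  qed
  have I: "(LINT t:{0..T}|lborel. \<bar>measure M (A \<inter> (\<phi> t -` B \<inter> space M)) - measure M A * measure M B\<bar>)
      = integral {0..T} (\<lambda>t. \<bar>c t\<bar>)" for T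
  proof -
    have "set_integrable lborel {0..T} (\<lambda>t. \<bar>c t\<bar>)"
      unfolding set_integrable_def by (rule borel_integrable_compact) (auto intro: continuous_on_subset[OF ccont])
    from set_borel_integral_eq_integral(2)[OF this] show ?thesis by (simp add: c_def P_def b_def)
  qed
  show "((\<lambda>T. (1 / T) * (LINT t:{0..T}|lborel.
      \<bar>measure M (A \<inter> (\<phi> t -` B \<inter> space M)) - measure M A * measure M B\<bar>)) \<longlongrightarrow> 0) at_top"
    unfolding I
  proof (rule tendstoI)
    fix e :: real assume e: "e > 0"
    \<comment> \<open>Makes \<open>2 / sqrt K\<close> less than \<open>e / 2\<close>; the other half
      beats \<open>S / T\<close> for large \<open>T\<close>.\<close>
    obtain K :: nat where K: "real K > (4 / e)\<^sup>2" using reals_Archimedean2 by blast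
    then have K0: "K > 0" by (metis gr0I of_nat_0 not_less zero_le_power2)
    have "4 / e < sqrt (real K)" by (rule real_less_rsqrt[OF K])
    then have Ke: "2 / sqrt (real K) < e / 2" using e K0 by (simp add: field_simps)
    obtain S where S: "\<And>T. T \<ge> 0 \<Longrightarrow> integral {0..T} (\<lambda>t. \<bar>c t\<bar>) \<le> 2 / sqrt (real K) * T + S"
      using bessel[OF K0] by blast
    show "\<forall>\<^sub>F T in at_top. dist (1 / T * integral {0..T} (\<lambda>t. \<bar>c t\<bar>)) 0 < e"
      using eventually_gt_at_top[of "max 1 (2 * \<bar>S\<bar> / e)"]
    proof eventually_elim
      fix T assume T: "max 1 (2 * \<bar>S\<bar> / e) < T"
      then have T0: "T > 0" and "2 * \<bar>S\<bar> / e < T" by auto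
      then have Ts: "\<bar>S\<bar> < e / 2 * T" using e by (simp add: field_simps)
      define J where "J = integral {0..T} (\<lambda>t. \<bar>c t\<bar>)"
      have pos: "0 \<le> J"
        unfolding J_def
        by (rule integral_nonneg) (auto intro!: integrable_continuous_real continuous_on_subset[OF ccont])
      have "J \<le> 2 / sqrt (real K) * T + S" unfolding J_def using S T0 by simp
      moreover have "2 / sqrt (real K) * T < e / 2 * T" using Ke T0 by (rule mult_strict_right_mono)
      ultimately have "J < e / 2 * T + e / 2 * T" using Ts by linarith
      then have "J < e * T" by (simp add: mult.commute)
      then have "dist (1 / T * J) 0 < e" using T0 pos by (simp add: dist_real_def field_simps)
      then show "dist (1 / T * integral {0..T} (\<lambda>t. \<bar>c t\<bar>)) 0 < e" by (simp only: J_def)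
    qed
  qed
qed

section \<open>The flow on the torus\<close>

lemma abs_integral_le:
  fixes f g :: "'a \<Rightarrow> real"
  assumes "integrable M f" "integrable M g" "\<And>x. \<bar>f x\<bar> \<le> g x"
  shows "\<bar>LINT x|M. f x\<bar> \<le> (LINT x|M. g x)"
  by (rule order_trans[OF integral_abs_bound integral_mono]) (use assms in auto)

section \<open>Descent of the flow and its measure\<close>

context irrational_slope
begin

definition tflow :: "(real \<times> real \<Rightarrow> real) \<Rightarrow> real \<Rightarrow> torus \<Rightarrow> torus" where
  "tflow f t p = torus_of (Phi f t (rep p))"

text \<open>The closed square is a fundamental domain up to a Lebesgue null set, so doubling its
  boundary is harmless.\<close>

definition tmeas :: "(real \<times> real \<Rightarrow> real) \<Rightarrow> torus measure" where
  "tmeas f = distr (density lborel (\<lambda>z. ennreal (indicator (cbox (0, 0) (1, 1)) z * (f z / mean f)))) borel torus_of"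

lemma adm_periodic: "adm f \<Longrightarrow> periodic f"
  unfolding adm_def using lip_perD(1) by blast

lemma periodic_torus_Phi: "adm f \<Longrightarrow> periodic (\<lambda>z. torus_of (Phi f t z))"
  unfolding periodic_def by (intro allI ballI) (simp only: Phi_Ints torus_of_add_Ints)

lemma tflow_torus_of: "adm f \<Longrightarrow> tflow f t (torus_of z) = torus_of (Phi f t z)"
  unfolding tflow_def by (rule rep_torus_of[OF periodic_torus_Phi])

lemma tflow_add: "adm f \<Longrightarrow> tflow f (s + t) p = tflow f s (tflow f t p)"
  using tflow_torus_of[of f s "Phi f t (rep p)"] by (simp add: tflow_def Phi_add)

lemma tflow_measurable:
  assumes "adm f" shows "tflow f t \<in> borel \<rightarrow>\<^sub>M borel"
proof -
  have "continuous_on UNIV (\<lambda>z. torus_of (Phi f t z))"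
    by (rule continuous_on_compose2[OF torus_of_continuous[of UNIV] Phi_cont[OF assms]]) simp
  then have "continuous_on UNIV (tflow f t)"
    unfolding tflow_def[abs_def] by (rule continuous_lift) (rule periodic_torus_Phi[OF assms])
  then show ?thesis by (rule borel_measurable_continuous_onI)
qed

lemma lift_tflow: "periodic g \<Longrightarrow> g (rep (tflow f t p)) = g (Phi f t (rep p))"
  unfolding tflow_def by (rule rep_torus_of)

lemma is_reparam_flow_tflow:
  assumes f: "adm f"
  shows "is_reparam_flow \<alpha> (\<lambda>p. inverse (f (rep p))) (tflow f)"
  unfolding is_reparam_flow_def
proof (intro allI conjI)
  fix p :: torus
  show "tflow f 0 p = p" by (simp add: tflow_def Phi_0[OF f])
  let ?x = "\<lambda>t. fst (rep p) + arrive f (rep p) t" and ?y = "\<lambda>t. snd (rep p) + \<alpha> * arrive f (rep p) t"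
  have "tflow f t p = torus_of (?x t, ?y t)" for t
    by (simp add: tflow_def Phi_def v_def torus_of_Pair mult.commute)
  moreover have d: "(arrive f (rep p) has_real_derivative inverse (f (rep (tflow f t p)))) (at t)" for t
    using arrive_deriv[OF f, of "rep p" t] by (simp add: lift_tflow[OF adm_periodic[OF f]] inverse_eq_divide)
  moreover have "(?x has_real_derivative inverse (f (rep (tflow f t p)))) (at t)" for t
    using d[of t] by (auto intro!: derivative_eq_intros)
  moreover have "(?y has_real_derivative \<alpha> * inverse (f (rep (tflow f t p)))) (at t)" for t
    using d[of t] by (auto intro!: derivative_eq_intros)
  ultimately show "\<exists>x y. \<forall>t. tflow f t p = torus_of (x t, y t) \<and>
      (x has_real_derivative inverse (f (rep (tflow f t p)))) (at t) \<and>
      (y has_real_derivative \<alpha> * inverse (f (rep (tflow f t p)))) (at t)"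
    by (intro exI[of _ ?x] exI[of _ ?y] allI conjI)
qed

lemma sets_tmeas: "sets (tmeas f) = sets borel" "space (tmeas f) = UNIV"
  by (simp_all add: tmeas_def)

lemma unit_square_integral:
  assumes "continuous_on UNIV g"
  shows "integrable lborel (\<lambda>z. indicator (cbox (0, 0) (1, 1)) z * g z)"
    "(LINT z|lborel. indicator (cbox (0, 0) (1, 1)) z * g z) = mean g"
proof -
  have s: "set_integrable lborel (cbox (0, 0) (1, 1)) g"
    unfolding set_integrable_def
    by (rule borel_integrable_compact) (auto intro: continuous_on_subset[OF assms])
  then show "integrable lborel (\<lambda>z. indicator (cbox (0, 0) (1, 1)) z * g z)"
    by (simp add: set_integrable_def)
  show "(LINT z|lborel. indicator (cbox (0, 0) (1, 1)) z * g z) = mean g"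
    using set_borel_integral_eq_integral(2)[OF s] by (simp add: set_lebesgue_integral_def mean_def)
qed

lemma density_facts:
  assumes f: "adm f"
  defines "w \<equiv> (\<lambda>z. indicator (cbox (0, 0) (1, 1)) z * (f z / mean f))"
  shows "w \<in> borel_measurable lborel" "0 \<le> w z"
proof -
  have "continuous_on UNIV (\<lambda>z. f z / mean f)"
    using mean_ge_1[OF f] by (intro continuous_intros admD(2)[OF f]) auto
  from borel_measurable_integrable[OF unit_square_integral(1)[OF this]]
  show "w \<in> borel_measurable lborel" by (simp add: w_def)
  have "0 \<le> f z" using admD(1)[OF f, of z] by simp
  then show "0 \<le> w z" using mean_ge_1[OF f] by (simp add: w_def)
qed

lemma prob_space_tmeas:
  assumes f: "adm f" shows "prob_space (tmeas f)"
proof -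
  let ?w = "\<lambda>z. indicator (cbox (0, 0) (1, 1)) z * (f z / mean f)"
  note w = density_facts[OF f]
  have c: "continuous_on UNIV (\<lambda>z. f z / mean f)"
    using mean_ge_1[OF f] by (intro continuous_intros admD(2)[OF f]) auto
  have "prob_space (density lborel (\<lambda>z. ennreal (?w z)))"
  proof
    have "emeasure (density lborel (\<lambda>z. ennreal (?w z))) (space (density lborel (\<lambda>z. ennreal (?w z)))) = (\<integral>\<^sup>+ z. ennreal (?w z) \<partial>lborel)"
      using w(1) by (subst emeasure_density) (auto intro!: nn_integral_cong)
    also have "\<dots> = ennreal (LINT z|lborel. ?w z)"
      by (rule nn_integral_eq_integral[OF unit_square_integral(1)[OF c]]) (use w(2) in simp)
    also have "(LINT z|lborel. ?w z) = 1"
      unfolding unit_square_integral(2)[OF c] using mean_ge_1[OF f] mean_cmult[of "1 / mean f" f] by simp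
    finally show "emeasure (density lborel (\<lambda>z. ennreal (?w z))) (space (density lborel (\<lambda>z. ennreal (?w z)))) = 1" by simp
  qed
  then show ?thesis unfolding tmeas_def by (rule prob_space.prob_space_distr) simp
qed

lemma integral_tmeas:
  assumes f: "adm f" and g: "lip_per K B g"
  shows "(LINT p|tmeas f. g (rep p)) = average f g"
proof -
  let ?w = "\<lambda>z. indicator (cbox (0, 0) (1, 1)) z * (f z / mean f)"
  note w = density_facts[OF f] and cg = lip_per_cont[OF g, of UNIV]
  have c: "continuous_on UNIV (\<lambda>z. g z * f z / mean f)"
    using mean_ge_1[OF f] by (intro continuous_intros admD(2)[OF f] cg) auto
  have gm: "g \<in> borel_measurable lborel" using borel_measurable_continuous_onI[OF cg] by simp
  have "(LINT p|tmeas f. g (rep p)) = (LINT z|density lborel (\<lambda>z. ennreal (?w z)). g (rep (torus_of z)))"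
    unfolding tmeas_def by (rule integral_distr) (simp, rule measurable_lift[OF g])
  also have "\<dots> = (LINT z|density lborel (\<lambda>z. ennreal (?w z)). g z)"
    by (simp only: rep_torus_of[OF lip_perD(1)[OF g]])
  also have "\<dots> = (LINT z|lborel. ?w z *\<^sub>R g z)"
    by (rule integral_density[OF gm w(1)]) (use w(2) in simp)
  also have "\<dots> = (LINT z|lborel. indicator (cbox (0, 0) (1, 1)) z * (g z * f z / mean f))"
    by (simp add: mult_ac)
  also have "\<dots> = mean (\<lambda>z. g z * f z / mean f)" by (rule unit_square_integral(2)[OF c])
  also have "\<dots> = average f g"
    using mean_cmult[of "1 / mean f" "\<lambda>z. g z * f z"] by (simp add: average_def)
  finally show ?thesis .
qed

section \<open>Invariance and unique ergodicity\<close>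

lemma small_multiple_imp_zero:
  fixes x :: real
  assumes "\<And>e. e > 0 \<Longrightarrow> \<bar>x\<bar> \<le> C * e" shows "x = 0"
proof (rule ccontr)
  assume "x \<noteq> 0"
  define e where "e = \<bar>x\<bar> / (2 * (\<bar>C\<bar> + 1))"
  have e: "e > 0" using \<open>x \<noteq> 0\<close> by (simp add: e_def add_nonneg_pos)
  have "\<bar>x\<bar> \<le> C * e" by (rule assms[OF e])
  also have "\<dots> \<le> (\<bar>C\<bar> + 1) * e" using e by (intro mult_right_mono) auto
  also have "\<dots> = \<bar>x\<bar> / 2" by (simp add: e_def field_simps add_nonneg_eq_0_iff)
  finally show False using \<open>x \<noteq> 0\<close> by simp
qed

text \<open>Invariance without any change of variables: along one orbit the integrals of
  \<open>g\<close> and of its shift by \<open>t\<close> differ by boundary terms at most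
  \<open>2 * B * \<bar>t\<bar>\<close>, and both time averages converge to the respective
  \<open>average\<close>.\<close>

lemma average_Phi:
  assumes f: "adm f" and g: "lip_per K B g"
  shows "average f (\<lambda>z. g (Phi f t z)) = average f g"
proof -
  obtain Kf Bf where fl: "lip_per Kf Bf f" using f by (auto simp: adm_def)
  note gp = lip_per_Phi[OF f fl g, of t]
  have "\<bar>average f (\<lambda>z. g (Phi f t z)) - average f g\<bar> \<le> 3 * e" if e: "e > 0" for e
  proof -
    obtain L1 where L1: "L1 > 0" "\<And>L z. L \<ge> L1 \<Longrightarrow> \<bar>integral {0..L} (\<lambda>s. g (Phi f s z)) - L * average f g\<bar> \<le> e * L"
      using time_average[OF f e, of K B] g by blast
    obtain L2 where L2: "L2 > 0" "\<And>L z. L \<ge> L2 \<Longrightarrow> \<bar>integral {0..L} (\<lambda>s. g (Phi f t (Phi f s z))) - L * average f (\<lambda>z. g (Phi f t z))\<bar> \<le> e * L"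
      using time_average[OF f e, of "K * (1 + Kf * \<bar>t\<bar> * norm v)" B] gp by blast
    define L where "L = max (max L1 L2) (2 * B * \<bar>t\<bar> / e)"
    have L: "L \<ge> L1" "L \<ge> L2" "2 * B * \<bar>t\<bar> / e \<le> L" "L > 0" using L1 by (auto simp: L_def)
    then have Lb: "2 * B * \<bar>t\<bar> \<le> e * L" using e by (simp add: field_simps)
    have "continuous_on UNIV (\<lambda>s. g (Phi f s 0))"
      by (intro cont_compose_UNIV[OF lip_per_cont[OF g]] Phi_cont_time f)
    then obtain G where G: "\<And>s. (G has_real_derivative g (Phi f s 0)) (at s)"
      using antiderivative_exists by blast
    have "integral {0..L} (\<lambda>s. g (Phi f s 0)) = G L - G 0"
      by (rule integral_antiderivative[OF G]) (use L in simp)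
    moreover have "integral {0..L} (\<lambda>s. g (Phi f t (Phi f s 0))) = G (L + t) - G (0 + t)"
      using integral_antiderivative(2)[OF antiderivative_shift[of G, OF G], of 0 L t] L
      by (simp add: Phi_add[OF f, symmetric] add.commute)
    moreover have "\<bar>G (L + t) - G L\<bar> \<le> B * \<bar>L + t - L\<bar>" "\<bar>G (0 + t) - G 0\<bar> \<le> B * \<bar>0 + t - 0\<bar>"
      by (rule antiderivative_lipschitz[OF G]; rule lip_perD(2)[OF g])+
    ultimately have "\<bar>integral {0..L} (\<lambda>s. g (Phi f t (Phi f s 0))) - integral {0..L} (\<lambda>s. g (Phi f s 0))\<bar> \<le> e * L"
      using Lb by simp
    then have "\<bar>L * average f (\<lambda>z. g (Phi f t z)) - L * average f g\<bar> \<le> 3 * (e * L)"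
      using L1(2)[OF L(1), of 0] L2(2)[OF L(2), of 0] by linarith
    then have "L * \<bar>average f (\<lambda>z. g (Phi f t z)) - average f g\<bar> \<le> L * (3 * e)"
      using L(4) by (simp add: right_diff_distrib[symmetric] abs_mult mult_ac)
    then show ?thesis using L(4) by simp
  qed
  then have "average f (\<lambda>z. g (Phi f t z)) - average f g = 0" by (rule small_multiple_imp_zero)
  then show ?thesis by simp
qed

lemma invariant_tmeas:
  assumes f: "adm f" shows "invariant_prob (tflow f) (tmeas f)"
  unfolding invariant_prob_def
proof (intro conjI allI)
  interpret prob_space "tmeas f" by (rule prob_space_tmeas[OF f])
  show "prob_space (tmeas f)" by unfold_locales
  show "sets (tmeas f) = sets borel" by (rule sets_tmeas)
  fix t
  show m: "tflow f t \<in> measurable (tmeas f) (tmeas f)"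
    using tflow_measurable[OF f, of t] measurable_cong_sets[OF sets_tmeas(1) sets_tmeas(1)] by blast
  show "distr (tmeas f) (tmeas f) (tflow f t) = tmeas f"
  proof (rule torus_measure_eqI)
    show "finite_measure (distr (tmeas f) (tmeas f) (tflow f t))"
      using prob_space_distr[OF m] by (simp add: prob_space_def)
    fix K B g assume g: "lip_per K B g"
    obtain Kf Bf where fl: "lip_per Kf Bf f" using f by (auto simp: adm_def)
    have "(LINT p|distr (tmeas f) (tmeas f) (tflow f t). g (rep p)) = (LINT p|tmeas f. g (rep (tflow f t p)))"
      using measurable_lift[OF g] measurable_cong_sets[OF sets_tmeas(1) refl] by (intro integral_distr m) blast
    also have "\<dots> = (LINT p|tmeas f. g (Phi f t (rep p)))" by (simp add: lift_tflow[OF lip_perD(1)[OF g]])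
    also have "\<dots> = average f (\<lambda>z. g (Phi f t z))" by (rule integral_tmeas[OF f lip_per_Phi[OF f fl g]])
    also have "\<dots> = (LINT p|tmeas f. g (rep p))" by (simp only: average_Phi[OF f g] integral_tmeas[OF f g])
    finally show "(LINT p|distr (tmeas f) (tmeas f) (tflow f t). g (rep p)) = (LINT p|tmeas f. g (rep p))" .
  qed (auto simp: sets_tmeas intro: finite_measure_axioms)
qed

text \<open>Replacing time integrals by Riemann sums avoids joint measurability of the flow in the
  uniqueness proof.\<close>

lemma riemann_sum_bound:
  assumes f: "adm f" and g: "lip_per K B g" and d: "\<delta> > 0"
  shows "\<bar>\<delta> * (\<Sum>j<N. g (Phi f (real j * \<delta>) z)) - integral {0..real N * \<delta>} (\<lambda>s. g (Phi f s z))\<bar>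
    \<le> real N * (K * norm v * \<delta> * \<delta>)"
proof -
  have "continuous_on UNIV (\<lambda>s. g (Phi f s z))"
    by (intro cont_compose_UNIV[OF lip_per_cont[OF g]] Phi_cont_time f)
  then obtain G where G: "\<And>s. (G has_real_derivative g (Phi f s z)) (at s)"
    using antiderivative_exists by blast
  have K0: "K \<ge> 0" by (rule lip_per_nonneg[OF g])
  have step: "\<bar>\<delta> * g (Phi f a z) - (G (a + \<delta>) - G a)\<bar> \<le> K * norm v * \<delta> * \<delta>" for a
  proof -
    have "norm ((G (a + \<delta>) - (a + \<delta>) * g (Phi f a z)) - (G a - a * g (Phi f a z))) \<le> (K * norm v * \<delta>) * norm (a + \<delta> - a)"
    proof (rule field_differentiable_bound[of "{a..a + \<delta>}" "\<lambda>s. G s - s * g (Phi f a z)" "\<lambda>s. g (Phi f s z) - g (Phi f a z)"])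
      fix s assume s: "s \<in> {a..a + \<delta>}"
      show "((\<lambda>s. G s - s * g (Phi f a z)) has_field_derivative g (Phi f s z) - g (Phi f a z)) (at s within {a..a + \<delta>})"
        by (auto intro!: derivative_eq_intros has_field_derivative_at_within[OF G])
      have "\<bar>g (Phi f s z) - g (Phi f a z)\<bar> \<le> K * norm (Phi f s z - Phi f a z)" by (rule lip_perD(3)[OF g])
      also have "\<dots> \<le> K * (\<bar>s - a\<bar> * norm v)" using K0 by (intro mult_left_mono Phi_lip_time f)
      also have "\<dots> \<le> K * (\<delta> * norm v)" using K0 s by (intro mult_left_mono mult_right_mono) auto
      finally show "norm (g (Phi f s z) - g (Phi f a z)) \<le> K * norm v * \<delta>" by (simp add: mult_ac)
    qed (use d in auto)
    then show ?thesis using d by (simp add: algebra_simps abs_minus_commute)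
  qed
  have "integral {0..real N * \<delta>} (\<lambda>s. g (Phi f s z)) = G (real N * \<delta>) - G (real 0 * \<delta>)"
    using integral_antiderivative(2)[OF G, of 0 "real N * \<delta>"] d by simp
  also have "\<dots> = (\<Sum>j<N. G (real (Suc j) * \<delta>) - G (real j * \<delta>))"
    by (rule sum_lessThan_telescope[symmetric])
  finally have eq: "\<delta> * (\<Sum>j<N. g (Phi f (real j * \<delta>) z)) - integral {0..real N * \<delta>} (\<lambda>s. g (Phi f s z)) =
    (\<Sum>j<N. \<delta> * g (Phi f (real j * \<delta>) z) - (G (real j * \<delta> + \<delta>) - G (real j * \<delta>)))"
    by (simp add: sum_distrib_left sum_subtractf sum.distrib algebra_simps)
  have "(\<Sum>j<N. \<bar>\<delta> * g (Phi f (real j * \<delta>) z) - (G (real j * \<delta> + \<delta>) - G (real j * \<delta>))\<bar>)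
      \<le> (\<Sum>j<N. K * norm v * \<delta> * \<delta>)"
    by (rule sum_mono, rule step)
  from order_trans[OF sum_abs this] show ?thesis unfolding eq by simp
qed

text \<open>Finite averages of \<open>g\<close> along the flow keep its integral for every invariant
  \<open>N\<close>, yet they are uniformly close to the constant \<open>average f g\<close>.\<close>

lemma unique_invariant_tmeas:
  assumes f: "adm f" shows "unique_invariant_prob (tflow f) (tmeas f)"
  unfolding unique_invariant_prob_def
proof (intro conjI allI impI invariant_tmeas[OF f])
  fix N assume inv: "invariant_prob (tflow f) N"
  then interpret N: prob_space N by (simp add: invariant_prob_def)
  interpret T: prob_space "tmeas f" by (rule prob_space_tmeas[OF f])
  have sN: "sets N = sets borel" and mN: "\<And>t. tflow f t \<in> measurable N N"
    and dN: "\<And>t. distr N N (tflow f t) = N" using inv by (auto simp: invariant_prob_def)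
  have bm: "borel_measurable N = borel_measurable borel" by (rule measurable_cong_sets[OF sN refl])
  obtain Kf Bf where fl: "lip_per Kf Bf f" using f by (auto simp: adm_def)
  show "N = tmeas f"
  proof (rule torus_measure_eqI)
    fix K B g assume g: "lip_per K B g"
    note K0 = lip_per_nonneg[OF g]
    have iN: "integrable N (\<lambda>p. g (Phi f t (rep p)))" for t
      by (rule integrable_lift[OF N.finite_measure_axioms sN lip_per_Phi[OF f fl g]])
    have eqN: "(LINT p|N. g (Phi f t (rep p))) = (LINT p|N. g (rep p))" for t
    proof -
      have "(LINT p|distr N N (tflow f t). g (rep p)) = (LINT p|N. g (rep (tflow f t p)))"
        using measurable_lift[OF g] by (intro integral_distr mN) (simp add: bm)
      then show ?thesis by (simp add: dN lift_tflow[OF lip_perD(1)[OF g]])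
    qed
    have "\<bar>(LINT p|N. g (rep p)) - average f g\<bar> \<le> (1 + K * norm v) * e" if e: "e > 0" for e
    proof -
      obtain L where L: "L > 0" "\<And>L' z. L' \<ge> L \<Longrightarrow> \<bar>integral {0..L'} (\<lambda>s. g (Phi f s z)) - L' * average f g\<bar> \<le> e * L'"
        using time_average[OF f e, of K B] g by blast
      \<comment> \<open>With step \<open>e\<close>, \<open>n\<close> samples span a time of at least
        \<open>L\<close>; sampling then costs \<open>K * norm v * e\<close> and equidistribution
        \<open>e\<close>.\<close>
      obtain n :: nat where n: "real n > L / e" using reals_Archimedean2 by blast
      have n0: "real n > 0" using n L e by (meson divide_pos_pos order_less_trans)
      have nL: "real n * e \<ge> L" using n e by (simp add: field_simps)
      have pt: "\<bar>(\<Sum>j<n. g (Phi f (real j * e) z)) / real n - average f g\<bar> \<le> (1 + K * norm v) * e" for z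
      proof -
        let ?S = "\<Sum>j<n. g (Phi f (real j * e) z)"
        have "\<bar>e * ?S - real n * e * average f g\<bar> \<le> real n * (K * norm v * e * e) + e * (real n * e)"
          using riemann_sum_bound[OF f g e, where N = n and z = z] L(2)[OF nL, of z] by linarith
        moreover have "e * ?S - real n * e * average f g = (real n * e) * (?S / real n - average f g)"
          using n0 by (simp add: field_simps)
        moreover have "real n * (K * norm v * e * e) + e * (real n * e) = (real n * e) * ((1 + K * norm v) * e)"
          by (simp add: algebra_simps)
        ultimately have "(real n * e) * \<bar>?S / real n - average f g\<bar> \<le> (real n * e) * ((1 + K * norm v) * e)"
          using n0 e by (simp only: abs_mult)
        moreover have "real n * e > 0" using n0 e by simp
        ultimately show ?thesis by (simp only: mult_le_cancel_left_pos)
      qed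
      have "(LINT p|N. (\<Sum>j<n. g (Phi f (real j * e) (rep p))) / real n) = (LINT p|N. g (rep p))"
        using n0 by (simp add: Bochner_Integration.integral_sum[OF iN] eqN)
      moreover have "\<bar>(LINT p|N. (\<Sum>j<n. g (Phi f (real j * e) (rep p))) / real n) - average f g\<bar> \<le> (1 + K * norm v) * e"
      proof -
        have i: "integrable N (\<lambda>p. (\<Sum>j<n. g (Phi f (real j * e) (rep p))) / real n - average f g)"
          using iN by simp
        have "(LINT p|N. (\<Sum>j<n. g (Phi f (real j * e) (rep p))) / real n) - average f g =
            (LINT p|N. (\<Sum>j<n. g (Phi f (real j * e) (rep p))) / real n - average f g)"
          using iN by (simp add: N.prob_space)
        also have "\<bar>\<dots>\<bar> \<le> (LINT p|N. (1 + K * norm v) * e)"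
          by (rule abs_integral_le[OF i _ pt]) simp
        finally show ?thesis by (simp add: N.prob_space)
      qed
      ultimately show ?thesis by simp
    qed
    then have "(LINT p|N. g (rep p)) - average f g = 0" by (rule small_multiple_imp_zero)
    then show "(LINT p|N. g (rep p)) = (LINT p|tmeas f. g (rep p))" by (simp add: integral_tmeas[OF f g])
  qed (auto simp: sN sets_tmeas N.finite_measure_axioms T.finite_measure_axioms)
qed

section \<open>Correlations and weak mixing on the torus\<close>

lemma lip_per_scale:
  assumes g: "lip_per K B g"
  shows "\<exists>C>0. \<exists>g'. lip_per 1 1 g' \<and> g = (\<lambda>z. C * g' z)"
proof -
  define C where "C = K + B + 1"
  have C: "C > 0" "K \<le> C" "B \<le> C" using lip_per_nonneg[OF g] by (auto simp: C_def)
  have "lip_per 1 1 (\<lambda>z. (1 / C) * g z)"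
    by (rule lip_per_mono[OF lip_per_cmult[OF g]]) (use C in auto)
  moreover have "g = (\<lambda>z. C * ((1 / C) * g z))" using C by simp
  ultimately show ?thesis using C(1) by blast
qed

lemma mixes_limit:
  assumes f: "adm f" and mix: "\<And>n::nat. mixes f (t n) (1 / Suc n)"
    and g: "lip_per K B g" and h: "lip_per K' B' h"
  shows "(\<lambda>n. mean (\<lambda>z. g (Phi f (t n) z) * h z)) \<longlonglongrightarrow> average f g * mean h"
proof -
  obtain C g1 where C: "C > 0" "lip_per 1 1 g1" "g = (\<lambda>z. C * g1 z)" using lip_per_scale[OF g] by blast
  obtain D h1 where D: "D > 0" "lip_per 1 1 h1" "h = (\<lambda>z. D * h1 z)" using lip_per_scale[OF h] by blast
  have "(\<lambda>n. mean (\<lambda>z. g1 (Phi f (t n) z) * h1 z) - average f g1 * mean h1) \<longlonglongrightarrow> 0"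
  proof (rule Lim_null_comparison)
    show "\<forall>\<^sub>F n in sequentially. norm (mean (\<lambda>z. g1 (Phi f (t n) z) * h1 z) - average f g1 * mean h1) \<le> inverse (real (Suc n))"
      using mix C(2) D(2) unfolding mixes_def real_norm_def by (intro always_eventually allI) (simp add: inverse_eq_divide)
  qed (rule LIMSEQ_inverse_real_of_nat)
  then have "(\<lambda>n. mean (\<lambda>z. g1 (Phi f (t n) z) * h1 z)) \<longlonglongrightarrow> average f g1 * mean h1" by (rule LIM_zero_cancel)
  then have "(\<lambda>n. C * D * mean (\<lambda>z. g1 (Phi f (t n) z) * h1 z)) \<longlonglongrightarrow> C * D * (average f g1 * mean h1)"
    by (rule tendsto_mult_left)
  moreover have "C * D * mean (\<lambda>z. g1 (Phi f (t n) z) * h1 z) = mean (\<lambda>z. g (Phi f (t n) z) * h z)" for n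
    using mean_cmult[of "C * D" "\<lambda>z. g1 (Phi f (t n) z) * h1 z"] by (simp add: C(3) D(3) mult_ac)
  moreover have "C * D * (average f g1 * mean h1) = average f g * mean h"
    using mean_cmult[of C "\<lambda>z. g1 z * f z"] mean_cmult[of D h1] by (simp add: C(3) D(3) average_def mult_ac)
  ultimately show ?thesis by simp
qed

definition correlation :: "(real \<times> real \<Rightarrow> real) \<Rightarrow> (real \<times> real \<Rightarrow> real) \<Rightarrow> (real \<times> real \<Rightarrow> real) \<Rightarrow> real \<Rightarrow> real" where
  "correlation f h g t = (LINT p|tmeas f. h (rep p) * g (Phi f t (rep p)))"

lemma correlation_integrable:
  assumes f: "adm f" and g: "lip_per K B g" and h: "lip_per K' B' h"
  shows "integrable (tmeas f) (\<lambda>p. h (rep p) * g (Phi f t (rep p)))"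
    "correlation f h g t = average f (\<lambda>z. h z * g (Phi f t z))"
proof -
  obtain Kf Bf where fl: "lip_per Kf Bf f" using f by (auto simp: adm_def)
  note l = lip_per_mult[OF h lip_per_Phi[OF f fl g, of t]]
  interpret prob_space "tmeas f" by (rule prob_space_tmeas[OF f])
  show "integrable (tmeas f) (\<lambda>p. h (rep p) * g (Phi f t (rep p)))"
    by (rule integrable_lift[OF finite_measure_axioms sets_tmeas(1) l])
  show "correlation f h g t = average f (\<lambda>z. h z * g (Phi f t z))"
    unfolding correlation_def by (rule integral_tmeas[OF f l])
qed

text \<open>Using \<open>h * f\<close> as the second test function turns the Lebesgue integral in
  \<open>mixes\<close> into one against the invariant measure.\<close>

lemma correlation_limit:
  assumes f: "adm f" and mix: "\<And>n::nat. mixes f (t n) (1 / Suc n)"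
    and g: "lip_per K B g" and h: "lip_per K' B' h"
  shows "(\<lambda>n. correlation f h g (t n)) \<longlonglongrightarrow> average f h * average f g"
proof -
  obtain Kf Bf where fl: "lip_per Kf Bf f" using f by (auto simp: adm_def)
  have "(\<lambda>n. mean (\<lambda>z. g (Phi f (t n) z) * (h z * f z)) / mean f) \<longlonglongrightarrow> average f g * mean (\<lambda>z. h z * f z) / mean f"
    using mean_ge_1[OF f] by (intro tendsto_divide mixes_limit[OF f mix g lip_per_mult[OF h fl]] tendsto_const) simp
  then show ?thesis
    unfolding correlation_integrable(2)[OF f g h] by (simp add: average_def mult_ac)
qed

lemma correlation_continuous:
  assumes f: "adm f" and g: "lip_per K B g" and h: "lip_per K' 1 h"
  shows "\<bar>correlation f h g t - correlation f h g t'\<bar> \<le> K * norm v * \<bar>t - t'\<bar>"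
proof -
  interpret prob_space "tmeas f" by (rule prob_space_tmeas[OF f])
  note i = correlation_integrable(1)[OF f g h]
  have "correlation f h g t - correlation f h g t' =
      (LINT p|tmeas f. h (rep p) * g (Phi f t (rep p)) - h (rep p) * g (Phi f t' (rep p)))"
    unfolding correlation_def by (rule Bochner_Integration.integral_diff[symmetric]; rule i)
  also have "\<bar>\<dots>\<bar> \<le> (LINT p|tmeas f. K * norm v * \<bar>t - t'\<bar>)"
  proof (rule abs_integral_le)
    fix p
    have "\<bar>g (Phi f t (rep p)) - g (Phi f t' (rep p))\<bar> \<le> K * norm (Phi f t (rep p) - Phi f t' (rep p))"
      by (rule lip_perD(3)[OF g])
    also have "\<dots> \<le> K * (\<bar>t - t'\<bar> * norm v)"
      using lip_per_nonneg[OF g] by (intro mult_left_mono Phi_lip_time f)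
    finally have "\<bar>h (rep p)\<bar> * \<bar>g (Phi f t (rep p)) - g (Phi f t' (rep p))\<bar> \<le> 1 * (K * (\<bar>t - t'\<bar> * norm v))"
      using lip_perD(2)[OF h] by (intro mult_mono) auto
    then show "\<bar>h (rep p) * g (Phi f t (rep p)) - h (rep p) * g (Phi f t' (rep p))\<bar> \<le> K * norm v * \<bar>t - t'\<bar>"
      by (simp add: right_diff_distrib[symmetric] abs_mult mult_ac)
  qed (auto intro!: Bochner_Integration.integrable_diff i)
  finally show ?thesis by (simp add: prob_space)
qed

text \<open>One pair \<open>g\<close>, \<open>h\<close> works for all times at once, since
  invariance carries the approximation error of \<open>B\<close> along the flow unchanged.
  Continuity in time and the limit along the mixing times both follow from this.\<close>

lemma correlation_approx:
  assumes f: "adm f" and A: "A \<in> sets (tmeas f)" and B: "B \<in> sets (tmeas f)" and e: "\<epsilon> > 0"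
  shows "\<exists>K g K' h. lip_per K 1 g \<and> lip_per K' 1 h \<and>
    (\<forall>t. \<bar>measure (tmeas f) (A \<inter> (tflow f t -` B \<inter> space (tmeas f))) - correlation f h g t\<bar> \<le> \<epsilon>) \<and>
    \<bar>measure (tmeas f) A * measure (tmeas f) B - average f h * average f g\<bar> \<le> \<epsilon>"
proof -
  interpret prob_space "tmeas f" by (rule prob_space_tmeas[OF f])
  note M = finite_measure_axioms sets_tmeas(1)[of f]
  have e2: "\<epsilon> / 2 > 0" using e by simp
  obtain K g where g: "lip_per K 1 g" "\<And>z. 0 \<le> g z" "(LINT p|tmeas f. \<bar>indicator B p - g (rep p)\<bar>) < \<epsilon> / 2"
    using lip_approx_borel[OF M B] e2 unfolding lip_approx_def by blast
  obtain K' h where h: "lip_per K' 1 h" "\<And>z. 0 \<le> h z" "(LINT p|tmeas f. \<bar>indicator A p - h (rep p)\<bar>) < \<epsilon> / 2"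
    using lip_approx_borel[OF M A] e2 unfolding lip_approx_def by blast
  have iA: "integrable (tmeas f) (\<lambda>p. \<bar>indicator A p - h (rep p)\<bar>)" by (rule integrable_approx_diff[OF M A h(1)])
  have iB: "integrable (tmeas f) (\<lambda>p. \<bar>indicator B p - g (rep p)\<bar>)" by (rule integrable_approx_diff[OF M B g(1)])
  have bound: "\<bar>a * b - x * y\<bar> \<le> \<bar>a - x\<bar> + \<bar>b - y\<bar>" if "\<bar>b\<bar> \<le> 1" "\<bar>x\<bar> \<le> 1" for a b x y :: real
  proof -
    have "a * b - x * y = (a - x) * b + x * (b - y)" by (simp add: algebra_simps)
    then have "\<bar>a * b - x * y\<bar> \<le> \<bar>a - x\<bar> * \<bar>b\<bar> + \<bar>x\<bar> * \<bar>b - y\<bar>" by (metis abs_mult abs_triangle_ineq)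
    also have "\<dots> \<le> \<bar>a - x\<bar> * 1 + 1 * \<bar>b - y\<bar>" using that by (intro add_mono mult_mono) auto
    finally show ?thesis by simp
  qed
  have "\<bar>measure (tmeas f) (A \<inter> (tflow f t -` B \<inter> space (tmeas f))) - correlation f h g t\<bar> \<le> \<epsilon>" for t
  proof -
    have m: "tflow f t \<in> measurable (tmeas f) (tmeas f)" and d: "distr (tmeas f) (tmeas f) (tflow f t) = tmeas f"
      using invariant_tmeas[OF f] by (auto simp: invariant_prob_def)
    let ?P = "tflow f t -` B \<inter> space (tmeas f)"
    have P: "?P \<in> sets (tmeas f)" by (rule measurable_sets[OF m B])
    have iBt: "integrable (tmeas f) (\<lambda>p. \<bar>indicator B (tflow f t p) - g (rep (tflow f t p))\<bar>)"
      and eBt: "(LINT p|tmeas f. \<bar>indicator B (tflow f t p) - g (rep (tflow f t p))\<bar>) < \<epsilon> / 2"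
    proof -
      have bm: "(\<lambda>p. \<bar>indicator B p - g (rep p)\<bar>) \<in> borel_measurable (tmeas f)"
        using iB by (rule borel_measurable_integrable)
      show "integrable (tmeas f) (\<lambda>p. \<bar>indicator B (tflow f t p) - g (rep (tflow f t p))\<bar>)"
        using iB integrable_distr_eq[OF m bm] by (simp add: d)
      show "(LINT p|tmeas f. \<bar>indicator B (tflow f t p) - g (rep (tflow f t p))\<bar>) < \<epsilon> / 2"
        using g(3) integral_distr[OF m bm] by (simp add: d)
    qed
    have iAP: "integrable (tmeas f) (indicator (A \<inter> ?P) :: _ \<Rightarrow> real)"
      by (rule integrable_indicator_finite[OF M(1)]) (use A P in auto)
    note ic = correlation_integrable(1)[OF f g(1) h(1)]
    have "measure (tmeas f) (A \<inter> ?P) - correlation f h g t =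
        (LINT p|tmeas f. indicator (A \<inter> ?P) p - h (rep p) * g (Phi f t (rep p)))"
      using A P by (simp add: correlation_def Bochner_Integration.integral_diff[OF iAP ic])
    also have "\<bar>\<dots>\<bar> \<le> (LINT p|tmeas f. \<bar>indicator A p - h (rep p)\<bar> + \<bar>indicator B (tflow f t p) - g (rep (tflow f t p))\<bar>)"
    proof (rule abs_integral_le)
      fix p
      have "indicator (A \<inter> ?P) p = (indicator A p * indicator B (tflow f t p) :: real)"
        by (auto simp: indicator_def sets_tmeas)
      then have eq: "indicator (A \<inter> ?P) p - h (rep p) * g (Phi f t (rep p)) =
          indicator A p * indicator B (tflow f t p) - h (rep p) * g (rep (tflow f t p))"
        by (simp add: lift_tflow[OF lip_perD(1)[OF g(1)]])
      have "\<bar>indicator B (tflow f t p) :: real\<bar> \<le> 1" by (simp add: indicator_def)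
      from bound[OF this lip_perD(2)[OF h(1)]]
      show "\<bar>indicator (A \<inter> ?P) p - h (rep p) * g (Phi f t (rep p))\<bar> \<le>
          \<bar>indicator A p - h (rep p)\<bar> + \<bar>indicator B (tflow f t p) - g (rep (tflow f t p))\<bar>"
        unfolding eq .
    qed (intro Bochner_Integration.integrable_diff Bochner_Integration.integrable_add iAP ic iA iBt)+
    also have "\<dots> = (LINT p|tmeas f. \<bar>indicator A p - h (rep p)\<bar>) + (LINT p|tmeas f. \<bar>indicator B (tflow f t p) - g (rep (tflow f t p))\<bar>)"
      by (rule Bochner_Integration.integral_add[OF iA iBt])
    also have "\<dots> \<le> \<epsilon> / 2 + \<epsilon> / 2" using h(3) eBt by (intro add_mono) auto
    finally show ?thesis by simp
  qed
  moreover have "\<bar>measure (tmeas f) A * measure (tmeas f) B - average f h * average f g\<bar> \<le> \<epsilon>"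
  proof -
    have near: "\<bar>measure (tmeas f) C - average f k\<bar> \<le> \<epsilon> / 2"
      if C: "C \<in> sets (tmeas f)" and k: "lip_per Kk 1 k" and le: "(LINT p|tmeas f. \<bar>indicator C p - k (rep p)\<bar>) < \<epsilon> / 2" for C k Kk
    proof -
      have "measure (tmeas f) C - average f k = (LINT p|tmeas f. indicator C p - k (rep p))"
        using C integrable_indicator_finite[OF M(1) C] integrable_lift[OF M k]
        by (simp add: integral_tmeas[OF f k])
      also have "\<bar>\<dots>\<bar> \<le> (LINT p|tmeas f. \<bar>indicator C p - k (rep p)\<bar>)" by (rule integral_abs_bound)
      finally show ?thesis using le by linarith
    qed
    have "\<bar>average f h\<bar> \<le> 1" by (rule average_abs_le[OF f lip_per_cont[OF h(1)]]) (rule lip_perD(2)[OF h(1)])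
    moreover have "\<bar>measure (tmeas f) B\<bar> \<le> 1" by simp
    ultimately show ?thesis using bound[of "measure (tmeas f) B" "average f h" "measure (tmeas f) A" "average f g"]
      near[OF A h(1,3)] near[OF B g(1,3)] by linarith
  qed
  ultimately show ?thesis using g(1) h(1) by blast
qed

lemma weakly_mixing_tmeas:
  assumes f: "adm f" and mix: "\<And>n::nat. mixes f (t n) (1 / Suc n)"
  shows "weakly_mixing (tmeas f) (tflow f)"
proof (rule weakly_mixing_if_mixing_sequence[where \<tau> = t])
  show "prob_space (tmeas f)" by (rule prob_space_tmeas[OF f])
  show "tflow f s \<in> measurable (tmeas f) (tmeas f)" "distr (tmeas f) (tmeas f) (tflow f s) = tmeas f" for s
    using invariant_tmeas[OF f] by (auto simp: invariant_prob_def)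
  show "tflow f (s + r) p = tflow f s (tflow f r p)" for s r p by (rule tflow_add[OF f])
  fix A B assume A: "A \<in> sets (tmeas f)" and B: "B \<in> sets (tmeas f)"
  define c where "c s = measure (tmeas f) (A \<inter> (tflow f s -` B \<inter> space (tmeas f)))" for s
  show "continuous_on UNIV (\<lambda>s. measure (tmeas f) (A \<inter> (tflow f s -` B \<inter> space (tmeas f))))"
    unfolding c_def[symmetric] continuous_on_iff
  proof (intro ballI allI impI)
    fix s e :: real assume "e > 0"
    then have e: "e / 4 > 0" by simp
    obtain K g K' h where gh: "lip_per K 1 g" "lip_per K' 1 h" "\<And>s. \<bar>c s - correlation f h g s\<bar> \<le> e / 4"
      using correlation_approx[OF f A B e] unfolding c_def by blast
    define d where "d = e / (4 * (K * norm v + 1))"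
    have Kv: "K * norm v \<ge> 0" using lip_per_nonneg[OF gh(1)] by simp
    then have d: "d > 0" using \<open>e > 0\<close> by (simp add: d_def add_nonneg_pos)
    have "dist (c s') (c s) < e" if "dist s' s < d" for s'
    proof -
      have "\<bar>correlation f h g s' - correlation f h g s\<bar> \<le> K * norm v * \<bar>s' - s\<bar>"
        by (rule correlation_continuous[OF f gh(1,2)])
      also have "\<dots> \<le> (K * norm v + 1) * d"
        using that Kv by (intro mult_mono) (auto simp: dist_real_def)
      also have "\<dots> = e / 4" using Kv by (simp add: d_def field_simps add_nonneg_eq_0_iff)
      finally show ?thesis using gh(3)[of s] gh(3)[of s'] \<open>e > 0\<close> unfolding dist_real_def by linarith
    qed
    then show "\<exists>d>0. \<forall>s'\<in>UNIV. dist s' s < d \<longrightarrow> dist (c s') (c s) < e" using d by blast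
  qed
  show "(\<lambda>n. measure (tmeas f) (A \<inter> (tflow f (t n) -` B \<inter> space (tmeas f)))) \<longlonglongrightarrow> measure (tmeas f) A * measure (tmeas f) B"
    unfolding c_def[symmetric]
  proof (rule LIMSEQ_I)
    fix e :: real assume "e > 0"
    then have e: "e / 4 > 0" by simp
    obtain K g K' h where gh: "lip_per K 1 g" "lip_per K' 1 h" "\<And>s. \<bar>c s - correlation f h g s\<bar> \<le> e / 4"
      "\<bar>measure (tmeas f) A * measure (tmeas f) B - average f h * average f g\<bar> \<le> e / 4"
      using correlation_approx[OF f A B e] unfolding c_def by blast
    from LIMSEQ_D[OF correlation_limit[OF f mix gh(1,2)] e]
    obtain N where N: "\<And>n. n \<ge> N \<Longrightarrow> norm (correlation f h g (t n) - average f h * average f g) < e / 4" by blast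
    have "norm (c (t n) - measure (tmeas f) A * measure (tmeas f) B) < e" if "n \<ge> N" for n
      using N[OF that] gh(3)[of "t n"] gh(4) \<open>e > 0\<close> unfolding real_norm_def by linarith
    then show "\<exists>N. \<forall>n\<ge>N. norm (c (t n) - measure (tmeas f) A * measure (tmeas f) B) < e" by blast
  qed
qed

section \<open>Dense prime orbits and conclusion\<close>

lemma prime_orbit_dense:
  assumes f: "adm f" and pd: "\<And>n::nat. \<exists>P. prime_dense f P (1 / Suc n)"
  shows "closure {tflow f (real p) x | p :: nat. prime p} = UNIV"
proof (rule ccontr)
  let ?S = "{tflow f (real p) x | p :: nat. prime p}"
  assume "closure ?S \<noteq> UNIV"
  then obtain y where y: "y \<in> - closure ?S" by blast
  have "open (torus_of -` (- closure ?S))" by (simp only: open_torus_iff[symmetric]) (rule open_Compl, rule closed_closure)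
  moreover have "rep y \<in> torus_of -` (- closure ?S)" using y by simp
  ultimately obtain e where e: "e > 0" "ball (rep y) e \<subseteq> torus_of -` (- closure ?S)"
    by (rule openE)
  obtain n where n: "inverse (real (Suc n)) < e" using reals_Archimedean[OF e(1)] by blast
  obtain P where "prime_dense f P (1 / Suc n)" using pd by blast
  then obtain p m where pm: "prime p" "m \<in> \<int> \<times> \<int>" "norm (Phi f (real p) (rep x) - rep y - m) < 1 / Suc n"
    unfolding prime_dense_def by blast
  define w where "w = Phi f (real p) (rep x) - m"
  have "dist (rep y) w < e"
    using pm(3) n by (simp add: w_def dist_norm norm_minus_commute inverse_eq_divide algebra_simps)
  then have "torus_of w \<notin> closure ?S" using e(2) by (auto simp: subset_iff simp del: split_paired_All)
  moreover have "torus_of w = tflow f (real p) x"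
    using torus_of_add_Ints[OF pm(2), of w] by (simp add: w_def tflow_def)
  then have "torus_of w \<in> ?S" using pm(1) by blast
  ultimately show False using closure_subset[of ?S] by blast
qed

end

lemma weakly_mixing_flow_exists:
  assumes irr: "\<alpha> \<notin> \<rat>" and li: "liouville \<alpha>"
  shows "\<exists>(r :: torus \<Rightarrow> real) (\<phi> :: real \<Rightarrow> torus \<Rightarrow> torus) (\<mu> :: torus measure).
        smooth_on_torus r \<and> (\<forall>x. r x > 0) \<and>
        is_reparam_flow \<alpha> r \<phi> \<and>
        unique_invariant_prob \<phi> \<mu> \<and>
        weakly_mixing \<mu> \<phi> \<and>
        (\<forall>x. closure {\<phi> (real p) x | p :: nat. prime p} = UNIV)"
proof -
  interpret irrational_slope \<alpha> by unfold_locales (rule irr)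
  obtain c where c: "c \<ge> 2" "generic_speed c" using generic_speed_exists by blast
  obtain a p q where sm: "\<And>k. summable (\<lambda>n. \<bar>a n\<bar> * (1 + \<bar>of_int (p n)\<bar> + real (q n)) ^ k)"
    and f: "adm (wave_sum c a p q)"
    and st: "\<And>n::nat. \<exists>t P. mixes (wave_sum c a p q) t (1 / Suc n) \<and> prime_dense (wave_sum c a p q) P (1 / Suc n)"
    using mixing_speed_exists[OF li c] by blast
  define f where "f = wave_sum c a p q"
  note f = f[folded f_def] and st = st[folded f_def]
  define r where "r = (\<lambda>x. inverse (f (rep x)))"
  obtain t where t: "\<And>n::nat. mixes f (t n) (1 / Suc n)" using st by metis
  have pos: "f z > 0" for z using admD(1)[OF f, of z] by linarith
  have "smooth_on_torus r"
  proof -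
    have "r \<circ> torus_of = (\<lambda>z. inverse (f z))"
      by (rule ext) (simp only: o_def r_def rep_torus_of[OF adm_periodic[OF f]])
    moreover have "C_k k (\<lambda>z. inverse (f z))" for k
      unfolding f_def by (rule C_k_inverse[OF _ C_k_wave_sum[OF sm]]) (use pos[unfolded f_def] in \<open>metis less_irrefl\<close>)
    ultimately show ?thesis by (simp add: smooth_on_torus_def)
  qed
  moreover have "\<forall>x. r x > 0" using pos by (simp only: r_def positive_imp_inverse_positive) simp
  moreover have "is_reparam_flow \<alpha> r (tflow f)" unfolding r_def by (rule is_reparam_flow_tflow[OF f])
  moreover have "unique_invariant_prob (tflow f) (tmeas f)" by (rule unique_invariant_tmeas[OF f])
  moreover have "weakly_mixing (tmeas f) (tflow f)" by (rule weakly_mixing_tmeas[OF f t])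
  moreover have "\<forall>x. closure {tflow f (real p) x | p :: nat. prime p} = UNIV"
    using prime_orbit_dense[OF f] st by blast
  ultimately show ?thesis by blast
qed

theorem corollary1:
  "uncountable {\<alpha> :: real. \<alpha> \<notin> \<rat> \<and>
     (\<exists>(r :: torus \<Rightarrow> real) (\<phi> :: real \<Rightarrow> torus \<Rightarrow> torus) (\<mu> :: torus measure).
        smooth_on_torus r \<and> (\<forall>x. r x > 0) \<and>
        is_reparam_flow \<alpha> r \<phi> \<and>
        unique_invariant_prob \<phi> \<mu> \<and>
        weakly_mixing \<mu> \<phi> \<and>
        (\<forall>x. closure {\<phi> (real p) x | p :: nat. prime p} = UNIV))}"
proof -
  have "{\<alpha>. \<alpha> \<notin> \<rat> \<and> liouville \<alpha>} \<subseteq> {\<alpha>. \<alpha> \<notin> \<rat> \<and> (\<exists>r \<phi> \<mu>.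
        smooth_on_torus r \<and> (\<forall>x. r x > 0) \<and> is_reparam_flow \<alpha> r \<phi> \<and>
        unique_invariant_prob \<phi> \<mu> \<and> weakly_mixing \<mu> \<phi> \<and>
        (\<forall>x. closure {\<phi> (real p) x | p :: nat. prime p} = UNIV))}"
    using weakly_mixing_flow_exists by (intro Collect_mono impI conjI) auto
  then show ?thesis using uncountable_liouville countable_subset by blast
qed

end
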